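(* The Fourier transform $F\mapsto\widehat F$ restricts to an isomorphism of the topological vector spaces $\mathcal S(\mathrm{HC})$ and $\mathcal S(\mathbb R,\mathcal H)$. Its inverse is given, for $A\in\mathcal S(\mathbb R,\mathcal H)$, by $$\mathcal F^{-1}(A)(u;x)=\frac1{2\pi}\int_{\mathbb R}A(u;\zeta)\,e^{ix\zeta}\,d\zeta .$$
   Context: Algebra. Let $V$ be a purely odd real super vector space of dimension $n\ge 1$ with a positive definite symmetric bilinear form $\beta$, and fix an orthonormal basis $a_1,\dots,a_n$. The Heisenberg--Clifford Lie superalgebra is $\mathfrak{hc}=V\oplus\mathbb R z$ with $z$ even and central, $V$ odd, and $[u+\lambda z,v+\mu z]=2\beta(u,v)z$. Its universal enveloping algebra $\mathfrak U(\mathfrak{hc})$ is the unital real superalgebra generated by odd $a_1,\dots,a_n$ and an even central element $z$ with $a_ia_j=-a_ja_i$ ($i\ne j$) and $a_i^2=z$. Parity is denoted $|\cdot|$. For $I=\{i_1<\dots<i_r\}\subset\{1,\dots,n\}$ put $a_I=a_{i_1}\cdots a_{i_r}$ ($a_\emptyset=1$), and $\gamma=a_1\cdots a_n$. The antipode $S$ is the even unital linear map with $S(uv)=(-1)^{|u||v|}S(v)S(u)$ and $S(x)=-x$ for $x\in\mathfrak{hc}$. The coproduct $\Delta:\mathfrak U(\mathfrak{hc})\to\mathfrak U(\mathfrak{hc})\otimes\mathfrak U(\mathfrak{hc})$ is the even unital algebra homomorphism with $\Delta(x)=x\otimes1+1\otimes x$ for $x\in\mathfrak{hc}$, where $(a\otimes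 b)(c\otimes d)=(-1)^{|b||c|}ac\otimes bd$. Write $\Delta(\gamma)=\sum_i\gamma_i^{(1)}\otimes\gamma_i^{(2)}$ with homogeneous terms. Functions. $\mathcal C^\infty(\mathrm{HC})$ is the space of linear maps $F:\mathfrak U(\mathfrak{hc})\to C^\infty(\mathbb R)$ (smooth functions on $\mathbb R$) with $F(zu)=F(u)'$ for all $u$; write $F(u;x)=F(u)(x)$. $F$ is even (odd) if it vanishes on odd (even) elements. For homogeneous $u,F$ define $(L_uF)(v;y)=(-1)^{|u||F|}F(S(u)v;y)$, extended bilinearly. The Schwartz space $\mathcal S(\mathrm{HC})$ is the space of $F\in\mathcal C^\infty(\mathrm{HC})$ with $s_{j,u}(F)=\sup_{x\in\mathbb R}|x^j(L_uF)(1;x)|<\infty$ for all $j\in\mathbb N$, $u\in\mathfrak U(\mathfrak{hc})$, topologized by these seminorms (equivalently, all $F(u)$ lie in the classical Schwartz space $\mathcal S(\mathbb R)$). Representations. For $\zeta\in\mathbb C$ put $\sigma=\begin{pmatrix}1&0\\0&-1\end{pmatrix}$, $X_\zeta=\begin{pmatrix}0&\zeta\\1&0\end{pmatrix}$, $Y_\zeta=\begin{pmatrix}0&i\zeta\\-i&0\end{pmatrix}$. If $n=2k$: the spin module is $(\mathbb C^{1|1})^{\otimes k}$, $\mathcal H_\zeta=\mathrm{Mat}_{2^k}(\mathbb C)=\mathrm{End}((\mathbb C^{1|1})^{\otimes k})$, and for $1\le j\le k$, $c_\zeta(a_{2j-1})=\sigma^{\otimes(j-1)}\otimes X_\zeta\otimes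 1^{\otimes(k-j)}$, $c_\zeta(a_{2j})=\sigma^{\otimes(j-1)}\otimes Y_\zeta\otimes1^{\otimes(k-j)}$. If $n=2k+1$: let $D_\zeta=\mathbb C[\epsilon]$ with $\epsilon$ odd, $\epsilon^2=\zeta$; the spin module is $D_\zeta\otimes\mathbb C^{2^k}$ (graded by the grading of $D_\zeta$), and $\mathcal H_\zeta=D_\zeta\otimes\mathrm{Mat}_{2^k}(\mathbb C)=\mathrm{End}_{D_\zeta}(D_\zeta\otimes\mathbb C^{2^k})$; let $C_1,\dots,C_{2k}\in \mathrm{Mat}_{2^k}(\mathbb C)$ be the matrices $c_1(a_1),\dots,c_1(a_{2k})$ of the even case with parameter $1$, $\Gamma=\sigma^{\otimes k}$, and $c_\zeta(a_1)=\epsilon\otimes\Gamma$, $c_\zeta(a_{j+1})=\epsilon\otimes(-i\,\Gamma C_j)$ for $1\le j\le 2k$. $\mathcal H$ denotes the underlying complex vector space of $\mathcal H_\zeta$, which does not depend on $\zeta$ (for odd $n$ it is $\mathrm{Mat}_{2^k}(\mathbb C)\oplus\epsilon\,\mathrm{Mat}_{2^k}(\mathbb C)$). In both cases $d\pi_\zeta:\mathfrak U(\mathfrak{hc})\to\mathcal H_\zeta$ is the unital algebra homomorphism with $d\pi_\zeta(a_j)=e^{i\pi/4}c_\zeta(a_j)$ and $d\pi_\zeta(z)=i\zeta$. Super adjoint. For real $\eta\neq0$ the spin module with parameter $\eta$ carries a sesquilinear form $(\cdot,\cdot)_\eta$ (linear in the first argument) for which all $c_\eta(v)$, $v\in V$,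 are self-adjoint: on $\mathbb C^{1|1}$, and on $D_\eta\cong\mathbb C^2$ with basis $1,\epsilon$, it is $(u,v)_\eta=u_1\bar v_1+\eta u_2\bar v_2$; on $(\mathbb C^{1|1})^{\otimes k}$ it is the tensor product form, and on $D_\eta\otimes\mathbb C^{2^k}$ it is the tensor product with the standard inner product of $\mathbb C^{2^k}$. Put $\langle u|v\rangle=i^{|u||v|}(u,v)_\eta$ for homogeneous $u,v$. The super adjoint $B^\dagger$ of a homogeneous $B\in\mathcal H_\eta$ is determined by $\langle Bu|v\rangle=(-1)^{|u||B|}\langle u|B^\dagger v\rangle$, and $B\mapsto B^\dagger$ is extended conjugate-linearly. Functional $T$. On $\mathcal H_\zeta$ define $T(A)=\mathrm{STr}(A)=\mathrm{Tr}(\sigma^{\otimes k}A)$ if $n=2k$, and $T(A)=\mathrm{Tr}(e^{i\pi/4}\epsilon A)$ if $n=2k+1$, where $\mathrm{Tr}$ is the trace over $\mathbb C$ of an endomorphism of the spin module. Put $\langle A|B\rangle=T(AB^\dagger)$. Let $[n]=n/2$ for $n$ even and $[n]=(n+1)/2$ for $n$ odd. Fourier transform. For $F\in\mathcal C_c^\infty(\mathrm{HC})$ (all $F(u)$ supported in a common compact set) or $F\in\mathcal S(\mathrm{HC})$, and $\zeta\in\mathbb R$, $\widehat F(\zeta)=\int_{\mathrm{HC}}F\cdot\pi_{-\zeta}$ with $\pi_{-\zeta}(u;x)=e^{-i\zeta x}d\pi_{-\zeta}(u)$; explicitly $$\widehat F(\zeta)=\sum_i\Big(\int_{\mathbb R}F(\gamma_i^{(1)};x)e^{-i\zeta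 x}\,dx\Big)\,d\pi_{-\zeta}(\gamma_i^{(2)})\in\mathcal H.$$ The space $\mathcal S(\mathbb R,\mathcal H)$. For any map $A:\mathbb R\to\mathcal H$, $u\in\mathfrak U(\mathfrak{hc})$ and non-zero $\zeta\in\mathbb R$ put $$A(u;\zeta)=\langle A(\zeta)\,|\,d\pi_{-\zeta}(u)\rangle\,(-2\zeta)^{-[n]}=T\big(A(\zeta)\,d\pi_{-\zeta}(u)^\dagger\big)(-2\zeta)^{-[n]},$$ with product, $T$ and $\dagger$ taken in $\mathcal H_{-\zeta}$. $\mathcal S(\mathbb R,\mathcal H)$ is the space of maps $A:\mathbb R\to\mathcal H$ such that for all $u\in\mathfrak U(\mathfrak{hc})$ and all $k\ge0$ the function $A(u;\zeta)$ is smooth on $\mathbb R$ and $s_{k,u}(A)=\sup_{\zeta\in\mathbb R}\big|\frac{d^k}{d\zeta^k}A(u;\zeta)\big|<\infty$. Its locally convex topology is defined by the countable family of seminorms $s_{k,z^ja_J}$, $k,j\ge0$, $J\subset\{1,\dots,n\}$.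
   Formalization: S(R,H) is taken to consist of maps A also continuous at 0 (A(0) is otherwise undetermined), with A(u;0) read as a limit; for odd n the inverse formula, false as displayed, is corrected by a factor -i for even u and i for odd u. *)

theory Defs
  imports "HOL-Analysis.Analysis"
begin

section \<open>Superalgebras with a basis that is multiplicative up to sign\<close>

text \<open>
  A basis index type with product \<^term>\<open>bmul\<close>, sign \<^term>\<open>bsgn\<close> and parity \<^term>\<open>bodd\<close>
  describes the real superalgebra with basis \<open>e b\<close> and \<open>e b * e c = bsgn b c e (bmul b c)\<close>.
  Enveloping algebras of Heisenberg--Clifford Lie superalgebras and their
  super tensor products are of this form.
\<close>

class super_basis =
  fixes bone :: 'a
    and bmul :: "'a \<Rightarrow> 'a \<Rightarrow> 'a"
    and bsgn :: "'a \<Rightarrow> 'a \<Rightarrow> real"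
    and bodd :: "'a \<Rightarrow> bool"
  assumes bmul_assoc: "bmul (bmul a b) c = bmul a (bmul b c)"
    and bmul_one [simp]: "bmul bone a = a" "bmul a bone = a"
    and bsgn_cocycle: "bsgn a b * bsgn (bmul a b) c = bsgn b c * bsgn a (bmul b c)"
    and bsgn_one [simp]: "bsgn bone a = 1" "bsgn a bone = 1"
    and bodd_one [simp]: "\<not> bodd bone"
    and bodd_mul: "bodd (bmul a b) \<longleftrightarrow> bodd a \<noteq> bodd b"

typedef 'b salg = "{f :: 'b \<Rightarrow> real. finite {b. f b \<noteq> 0}}"
  morphisms coord Abs_salg
  by (rule exI[of _ "\<lambda>_. 0"]) simp

setup_lifting type_definition_salg

lemma finite_supp [simp]: "finite {b. coord x b \<noteq> 0}"
  using coord[of x] by simp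

lemma salg_eqI: "(\<And>b. coord x b = coord y b) \<Longrightarrow> x = y"
  by (simp add: coord_inject[symmetric] fun_eq_iff)

instantiation salg :: (type) real_vector
begin

lift_definition zero_salg :: "'a salg" is "\<lambda>_. 0" by simp
lift_definition plus_salg :: "'a salg \<Rightarrow> 'a salg \<Rightarrow> 'a salg" is "\<lambda>f g b. f b + g b"
proof -
  fix f g :: "'a \<Rightarrow> real"
  assume "finite {b. f b \<noteq> 0}" "finite {b. g b \<noteq> 0}"
  then show "finite {b. f b + g b \<noteq> 0}"
    by (rule_tac finite_subset[of _ "{b. f b \<noteq> 0} \<union> {b. g b \<noteq> 0}"]) auto
qed
lift_definition uminus_salg :: "'a salg \<Rightarrow> 'a salg" is "\<lambda>f b. - f b" by simp
lift_definition minus_salg :: "'a salg \<Rightarrow> 'a salg \<Rightarrow> 'a salg" is "\<lambda>f g b. f b - g b"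
proof -
  fix f g :: "'a \<Rightarrow> real"
  assume "finite {b. f b \<noteq> 0}" "finite {b. g b \<noteq> 0}"
  then show "finite {b. f b - g b \<noteq> 0}"
    by (rule_tac finite_subset[of _ "{b. f b \<noteq> 0} \<union> {b. g b \<noteq> 0}"]) auto
qed
lift_definition scaleR_salg :: "real \<Rightarrow> 'a salg \<Rightarrow> 'a salg" is "\<lambda>r f b. r * f b"
proof -
  fix r and f :: "'a \<Rightarrow> real"
  assume "finite {b. f b \<noteq> 0}"
  then show "finite {b. r * f b \<noteq> 0}"
    by (rule_tac finite_subset[of _ "{b. f b \<noteq> 0}"]) auto
qed

instance
  by standard (transfer; simp add: fun_eq_iff algebra_simps)+

end

lemma coord_simps [simp]:
  "coord 0 b = 0" "coord (x + y) b = coord x b + coord y b" "coord (- x) b = - coord x b"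
  "coord (x - y) b = coord x b - coord y b" "coord (r *\<^sub>R x) b = r * coord x b"
  by (transfer; simp)+

lift_definition basis_elt :: "'b \<Rightarrow> 'b salg" is "\<lambda>b c. if c = b then 1 else 0"
  by simp

lemma coord_basis_elt [simp]: "coord (basis_elt b) c = (if c = b then 1 else 0)"
  by transfer simp

lemma coord_sum: "coord (\<Sum>i\<in>A. f i) b = (\<Sum>i\<in>A. coord (f i) b)"
  by (induction A rule: infinite_finite_induct) auto

text \<open>Linear extension of a map given on the basis.\<close>

definition lin_ext :: "('b \<Rightarrow> 'v::real_vector) \<Rightarrow> 'b salg \<Rightarrow> 'v" where
  "lin_ext \<phi> x = (\<Sum>b | coord x b \<noteq> 0. coord x b *\<^sub>R \<phi> b)"

lemma lin_ext_supset:
  "finite B \<Longrightarrow> {b. coord x b \<noteq> 0} \<subseteq> B \<Longrightarrow> lin_ext \<phi> x = (\<Sum>b\<in>B. coord x b *\<^sub>R \<phi> b)"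
  unfolding lin_ext_def by (rule sum.mono_neutral_left) auto

lemma linear_lin_ext: "linear (lin_ext \<phi>)"
proof (rule linearI)
  fix x y :: "'a salg" and r
  let ?B = "{b. coord x b \<noteq> 0} \<union> {b. coord y b \<noteq> 0}"
  have "lin_ext \<phi> z = (\<Sum>b\<in>?B. coord z b *\<^sub>R \<phi> b)" if "{b. coord z b \<noteq> 0} \<subseteq> ?B" for z
    using that by (intro lin_ext_supset) auto
  from this[of x] this[of y] this[of "x + y"]
  show "lin_ext \<phi> (x + y) = lin_ext \<phi> x + lin_ext \<phi> y"
    by (fastforce simp: scaleR_add_left sum.distrib)
  have "lin_ext \<phi> (r *\<^sub>R x) = (\<Sum>b | coord x b \<noteq> 0. coord (r *\<^sub>R x) b *\<^sub>R \<phi> b)"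
    by (rule lin_ext_supset) auto
  then show "lin_ext \<phi> (r *\<^sub>R x) = r *\<^sub>R lin_ext \<phi> x"
    by (simp add: lin_ext_def scaleR_sum_right)
qed

lemmas lin_ext_add = linear_add[OF linear_lin_ext]
  and lin_ext_scale = linear_scale[OF linear_lin_ext]

lemma lin_ext_basis [simp]: "lin_ext \<phi> (basis_elt b) = \<phi> b"
proof -
  have "{c. coord (basis_elt b) c \<noteq> 0} = {b}" by auto
  then show ?thesis by (simp add: lin_ext_def)
qed

lemma salg_expand: "x = lin_ext basis_elt x"
proof (rule salg_eqI)
  fix c
  have "coord (lin_ext basis_elt x) c
      = (\<Sum>b | coord x b \<noteq> 0. coord x b * (if c = b then 1 else 0))"
    by (simp add: lin_ext_def coord_sum)
  also have "\<dots> = coord x c" by (auto simp: if_distrib sum.delta cong: if_cong)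
  finally show "coord x c = coord (lin_ext basis_elt x) c" by simp
qed

lemma linear_eq_on_basis:
  assumes "linear f" "linear g" "\<And>b. f (basis_elt b) = g (basis_elt b)"
  shows "f x = g x"
proof -
  have "f (lin_ext basis_elt x) = g (lin_ext basis_elt x)"
    unfolding lin_ext_def using assms by (simp add: linear_sum linear_scale)
  then show ?thesis by (simp flip: salg_expand)
qed

instantiation salg :: (super_basis) real_algebra_1
begin

definition one_salg :: "'a salg" where
  "1 = basis_elt bone"

definition times_salg :: "'a salg \<Rightarrow> 'a salg \<Rightarrow> 'a salg" where
  "x * y = lin_ext (\<lambda>b. lin_ext (\<lambda>c. bsgn b c *\<^sub>R basis_elt (bmul b c)) y) x"

lemma lin_times_left: "linear (\<lambda>x :: 'a salg. x * y)"
  unfolding times_salg_def by (rule linear_lin_ext)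

lemma lin_times_right: "linear (\<lambda>y :: 'a salg. x * y)"
proof (rule linearI)
  fix y z :: "'a salg" and r
  show "x * (y + z) = x * y + x * z"
    by (simp add: times_salg_def lin_ext_def[of _ x] lin_ext_add scaleR_add_right sum.distrib)
  show "x * (r *\<^sub>R y) = r *\<^sub>R (x * y)"
    by (simp add: times_salg_def lin_ext_def[of _ x] lin_ext_scale scaleR_sum_right
        mult.commute)
qed

lemma basis_times: "basis_elt b * basis_elt (c :: 'a) = bsgn b c *\<^sub>R basis_elt (bmul b c)"
  by (simp add: times_salg_def)

instance
proof
  fix x y z :: "'a salg" and r :: real
  note L = linear_add[OF lin_times_left] linear_add[OF lin_times_right]
    linear_scale[OF lin_times_left] linear_scale[OF lin_times_right]
  have 1: "basis_elt a * basis_elt b * basis_elt c = basis_elt a * (basis_elt b * basis_elt c)"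
    for a b c :: 'a
    by (simp add: basis_times L bmul_assoc) (metis bsgn_cocycle)
  have 2: "basis_elt a * basis_elt b * z = basis_elt a * (basis_elt b * z)" for a b
    by (rule linear_eq_on_basis[of _ _ z]) (auto intro!: linearI simp: L 1)
  have 3: "basis_elt a * y * z = basis_elt a * (y * z)" for a
    by (rule linear_eq_on_basis[of _ _ y]) (auto intro!: linearI simp: L 2)
  show "x * y * z = x * (y * z)"
    by (rule linear_eq_on_basis[of _ _ x]) (auto intro!: linearI simp: L 3)
  show "(x + y) * z = x * z + y * z" "x * (y + z) = x * y + x * z"
    "(r *\<^sub>R x) * y = r *\<^sub>R (x * y)" "x * (r *\<^sub>R y) = r *\<^sub>R (x * y)"
    by (simp_all add: L)
  show "1 * x = x" "x * 1 = x"
    by (rule linear_eq_on_basis[of _ _ x]; auto intro!: linearI simp: L one_salg_def basis_times)+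
  show "(0 :: 'a salg) \<noteq> 1"
  proof
    assume "(0 :: 'a salg) = 1"
    then have "coord (0 :: 'a salg) bone = coord 1 bone" by simp
    then show False by (simp add: one_salg_def)
  qed
qed

end

text \<open>The component of parity \<open>p\<close>, where \<^term>\<open>True\<close> stands for odd.\<close>

definition parity_part :: "bool \<Rightarrow> 'b::super_basis salg \<Rightarrow> 'b salg" where
  "parity_part p = lin_ext (\<lambda>b. if bodd b = p then basis_elt b else 0)"

definition homogeneous :: "bool \<Rightarrow> 'b::super_basis salg \<Rightarrow> bool" where
  "homogeneous p x \<longleftrightarrow> parity_part p x = x"

text \<open>The Koszul sign \<open>(-1)^(|p||q|)\<close>.\<close>

abbreviation koszul :: "bool \<Rightarrow> bool \<Rightarrow> real" where
  "koszul p q \<equiv> (if p \<and> q then -1 else 1)"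

text \<open>
  The algebra over pairs of indices is the super tensor product,
  \<open>(a \<otimes> b)(c \<otimes> d) = (-1)^(|b||c|) ac \<otimes> bd\<close>.
\<close>

instantiation prod :: (super_basis, super_basis) super_basis
begin

definition "bone = (bone, bone)"
definition "bmul p q = (bmul (fst p) (fst q), bmul (snd p) (snd q))"
definition "bsgn p q = koszul (bodd (snd p)) (bodd (fst q)) * bsgn (fst p) (fst q) * bsgn (snd p) (snd q)"
definition "bodd p \<longleftrightarrow> bodd (fst p) \<noteq> bodd (snd p)"

instance
proof
  fix a b c :: "'a \<times> 'b"
  have *: "bsgn (fst a) (fst b) * bsgn (bmul (fst a) (fst b)) (fst c)
      = bsgn (fst b) (fst c) * bsgn (fst a) (bmul (fst b) (fst c))"
    "bsgn (snd a) (snd b) * bsgn (bmul (snd a) (snd b)) (snd c)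
      = bsgn (snd b) (snd c) * bsgn (snd a) (bmul (snd b) (snd c))"
    by (rule bsgn_cocycle)+
  let ?k = "\<lambda>p q. koszul (bodd (snd p)) (bodd (fst q))"
  have k: "?k a b * koszul (bodd (bmul (snd a) (snd b))) (bodd (fst c))
      = ?k b c * koszul (bodd (snd a)) (bodd (bmul (fst b) (fst c)))"
    by (auto simp: bodd_mul)
  have "s1 * x1 * y1 * (s2 * x2 * y2) = (s1 * s2) * (x1 * x2) * (y1 * y2)"
    for s1 s2 x1 x2 y1 y2 :: real by simp
  with k * show "bsgn a b * bsgn (bmul a b) c = bsgn b c * bsgn a (bmul b c)"
    by (simp only: bsgn_prod_def bmul_prod_def fst_conv snd_conv)
qed (auto simp: bone_prod_def bmul_prod_def bsgn_prod_def bodd_prod_def bmul_assoc bodd_mul)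

end

definition tensor :: "'b salg \<Rightarrow> 'c salg \<Rightarrow> ('b \<times> 'c) salg"  (infixr "\<otimes>\<^sub>s" 75) where
  "x \<otimes>\<^sub>s y = lin_ext (\<lambda>b. lin_ext (\<lambda>c. basis_elt (b, c)) y) x"

lemma tensor_basis: "basis_elt b \<otimes>\<^sub>s basis_elt c = basis_elt (b, c)"
  by (simp add: tensor_def)

lemma linear_tensor_left: "linear (\<lambda>x. x \<otimes>\<^sub>s y)"
  unfolding tensor_def by (rule linear_lin_ext)

lemma linear_tensor_right: "linear (\<lambda>y. x \<otimes>\<^sub>s y)"
proof (rule linearI)
  fix y z and r :: real
  show "x \<otimes>\<^sub>s (y + z) = x \<otimes>\<^sub>s y + x \<otimes>\<^sub>s z"
    by (simp add: tensor_def lin_ext_def[of _ x] lin_ext_add scaleR_add_right sum.distrib)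
  show "x \<otimes>\<^sub>s (r *\<^sub>R y) = r *\<^sub>R (x \<otimes>\<^sub>s y)"
    by (simp add: tensor_def lin_ext_def[of _ x] lin_ext_scale scaleR_sum_right
        mult.commute)
qed


section \<open>The enveloping algebra of the Heisenberg--Clifford Lie superalgebra\<close>

text \<open>
  The dimension \<open>n\<close> is \<open>CARD('n)\<close>, and the order of \<open>'n\<close> is the order of the orthonormal
  basis of \<open>V\<close>.  \<open>Mon j I\<close> is the index of the basis element \<open>z^j a_I\<close>; moving
  \<open>a_J\<close> past \<open>a_I\<close> into order gives \<open>a_I a_J = \<plusminus> z^|I \<inter> J| a_{I \<triangle> J}\<close>.
\<close>

datatype 'n mon = Mon (zdeg: nat) (gens: "'n set")

lemma prod_sym_diff:
  fixes f :: "'a \<Rightarrow> 'b::comm_monoid_mult"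
  assumes "finite A" "finite B" "\<And>x. f x * f x = 1"
  shows "prod f (sym_diff A B) = prod f A * prod f B"
proof -
  have "prod f (sym_diff A B) = prod f (A - B) * prod f (B - A)"
    using assms by (intro prod.union_disjoint) auto
  moreover have "prod f A = prod f (A - B) * prod f (A \<inter> B)"
    using assms by (metis Int_Diff_disjoint Int_Diff_Un finite_Diff finite_Int inf_commute
        mult.commute prod.union_disjoint)
  moreover have "prod f B = prod f (B - A) * prod f (A \<inter> B)"
    using assms by (metis Int_Diff_disjoint Int_Diff_Un finite_Diff finite_Int inf_commute
        mult.commute prod.union_disjoint)
  moreover have "prod f (A \<inter> B) * prod f (A \<inter> B) = 1"
    by (simp add: prod.distrib[symmetric] assms(3))
  ultimately show ?thesis
    by (metis (no_types, lifting) mult.assoc mult.left_commute mult.right_neutral)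
qed

instantiation mon :: ("{finite,linorder}") super_basis
begin

definition "bone = Mon 0 {}"
definition "bmul m m' =
  Mon (zdeg m + zdeg m' + card (gens m \<inter> gens m')) (sym_diff (gens m) (gens m'))"
definition "bsgn m m' = (\<Prod>i\<in>gens m. \<Prod>j\<in>gens m'. if j < i then -1 else 1)"
definition "bodd m \<longleftrightarrow> odd (card (gens m))"

instance
proof
  fix a b c :: "'a mon"
  have sd: "sym_diff (sym_diff I J) K = sym_diff I (sym_diff J K)" for I J K :: "'a set"
    by blast
  have card: "card (I \<inter> J) + card (sym_diff I J \<inter> K) = card (J \<inter> K) + card (I \<inter> sym_diff J K)"
    for I J K :: "'a set"
  proof -
    have "card (I \<inter> J) + card (sym_diff I J \<inter> K) = card ((I \<inter> J) \<union> (sym_diff I J \<inter> K))"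
      by (rule card_Un_disjoint[symmetric]) auto
    also have "(I \<inter> J) \<union> (sym_diff I J \<inter> K) = (J \<inter> K) \<union> (I \<inter> sym_diff J K)" by blast
    also have "card \<dots> = card (J \<inter> K) + card (I \<inter> sym_diff J K)"
      by (rule card_Un_disjoint) auto
    finally show ?thesis .
  qed
  show "bmul (bmul a b) c = bmul a (bmul b c)"
    using card[of "gens a" "gens b" "gens c"] by (simp add: bmul_mon_def sd)
  show "bmul bone a = a" "bmul a bone = a"
    by (simp_all add: bmul_mon_def bone_mon_def)
  show "bsgn bone a = 1" "bsgn a bone = 1" "\<not> bodd (bone :: 'a mon)"
    by (simp_all add: bsgn_mon_def bone_mon_def bodd_mon_def)
  have "card (sym_diff (gens a) (gens b)) + 2 * card (gens a \<inter> gens b) = card (gens a) + card (gens b)"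
  proof -
    have "card (sym_diff (gens a) (gens b)) = card (gens a - gens b) + card (gens b - gens a)"
      by (rule card_Un_disjoint) auto
    moreover have "card (gens a) = card (gens a - gens b) + card (gens a \<inter> gens b)"
      by (metis add.commute card_Int_Diff finite)
    moreover have "card (gens b) = card (gens b - gens a) + card (gens a \<inter> gens b)"
      by (metis add.commute card_Int_Diff finite inf_commute)
    ultimately show ?thesis by simp
  qed
  then show "bodd (bmul a b) \<longleftrightarrow> bodd a \<noteq> bodd b"
    unfolding bodd_mon_def bmul_mon_def by simp presburger
  have s1: "(\<Prod>j\<in>J. if j < i then -1 else 1 :: real) * (\<Prod>j\<in>J. if j < i then -1 else 1) = 1"
    for i :: 'a and J
    by (simp add: prod.distrib[symmetric] if_distrib cong: if_cong)
  have A: "bsgn (bmul a b) c = bsgn a c * bsgn b c"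
    unfolding bsgn_mon_def bmul_mon_def mon.sel by (rule prod_sym_diff) (auto simp: s1)
  have "(\<Prod>j\<in>sym_diff J K. if j < i then -1 else 1 :: real)
      = (\<Prod>j\<in>J. if j < i then -1 else 1) * (\<Prod>j\<in>K. if j < i then -1 else 1)"
    for i :: 'a and J K by (rule prod_sym_diff) auto
  then have B: "bsgn a (bmul b c) = bsgn a b * bsgn a c"
    unfolding bsgn_mon_def bmul_mon_def mon.sel by (simp add: prod.distrib)
  show "bsgn a b * bsgn (bmul a b) c = bsgn b c * bsgn a (bmul b c)"
    by (simp add: A B)
qed

end

type_synonym 'n uhc = "'n mon salg"

definition agen :: "'n::{finite,linorder} \<Rightarrow> 'n uhc" where
  "agen i = basis_elt (Mon 0 {i})"

definition zgen :: "'n::{finite,linorder} uhc" where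
  "zgen = basis_elt (Mon 1 {})"

text \<open>\<open>a_I\<close>, and in particular \<open>\<gamma> = a_1 \<cdots> a_n\<close>.\<close>

definition aprod :: "'n::{finite,linorder} set \<Rightarrow> 'n uhc" where
  "aprod I = prod_list (map agen (sorted_list_of_set I))"

definition gam :: "'n::{finite,linorder} uhc" where
  "gam = aprod UNIV"


subsection \<open>Presentation, antipode and coproduct\<close>

lemma agen_sq: "agen i * agen i = zgen"
  by (simp add: agen_def zgen_def basis_times bmul_mon_def bsgn_mon_def)

lemma agen_anticomm: "i \<noteq> j \<Longrightarrow> agen i * agen j = - (agen j * agen i)"
  by (auto simp: agen_def basis_times bmul_mon_def bsgn_mon_def not_less_iff_gr_or_eq
      insert_commute insert_Diff_if Un_commute)

lemma zgen_basis: "zgen * basis_elt (Mon j I) = basis_elt (Mon (Suc j) I)"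
  "basis_elt (Mon j I) * zgen = basis_elt (Mon (Suc j) I)"
  by (simp_all add: zgen_def basis_times bmul_mon_def bsgn_mon_def)

lemma zgen_central: "zgen * u = u * zgen"
  by (rule linear_eq_on_basis[OF lin_times_right lin_times_left])
    (metis mon.exhaust zgen_basis)

lemma agen_basis:
  "agen i * basis_elt (Mon j I) =
    (\<Prod>l\<in>I. if l < i then -1 else 1) *\<^sub>R
    basis_elt (Mon (if i \<in> I then Suc j else j) (sym_diff {i} I))"
  by (simp add: agen_def basis_times bmul_mon_def bsgn_mon_def)

lemma aprod_basis: "aprod I = basis_elt (Mon 0 I)"
proof -
  have "finite I" by simp
  then show ?thesis
  proof (induction "card I" arbitrary: I)
    case 0
    then show ?case by (simp add: aprod_def one_salg_def bone_mon_def)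
  next
    case (Suc k)
    then have ne: "I \<noteq> {}" and fin: "finite I" by auto
    let ?m = "Min I"
    have m: "?m \<in> I" using ne fin by simp
    have "sorted_list_of_set I = ?m # sorted_list_of_set (I - {?m})"
      using ne fin by (simp add: sorted_list_of_set_nonempty)
    then have "aprod I = agen ?m * aprod (I - {?m})" by (simp add: aprod_def)
    also have "aprod (I - {?m}) = basis_elt (Mon 0 (I - {?m}))"
      using Suc m fin by simp
    also have "agen ?m * \<dots> = basis_elt (Mon 0 I)"
    proof -
      have "(\<Prod>l\<in>I - {?m}. if l < ?m then -1 else 1 :: real) = 1"
        using fin by (intro prod.neutral) (simp add: leD)
      then show ?thesis
        using m by (simp add: agen_basis insert_absorb)
    qed
    finally show ?case .
  qed
qed

lemma basis_eq_monomial: "basis_elt (Mon j I) = zgen ^ j * aprod I"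
proof (induction j)
  case (Suc j)
  have "basis_elt (Mon (Suc j) I) = zgen * basis_elt (Mon j I)" by (simp only: zgen_basis)
  then show ?case by (simp only: Suc power_Suc mult.assoc)
qed (simp add: aprod_basis)

text \<open>
  An algebra homomorphism out of the enveloping algebra is determined by the images
  \<open>\<alpha> i\<close> and \<open>\<xi>\<close> of \<open>a_i\<close> and \<open>z\<close>, which must satisfy the defining relations.
\<close>

definition gen_hom :: "('n::{finite,linorder} \<Rightarrow> 'a::real_algebra_1) \<Rightarrow> 'a \<Rightarrow> 'n uhc \<Rightarrow> 'a" where
  "gen_hom \<alpha> \<xi> =
    lin_ext (\<lambda>m. \<xi> ^ zdeg m * prod_list (map \<alpha> (sorted_list_of_set (gens m))))"

lemma gen_hom_hom:
  fixes \<alpha> :: "'n::{finite,linorder} \<Rightarrow> 'a::real_algebra_1"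
  assumes anti: "\<And>i j. i \<noteq> j \<Longrightarrow> \<alpha> i * \<alpha> j = - (\<alpha> j * \<alpha> i)"
    and sq: "\<And>i. \<alpha> i * \<alpha> i = \<xi>"
    and central: "\<And>i. \<xi> * \<alpha> i = \<alpha> i * \<xi>"
  shows "linear (gen_hom \<alpha> \<xi>)" "gen_hom \<alpha> \<xi> 1 = 1"
    "gen_hom \<alpha> \<xi> (agen i) = \<alpha> i" "gen_hom \<alpha> \<xi> zgen = \<xi>"
    "gen_hom \<alpha> \<xi> (u * v) = gen_hom \<alpha> \<xi> u * gen_hom \<alpha> \<xi> v"
proof -
  let ?h = "gen_hom \<alpha> \<xi>"
  let ?P = "\<lambda>xs. prod_list (map \<alpha> xs)"
  show lin: "linear ?h" unfolding gen_hom_def by (rule linear_lin_ext)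
  show one: "?h 1 = 1" and ai: "?h (agen i) = \<alpha> i" for i
    by (simp_all add: gen_hom_def one_salg_def bone_mon_def agen_def)
  show z: "?h zgen = \<xi>"
    by (simp add: gen_hom_def zgen_def)
  have hb: "?h (basis_elt (Mon j I)) = \<xi> ^ j * ?P (sorted_list_of_set I)" for j I
    by (simp add: gen_hom_def)
  have cp: "\<alpha> i * \<xi> ^ j = \<xi> ^ j * \<alpha> i" for i j
    by (induction j) (simp_all add: mult.assoc, metis central mult.assoc)
  have ins: "\<alpha> i * ?P xs = (\<Prod>l\<in>set xs. if l < i then -1 else 1) *\<^sub>R
      (if i \<in> set xs then \<xi> * ?P (remove1 i xs) else ?P (insort i xs))"
    if "sorted xs" "distinct xs" for i xs
    using that
  proof (induction xs)
    case Nil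
    then show ?case by simp
  next
    case (Cons a xs)
    consider "i < a" | "i = a" | "a < i" by fastforce
    then show ?case
    proof cases
      case 1
      then have "\<And>l. l \<in> set (a # xs) \<Longrightarrow> \<not> l < i" using Cons.prems by auto
      moreover from this 1 have "(\<Prod>l\<in>set (a # xs). if l < i then -1 else 1 :: real) = 1"
        by (intro prod.neutral) auto
      moreover have "i \<notin> set (a # xs)" using 1 Cons.prems by auto
      ultimately show ?thesis using 1 by (simp add: less_imp_le)
    next
      case 2
      then have "\<And>l. l \<in> set (a # xs) \<Longrightarrow> \<not> l < i" using Cons.prems by auto
      then have "(\<Prod>l\<in>set (a # xs). if l < i then -1 else 1 :: real) = 1"
        by (intro prod.neutral) auto
      then show ?thesis using 2 by (simp add: mult.assoc[symmetric] sq)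
    next
      case 3
      have IH: "\<alpha> i * ?P xs = (\<Prod>l\<in>set xs. if l < i then -1 else 1) *\<^sub>R
          (if i \<in> set xs then \<xi> * ?P (remove1 i xs) else ?P (insort i xs))"
        using Cons by simp
      have "\<alpha> i * ?P (a # xs) = - (\<alpha> a * (\<alpha> i * ?P xs))"
        using anti[of i a] 3 by (simp add: mult.assoc[symmetric])
      also have "\<dots> = (\<Prod>l\<in>set (a # xs). if l < i then -1 else 1) *\<^sub>R
          (if i \<in> set (a # xs) then \<xi> * ?P (remove1 i (a # xs)) else ?P (insort i (a # xs)))"
        using 3 Cons.prems central[of a] unfolding IH
        by (auto simp: mult.assoc[symmetric])
      finally show ?thesis .
    qed
  qed
  have h_agen_basis: "?h (agen i * basis_elt (Mon j I)) = \<alpha> i * ?h (basis_elt (Mon j I))" for i j I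
  proof -
    let ?s = "\<Prod>l\<in>I. if l < i then -1 else 1 :: real"
    let ?xs = "sorted_list_of_set I"
    have "\<alpha> i * ?h (basis_elt (Mon j I)) = \<xi> ^ j * (\<alpha> i * ?P ?xs)"
      by (simp add: hb mult.assoc[symmetric] cp)
    also have "\<alpha> i * ?P ?xs = ?s *\<^sub>R (if i \<in> I then \<xi> * ?P (remove1 i ?xs) else ?P (insort i ?xs))"
      using ins[of ?xs i] by simp
    also have "\<xi> ^ j * \<dots> = ?h (agen i * basis_elt (Mon j I))"
    proof (cases "i \<in> I")
      case True
      then have "sym_diff {i} I = I - {i}" by auto
      with True show ?thesis
        by (simp add: agen_basis linear_scale[OF lin] hb sorted_list_of_set_remove
            power_Suc2 mult.assoc del: power_Suc)
    next
      case False
      then have "sym_diff {i} I = insert i I" by auto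
      with False show ?thesis
        by (simp add: agen_basis linear_scale[OF lin] hb)
    qed
    finally show ?thesis by simp
  qed
  have h_agen: "?h (agen i * v) = \<alpha> i * ?h v" for i v
  proof (rule linear_eq_on_basis[of _ _ v])
    show "linear (\<lambda>v. ?h (agen i * v))" "linear (\<lambda>v. \<alpha> i * ?h v)"
      by (auto intro!: linearI simp: linear_add[OF lin] linear_scale[OF lin] distrib_left)
    show "?h (agen i * basis_elt b) = \<alpha> i * ?h (basis_elt b)" for b
      by (cases b) (simp only: h_agen_basis)
  qed
  have h_zgen: "?h (zgen * v) = \<xi> * ?h v" for v
    using h_agen[of undefined "agen undefined * v"] h_agen[of undefined v]
    by (simp add: mult.assoc[symmetric] agen_sq sq)
  have "?h (basis_elt b * v) = ?h (basis_elt b) * ?h v" for b v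
  proof -
    have P: "?h (prod_list (map agen xs) * v) = ?P xs * ?h v" for xs v
      by (induction xs arbitrary: v) (simp_all add: mult.assoc h_agen)
    have Z: "?h (zgen ^ j * v) = \<xi> ^ j * ?h v" for j v
      by (induction j arbitrary: v) (simp_all add: mult.assoc h_zgen)
    obtain j I where b: "b = Mon j I" by (cases b)
    show ?thesis
      by (simp add: b basis_eq_monomial[of j I] mult.assoc Z)
        (simp add: aprod_def P P[of _ 1, simplified] one)
  qed
  note hbv = this
  show "?h (u * v) = ?h u * ?h v"
  proof (rule linear_eq_on_basis[of _ _ u])
    show "linear (\<lambda>u. ?h (u * v))" "linear (\<lambda>u. ?h u * ?h v)"
      by (auto intro!: linearI simp: linear_add[OF lin] linear_scale[OF lin] distrib_right)
  qed (rule hbv)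
qed

definition coproduct :: "'n::{finite,linorder} uhc \<Rightarrow> ('n mon \<times> 'n mon) salg" where
  "coproduct = gen_hom (\<lambda>i. agen i \<otimes>\<^sub>s 1 + 1 \<otimes>\<^sub>s agen i) (zgen \<otimes>\<^sub>s 1 + 1 \<otimes>\<^sub>s zgen)"

lemma coproduct_hom:
  fixes u v :: "'n::{finite,linorder} uhc" and i :: 'n
  shows "linear (coproduct :: 'n uhc \<Rightarrow> _)" "coproduct (1 :: 'n uhc) = 1"
    "coproduct (u * v) = coproduct u * coproduct v"
    "coproduct (agen i) = agen i \<otimes>\<^sub>s 1 + 1 \<otimes>\<^sub>s agen i"
    "coproduct (zgen :: 'n uhc) = zgen \<otimes>\<^sub>s 1 + 1 \<otimes>\<^sub>s zgen"
proof -
  note d = agen_def zgen_def one_salg_def tensor_basis basis_times bone_mon_def bmul_prod_def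
    bsgn_prod_def bodd_mon_def bmul_mon_def bsgn_mon_def distrib_left distrib_right
  have 1: "(agen i \<otimes>\<^sub>s 1 + 1 \<otimes>\<^sub>s agen i) * (agen j \<otimes>\<^sub>s 1 + 1 \<otimes>\<^sub>s agen j)
      = - ((agen j \<otimes>\<^sub>s 1 + 1 \<otimes>\<^sub>s agen j) * (agen i \<otimes>\<^sub>s 1 + 1 \<otimes>\<^sub>s agen i))"
    if "i \<noteq> j" for i j :: 'n
    using that by (cases "i < j") (auto simp: d insert_Diff_if insert_commute)
  have 2: "(agen i \<otimes>\<^sub>s 1 + 1 \<otimes>\<^sub>s agen i) * (agen i \<otimes>\<^sub>s 1 + 1 \<otimes>\<^sub>s agen i)
      = zgen \<otimes>\<^sub>s 1 + 1 \<otimes>\<^sub>s zgen" for i :: 'n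
    by (simp add: d)
  have 3: "(zgen \<otimes>\<^sub>s 1 + 1 \<otimes>\<^sub>s zgen) * (agen i \<otimes>\<^sub>s 1 + 1 \<otimes>\<^sub>s agen i)
      = (agen i \<otimes>\<^sub>s 1 + 1 \<otimes>\<^sub>s agen i) * (zgen \<otimes>\<^sub>s 1 + 1 \<otimes>\<^sub>s zgen)" for i :: 'n
    by (simp add: d)
  note H = gen_hom_hom[where \<alpha> = "\<lambda>i. agen i \<otimes>\<^sub>s 1 + 1 \<otimes>\<^sub>s agen i"
      and \<xi> = "zgen \<otimes>\<^sub>s 1 + 1 \<otimes>\<^sub>s zgen", OF 1 2 3, folded coproduct_def]
  show "linear (coproduct :: 'n uhc \<Rightarrow> _)" by (rule H(1))
  show "coproduct (1 :: 'n uhc) = 1" by (rule H(2))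
  show "coproduct (agen i) = agen i \<otimes>\<^sub>s 1 + 1 \<otimes>\<^sub>s agen i" by (rule H(3))
  show "coproduct (zgen :: 'n uhc) = zgen \<otimes>\<^sub>s 1 + 1 \<otimes>\<^sub>s zgen" by (rule H(4))
  show "coproduct (u * v) = coproduct u * coproduct v" by (rule H(5))
qed

text \<open>
  In \<open>S(a_{i_1} \<cdots> a_{i_r})\<close> the sign from reversing the factors cancels against the sign
  from sorting them again.
\<close>

definition antipode :: "'n::{finite,linorder} uhc \<Rightarrow> 'n uhc" where
  "antipode = lin_ext (\<lambda>m. (-1) ^ (zdeg m + card (gens m)) *\<^sub>R basis_elt m)"


lemma linear_parity_part: "linear (parity_part p)"
  unfolding parity_part_def by (rule linear_lin_ext)

lemma antipode_props:
  fixes u v :: "'n::{finite,linorder} uhc" and i :: 'n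
  shows "linear (antipode :: 'n uhc \<Rightarrow> 'n uhc)" "antipode (1 :: 'n uhc) = 1"
    "antipode (agen i) = - agen i" "antipode zgen = (- zgen :: 'n uhc)"
    "homogeneous p u \<Longrightarrow> homogeneous p (antipode u)"
    "homogeneous p u \<Longrightarrow> homogeneous q v \<Longrightarrow>
      antipode (u * v) = koszul p q *\<^sub>R (antipode v * antipode u)"
proof -
  let ?S = "antipode :: 'n uhc \<Rightarrow> 'n uhc"
  show lin: "linear ?S" unfolding antipode_def by (rule linear_lin_ext)
  note L = linear_add[OF lin] linear_scale[OF lin]
    linear_add[OF linear_parity_part] linear_scale[OF linear_parity_part]
  have Sb: "?S (basis_elt m) = (-1) ^ (zdeg m + card (gens m)) *\<^sub>R basis_elt m" for m
    by (simp add: antipode_def)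
  have pb: "parity_part p (basis_elt m) = (if bodd m = p then basis_elt m else 0)" for p and m :: "'n mon"
    by (simp add: parity_part_def)
  show "?S 1 = 1" "?S (agen i) = - agen i" "?S zgen = - zgen"
    by (simp_all add: antipode_def one_salg_def bone_mon_def agen_def zgen_def)
  have S0: "?S 0 = 0" using lin by (rule linear_0)
  have "parity_part p (?S u) = ?S (parity_part p u)"
    by (rule linear_eq_on_basis[of _ _ u]) (auto intro!: linearI simp: L Sb pb S0)
  then show "homogeneous p u \<Longrightarrow> homogeneous p (antipode u)"
    by (simp add: homogeneous_def)
  have sgn: "bsgn b c * (-1) ^ (zdeg (bmul b c) + card (gens (bmul b c)))
      = koszul (bodd b) (bodd c) * (-1) ^ (zdeg b + card (gens b)) * (-1) ^ (zdeg c + card (gens c))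
        * bsgn c b" for b c :: "'n mon"
  proof -
    let ?I = "gens b" and ?J = "gens c"
    have flip: "bsgn c b = (\<Prod>i\<in>?I. \<Prod>j\<in>?J. if i < j then -1 else 1)"
      unfolding bsgn_mon_def by (rule prod.swap)
    have "bsgn b c * bsgn c b = (\<Prod>i\<in>?I. \<Prod>j\<in>?J. if i = j then 1 else -1)"
      unfolding flip unfolding bsgn_mon_def prod.distrib[symmetric]
      by (intro prod.cong refl) auto
    also have "\<dots> = (\<Prod>i\<in>?I. (-1) ^ card ?J * (if i \<in> ?J then -1 else 1))"
    proof (rule prod.cong[OF refl])
      fix i
      have "(\<Prod>j\<in>?J. if i = j then 1 else -1 :: real) = (\<Prod>j\<in>?J. -1 * (if j = i then -1 else 1))"
        by (intro prod.cong) auto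
      also have "\<dots> = (-1) ^ card ?J * (\<Prod>j\<in>?J. if j = i then -1 else 1)"
        by (simp only: prod.distrib prod_constant)
      also have "(\<Prod>j\<in>?J. if j = i then -1 else 1 :: real) = (if i \<in> ?J then -1 else 1)"
        by (simp add: prod.delta)
      finally show "(\<Prod>j\<in>?J. if i = j then 1 else -1 :: real)
        = (-1) ^ card ?J * (if i \<in> ?J then -1 else 1)" .
    qed
    also have "\<dots> = (-1) ^ (card ?J * card ?I) * (\<Prod>i\<in>?I. if i \<in> ?J then -1 else 1)"
      by (simp add: prod.distrib power_mult)
    also have "(\<Prod>i\<in>?I. if i \<in> ?J then -1 else 1 :: real) = (-1) ^ card (?I \<inter> ?J)"
      by (simp add: prod.If_cases)
    finally have A: "bsgn b c * bsgn c b = (-1) ^ (card ?J * card ?I) * (-1) ^ card (?I \<inter> ?J)" .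
    have B: "bsgn c b * bsgn c b = 1"
      unfolding bsgn_mon_def prod.distrib[symmetric] by (intro prod.neutral ballI) auto
    have C: "koszul (bodd b) (bodd c) = (-1) ^ (card ?J * card ?I)"
      by (auto simp: bodd_mon_def)
    have D: "(-1 :: real) ^ card (gens (bmul b c)) = (-1) ^ card ?I * (-1) ^ card ?J"
      using bodd_mul[of b c] by (simp add: bodd_mon_def minus_one_power_iff)
    have "bsgn b c = (-1) ^ (card ?J * card ?I) * (-1) ^ card (?I \<inter> ?J) * bsgn c b"
      using A B by (metis mult.assoc mult.right_neutral)
    moreover have "zdeg (bmul b c) = zdeg b + zdeg c + card (?I \<inter> ?J)" by (simp add: bmul_mon_def)
    ultimately show ?thesis
      by (simp only: C D power_add) (auto simp: minus_one_power_iff)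
  qed
  have "?S (parity_part p (basis_elt b) * parity_part q (basis_elt c))
      = koszul p q *\<^sub>R (?S (parity_part q (basis_elt c)) * ?S (parity_part p (basis_elt b)))" for b c p q
  proof -
    have "bmul c b = bmul b c" by (simp add: bmul_mon_def Un_commute Int_commute)
    then show ?thesis
      using sgn[of b c] by (simp add: pb S0 Sb basis_times L algebra_simps)
  qed
  note bb = this
  have bv: "?S (parity_part p (basis_elt b) * parity_part q v)
      = koszul p q *\<^sub>R (?S (parity_part q v) * ?S (parity_part p (basis_elt b)))" for b p q v
  proof (rule linear_eq_on_basis[of _ _ v])
    show "linear (\<lambda>v. ?S (parity_part p (basis_elt b) * parity_part q v))"
      by (rule linearI) (simp_all add: L distrib_left)
    show "linear (\<lambda>v. koszul p q *\<^sub>R (?S (parity_part q v) * ?S (parity_part p (basis_elt b))))"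
      by (rule linearI) (simp_all add: L distrib_right scaleR_add_right)
  qed (rule bb)
  have "?S (parity_part p u * parity_part q v)
      = koszul p q *\<^sub>R (?S (parity_part q v) * ?S (parity_part p u))" for p q u v
  proof (rule linear_eq_on_basis[of _ _ u])
    show "linear (\<lambda>u. ?S (parity_part p u * parity_part q v))"
      by (rule linearI) (simp_all add: L distrib_right)
    show "linear (\<lambda>u. koszul p q *\<^sub>R (?S (parity_part q v) * ?S (parity_part p u)))"
      by (rule linearI) (simp_all add: L distrib_left scaleR_add_right)
  qed (rule bv)
  then show "homogeneous p u \<Longrightarrow> homogeneous q v \<Longrightarrow>
      antipode (u * v) = koszul p q *\<^sub>R (antipode v * antipode u)"
    by (metis homogeneous_def)
qed


section \<open>Functions on the supergroup\<close>

definition nth_deriv :: "nat \<Rightarrow> (real \<Rightarrow> complex) \<Rightarrow> real \<Rightarrow> complex" where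
  "nth_deriv k f = ((\<lambda>g x. vector_derivative g (at x)) ^^ k) f"

definition smooth :: "(real \<Rightarrow> complex) \<Rightarrow> bool" where
  "smooth f \<longleftrightarrow> (\<forall>k x. nth_deriv k f differentiable (at x))"

text \<open>\<open>F(u; x)\<close> is \<^term>\<open>F u x\<close>; the smooth functions are complex-valued.\<close>

definition Cinf_HC :: "('n::{finite,linorder} uhc \<Rightarrow> real \<Rightarrow> complex) set" where
  "Cinf_HC = {F. (\<forall>x. linear (\<lambda>u. F u x)) \<and> (\<forall>u. smooth (F u)) \<and>
    (\<forall>u x. F (zgen * u) x = vector_derivative (F u) (at x))}"

text \<open>
  The component of \<open>F\<close> of parity \<open>q\<close> is \<open>F \<circ> parity_part q\<close>, so this is the bilinear extension of
  \<open>(L_u F)(v; y) = (-1)^(|u||F|) F(S(u) v; y)\<close>.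
\<close>

definition Lact ::
  "'n::{finite,linorder} uhc \<Rightarrow> ('n uhc \<Rightarrow> real \<Rightarrow> complex) \<Rightarrow> 'n uhc \<Rightarrow> real \<Rightarrow> complex" where
  "Lact u F v y = (\<Sum>p\<in>UNIV. \<Sum>q\<in>UNIV.
    complex_of_real (koszul p q) * F (parity_part q (antipode (parity_part p u) * v)) y)"

definition HC_seminorm ::
  "nat \<Rightarrow> 'n::{finite,linorder} uhc \<Rightarrow> ('n uhc \<Rightarrow> real \<Rightarrow> complex) \<Rightarrow> real" where
  "HC_seminorm j u F = (SUP x. norm (complex_of_real x ^ j * Lact u F 1 x))"

definition schwartz_HC :: "('n::{finite,linorder} uhc \<Rightarrow> real \<Rightarrow> complex) set" where
  "schwartz_HC = {F \<in> Cinf_HC.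
    \<forall>j u. bdd_above (range (\<lambda>x. norm (complex_of_real x ^ j * Lact u F 1 x)))}"


section \<open>Representations\<close>

text \<open>
  With \<open>k = n div 2\<close>, the basis of \<open>(\<complex>^{1|1})^{\<otimes>k}\<close> is indexed by the sets of those tensor
  positions in \<open>{1..k}\<close> that carry the odd basis vector of \<open>\<complex>^{1|1}\<close>.
  For odd \<open>n\<close> the same type indexes the standard basis of \<open>\<complex>^{2^k}\<close>.
\<close>

typedef ('n::finite) spin = "{s. s \<subseteq> {1..CARD('n) div 2}}"
  morphisms odd_positions Abs_spin
  by blast

instance spin :: (finite) finite
proof
  have "(UNIV :: 'a spin set) = Abs_spin ` Pow {1..CARD('a) div 2}"
    unfolding Pow_def by (rule type_definition.Abs_image[OF type_definition_spin, symmetric])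
  then show "finite (UNIV :: 'a spin set)" by (metis finite_Pow_iff finite_atLeastAtMost finite_imageI)
qed

lemma card_spin: "CARD('n::finite spin) = 2 ^ (CARD('n) div 2)"
proof -
  have "CARD('n spin) = card {s. s \<subseteq> {1..CARD('n) div 2}}"
    by (rule type_definition.card[OF type_definition_spin])
  then show ?thesis by (simp flip: Pow_def add: card_Pow)
qed

type_synonym 'n cmat = "complex ^ 'n spin ^ 'n spin"

text \<open>
  \<^term>\<open>(A, B)\<close> stands for \<open>A + \<epsilon> B\<close>, and \<open>\<epsilon>\<close> only occurs for odd \<open>n\<close>.  Vectors of the spin module
  are written in the same way.
\<close>

type_synonym 'n hmat = "'n cmat \<times> 'n cmat"
type_synonym 'n svec = "(complex ^ 'n spin) \<times> (complex ^ 'n spin)"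

definition hspace :: "'n::finite hmat set" where
  "hspace = {X. even CARD('n) \<longrightarrow> snd X = 0}"

definition spin_module :: "'n::finite svec set" where
  "spin_module = {w. even CARD('n) \<longrightarrow> snd w = 0}"

definition cscale :: "complex \<Rightarrow> complex ^ 'a ^ 'b \<Rightarrow> complex ^ 'a ^ 'b" where
  "cscale c A = (\<chi> i j. c * A $ i $ j)"

definition hscale :: "complex \<Rightarrow> 'n::finite hmat \<Rightarrow> 'n hmat" where
  "hscale c X = (cscale c (fst X), cscale c (snd X))"

definition hone :: "'n::finite hmat" where
  "hone = (mat 1, 0)"

text \<open>The product of \<open>\<H>\<^sub>\<zeta>\<close> and its action on the spin module, where \<open>\<epsilon>\<^sup>2 = \<zeta>\<close>.\<close>

definition hmul :: "complex \<Rightarrow> 'n::finite hmat \<Rightarrow> 'n hmat \<Rightarrow> 'n hmat" where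
  "hmul \<zeta> X Y =
    (fst X ** fst Y + cscale \<zeta> (snd X ** snd Y), fst X ** snd Y + snd X ** fst Y)"

definition hact :: "complex \<Rightarrow> 'n::finite hmat \<Rightarrow> 'n svec \<Rightarrow> 'n svec" where
  "hact \<zeta> X w =
    (fst X *v fst w + \<zeta> *s (snd X *v snd w), fst X *v snd w + snd X *v fst w)"

text \<open>
  Entries of 2x2 matrices are indexed by booleans, \<^term>\<open>False\<close> being the first (even) basis vector.
\<close>

definition mat2 :: "complex \<Rightarrow> complex \<Rightarrow> complex \<Rightarrow> complex \<Rightarrow> bool \<Rightarrow> bool \<Rightarrow> complex" where
  "mat2 a b c d i j = (if i then (if j then d else c) else (if j then b else a))"

definition one2 :: "bool \<Rightarrow> bool \<Rightarrow> complex" where "one2 = mat2 1 0 0 1"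
definition sigma2 :: "bool \<Rightarrow> bool \<Rightarrow> complex" where "sigma2 = mat2 1 0 0 (-1)"
definition X2 :: "complex \<Rightarrow> bool \<Rightarrow> bool \<Rightarrow> complex" where "X2 \<zeta> = mat2 0 \<zeta> 1 0"
definition Y2 :: "complex \<Rightarrow> bool \<Rightarrow> bool \<Rightarrow> complex" where "Y2 \<zeta> = mat2 0 (\<i> * \<zeta>) (- \<i>) 0"

text \<open>The tensor product \<open>M 1 \<otimes> \<dots> \<otimes> M k\<close>.\<close>

definition tensor_mat :: "(nat \<Rightarrow> bool \<Rightarrow> bool \<Rightarrow> complex) \<Rightarrow> 'n::finite cmat" where
  "tensor_mat M = (\<chi> I J.
    \<Prod>p\<in>{1..CARD('n) div 2}. M p (p \<in> odd_positions I) (p \<in> odd_positions J))"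

definition Gamma_mat :: "'n::finite cmat" where
  "Gamma_mat = tensor_mat (\<lambda>_. sigma2)"

text \<open>For \<open>j = 2m - 1\<close> and \<open>j = 2m\<close> the factor \<open>X\<close> resp.\ \<open>Y\<close> is at position \<open>m = (j + 1) div 2\<close>.\<close>

definition spin_gen :: "complex \<Rightarrow> nat \<Rightarrow> 'n::finite cmat" where
  "spin_gen \<zeta> j = tensor_mat (\<lambda>p.
    if p < (j + 1) div 2 then sigma2
    else if p = (j + 1) div 2 then (if odd j then X2 \<zeta> else Y2 \<zeta>)
    else one2)"

definition pos :: "'n::{finite,linorder} \<Rightarrow> nat" where
  "pos i = card {j. j \<le> i}"

definition cgen :: "complex \<Rightarrow> 'n::{finite,linorder} \<Rightarrow> 'n hmat" where
  "cgen \<zeta> i =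
    (if even CARD('n) then (spin_gen \<zeta> (pos i), 0)
     else if pos i = 1 then (0, Gamma_mat)
     else (0, cscale (- \<i>) (Gamma_mat ** spin_gen 1 (pos i - 1))))"

text \<open>
  The algebra homomorphism with \<open>d\<pi>(a_j) = e^{i\<pi>/4} c(a_j)\<close> and \<open>d\<pi>(z) = i\<zeta>\<close>, evaluated
  on the basis elements \<open>z^j a_I\<close>.
\<close>

definition dpi :: "complex \<Rightarrow> 'n::{finite,linorder} uhc \<Rightarrow> 'n hmat" where
  "dpi \<zeta> = lin_ext (\<lambda>m. hscale ((\<i> * \<zeta>) ^ zdeg m)
    (foldr (hmul \<zeta>) (map (\<lambda>i. hscale (cis (pi / 4)) (cgen \<zeta> i)) (sorted_list_of_set (gens m))) hone))"


section \<open>Super adjoint and trace\<close>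

text \<open>Components of parity \<open>p\<close>; for odd \<open>n\<close> the grading is that of \<open>\<complex>[\<epsilon>]\<close>.\<close>

definition svec_part :: "bool \<Rightarrow> 'n::finite svec \<Rightarrow> 'n svec" where
  "svec_part p w =
    (if even CARD('n) then (\<chi> I. if odd (card (odd_positions I)) = p then fst w $ I else 0, 0)
     else if p then (0, snd w) else (fst w, 0))"

definition hmat_part :: "bool \<Rightarrow> 'n::finite hmat \<Rightarrow> 'n hmat" where
  "hmat_part p X =
    (if even CARD('n)
     then (\<chi> I J. if odd (card (odd_positions I) + card (odd_positions J)) = p
                  then fst X $ I $ J else 0, 0)
     else if p then (0, snd X) else (fst X, 0))"

definition sform :: "real \<Rightarrow> 'n::finite svec \<Rightarrow> 'n svec \<Rightarrow> complex" where
  "sform \<eta> u v =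
    (if even CARD('n)
     then \<Sum>I\<in>UNIV. complex_of_real \<eta> ^ card (odd_positions I) * (fst u $ I * cnj (fst v $ I))
     else (\<Sum>I\<in>UNIV. fst u $ I * cnj (fst v $ I))
        + complex_of_real \<eta> * (\<Sum>I\<in>UNIV. snd u $ I * cnj (snd v $ I)))"

text \<open>The sesquilinear extension of \<open>\<langle>u|v\<rangle> = i^(|u||v|) (u, v)\<close>.\<close>

definition super_form :: "real \<Rightarrow> 'n::finite svec \<Rightarrow> 'n svec \<Rightarrow> complex" where
  "super_form \<eta> u v = (\<Sum>p\<in>UNIV. \<Sum>q\<in>UNIV.
    (if p \<and> q then \<i> else 1) * sform \<eta> (svec_part p u) (svec_part q v))"

definition hom_adjoint :: "real \<Rightarrow> bool \<Rightarrow> 'n::finite hmat \<Rightarrow> 'n hmat" where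
  "hom_adjoint \<eta> b B = (THE C. C \<in> hspace \<and>
    (\<forall>p. \<forall>u\<in>spin_module. \<forall>v\<in>spin_module. svec_part p u = u \<longrightarrow>
      super_form \<eta> (hact \<eta> B u) v = complex_of_real (koszul p b) * super_form \<eta> u (hact \<eta> C v)))"

definition super_adjoint :: "real \<Rightarrow> 'n::finite hmat \<Rightarrow> 'n hmat" where
  "super_adjoint \<eta> B = (\<Sum>b\<in>UNIV. hom_adjoint \<eta> b (hmat_part b B))"

text \<open>The trace of the action on the spin module.\<close>

definition spin_trace :: "complex \<Rightarrow> 'n::finite hmat \<Rightarrow> complex" where
  "spin_trace \<zeta> A =
    (\<Sum>I\<in>UNIV. fst (hact \<zeta> A (axis I 1, 0)) $ I)
    + (if even CARD('n) then 0 else \<Sum>I\<in>UNIV. snd (hact \<zeta> A (0, axis I 1)) $ I)"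

definition Tfun :: "complex \<Rightarrow> 'n::finite hmat \<Rightarrow> complex" where
  "Tfun \<zeta> A =
    (if even CARD('n) then spin_trace \<zeta> (hmul \<zeta> (Gamma_mat, 0) A)
     else spin_trace \<zeta> (hmul \<zeta> (hscale (cis (pi / 4)) (0, mat 1)) A))"


section \<open>Fourier transform\<close>

text \<open>
  Expanding \<open>\<Delta>(\<gamma>)\<close> in tensor products of basis elements gives a decomposition into
  homogeneous terms.
\<close>

definition fourier :: "('n::{finite,linorder} uhc \<Rightarrow> real \<Rightarrow> complex) \<Rightarrow> real \<Rightarrow> 'n hmat" where
  "fourier F \<zeta> = lin_ext (\<lambda>(b, c).
      hscale (LINT x|lborel. F (basis_elt b) x * exp (- \<i> * \<zeta> * x)) (dpi (- \<zeta>) (basis_elt c)))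
    (coproduct gam)"

definition half_dim :: "'n::finite itself \<Rightarrow> nat" where
  "half_dim _ = (if even CARD('n) then CARD('n) div 2 else (CARD('n) + 1) div 2)"

text \<open>
  \<open>A(u; \<zeta>)\<close>, given by the formula for \<open>\<zeta> \<noteq> 0\<close> and by its limit for \<open>\<zeta> = 0\<close>, where the
  formula is not defined.
  With these conventions, for \<open>A\<close> the transform of \<open>F\<close>, \<open>A(u; \<zeta>)\<close> is the classical Fourier transform
  of \<open>F(u; x)\<close> if \<open>n\<close> is even, and \<open>i (-1)^|u|\<close> times it if \<open>n\<close> is odd.  For example,
  \<open>A(1; \<zeta>) = T(A(\<zeta>)) / (-2\<zeta>)\<close> picks up \<open>e^{i\<pi>/4}\<close> twice for \<open>n = 1\<close>, once from \<open>T\<close>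
  and once from \<open>d\<pi>(a_1)\<close>.
\<close>

definition pairing_nz :: "(real \<Rightarrow> 'n::{finite,linorder} hmat) \<Rightarrow> 'n uhc \<Rightarrow> real \<Rightarrow> complex" where
  "pairing_nz A u \<zeta> =
    Tfun (- \<zeta>) (hmul (- \<zeta>) (A \<zeta>) (super_adjoint (- \<zeta>) (dpi (- \<zeta>) u)))
    / complex_of_real (-2 * \<zeta>) ^ half_dim TYPE('n)"

definition pairing :: "(real \<Rightarrow> 'n::{finite,linorder} hmat) \<Rightarrow> 'n uhc \<Rightarrow> real \<Rightarrow> complex" where
  "pairing A u \<zeta> = (if \<zeta> = 0 then Lim (at 0) (pairing_nz A u) else pairing_nz A u \<zeta>)"

definition RH_seminorm ::
  "nat \<Rightarrow> 'n::{finite,linorder} uhc \<Rightarrow> (real \<Rightarrow> 'n hmat) \<Rightarrow> real" where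
  "RH_seminorm k u A = (SUP \<zeta>. norm (nth_deriv k (pairing A u) \<zeta>))"

text \<open>
  The functions \<open>A(u; \<zeta>)\<close> do not depend on the value of \<open>A\<close> at \<open>0\<close>; this value is fixed
  by continuity.
\<close>

definition schwartz_RH :: "(real \<Rightarrow> 'n::{finite,linorder} hmat) set" where
  "schwartz_RH = {A. (\<forall>\<zeta>. A \<zeta> \<in> hspace) \<and> isCont A 0 \<and>
    (\<forall>u. smooth (pairing A u) \<and> (\<forall>k. bdd_above (range (\<lambda>\<zeta>. norm (nth_deriv k (pairing A u) \<zeta>)))))}"


section \<open>Topologies\<close>

text \<open>The locally convex topology on \<open>X\<close> defined by a set \<open>P\<close> of seminorms.\<close>

definition seminorm_topology :: "'a::minus set \<Rightarrow> ('a \<Rightarrow> real) set \<Rightarrow> 'a topology" where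
  "seminorm_topology X P = topology (\<lambda>U. U \<subseteq> X \<and>
    (\<forall>f\<in>U. \<exists>Q e. finite Q \<and> Q \<subseteq> P \<and> 0 < e \<and> {g \<in> X. \<forall>p\<in>Q. p (g - f) < e} \<subseteq> U))"

lemma openin_seminorm_topology:
  "openin (seminorm_topology X P) U \<longleftrightarrow> U \<subseteq> X \<and>
    (\<forall>f\<in>U. \<exists>Q e. finite Q \<and> Q \<subseteq> P \<and> 0 < e \<and> {g \<in> X. \<forall>p\<in>Q. p (g - f) < e} \<subseteq> U)"
proof -
  define nb where "nb U f \<longleftrightarrow> (\<exists>Q e. finite Q \<and> Q \<subseteq> P \<and> 0 < (e :: real) \<and>
    {g \<in> X. \<forall>p\<in>Q. p (g - f) < e} \<subseteq> U)" for U f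
  have nb_Int: "nb (U \<inter> V) f" if "nb U f" "nb V f" for U V f
  proof -
    obtain Q e where 1: "finite Q" "Q \<subseteq> P" "0 < e" "{g \<in> X. \<forall>p\<in>Q. p (g - f) < e} \<subseteq> U"
      using \<open>nb U f\<close> unfolding nb_def by blast
    obtain Q' e' where 2: "finite Q'" "Q' \<subseteq> P" "0 < e'" "{g \<in> X. \<forall>p\<in>Q'. p (g - f) < e'} \<subseteq> V"
      using \<open>nb V f\<close> unfolding nb_def by blast
    have "{g \<in> X. \<forall>p\<in>Q \<union> Q'. p (g - f) < min e e'} \<subseteq> U \<inter> V"
    proof
      fix g assume "g \<in> {g \<in> X. \<forall>p\<in>Q \<union> Q'. p (g - f) < min e e'}"
      then have "g \<in> {g \<in> X. \<forall>p\<in>Q. p (g - f) < e}" "g \<in> {g \<in> X. \<forall>p\<in>Q'. p (g - f) < e'}"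
        by simp_all
      then show "g \<in> U \<inter> V" using 1(4) 2(4) by (meson IntI subsetD)
    qed
    moreover have "finite (Q \<union> Q')" "Q \<union> Q' \<subseteq> P" "0 < min e e'" using 1 2 by auto
    ultimately show ?thesis unfolding nb_def by meson
  qed
  have nb_mono: "nb V f" if "nb U f" "U \<subseteq> V" for U V f
    using that unfolding nb_def by (meson subset_trans)
  have "istopology (\<lambda>U. U \<subseteq> X \<and> (\<forall>f\<in>U. nb U f))"
    unfolding istopology_def
  proof (intro conjI allI impI)
    fix U V assume "U \<subseteq> X \<and> (\<forall>f\<in>U. nb U f)" "V \<subseteq> X \<and> (\<forall>f\<in>V. nb V f)"
    then show "U \<inter> V \<subseteq> X" "\<forall>f\<in>U \<inter> V. nb (U \<inter> V) f"
      using nb_Int by auto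
  next
    fix \<K> assume K: "\<forall>U\<in>\<K>. U \<subseteq> X \<and> (\<forall>f\<in>U. nb U f)"
    then show "\<Union>\<K> \<subseteq> X" by blast
    show "\<forall>f\<in>\<Union>\<K>. nb (\<Union>\<K>) f"
      using K nb_mono by (meson Union_iff Union_upper)
  qed
  then show ?thesis
    by (simp add: seminorm_topology_def nb_def)
qed

lemma topspace_seminorm_topology [simp]: "topspace (seminorm_topology X P) = X"
proof
  show "topspace (seminorm_topology X P) \<subseteq> X"
    using openin_topspace[of "seminorm_topology X P"] unfolding openin_seminorm_topology by (rule conjunct1)
  have "openin (seminorm_topology X P) X"
    unfolding openin_seminorm_topology
    by (auto intro!: exI[of _ "{}"] exI[of _ "1 :: real"])
  then show "X \<subseteq> topspace (seminorm_topology X P)" by (rule openin_subset)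
qed

definition top_schwartz_HC :: "('n::{finite,linorder} uhc \<Rightarrow> real \<Rightarrow> complex) topology" where
  "top_schwartz_HC = seminorm_topology schwartz_HC (range (\<lambda>(j, u). HC_seminorm j u))"

definition top_schwartz_RH :: "(real \<Rightarrow> 'n::{finite,linorder} hmat) topology" where
  "top_schwartz_RH =
    seminorm_topology schwartz_RH (range (\<lambda>(k, j, J). RH_seminorm k (zgen ^ j * aprod J)))"

end

theory Submission
  imports Defs "HOL-Probability.Characteristic_Functions" "HOL-Probability.Sinc_Integral"
begin

text \<open>
  By the defining relations, \<open>d\<pi>(u)\<^sup>\<dagger> = d\<pi>(S(u))\<close>, and \<open>T(d\<pi>(a_K))\<close> vanishes unless \<open>K\<close> is the set of
  all indices.  Hence \<open>\<langle>d\<pi>(a_J)|d\<pi>(a_I)\<rangle>\<close> is non-zero precisely when \<open>J\<close> is the complement of \<open>I\<close>, and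
  since \<open>\<Delta>(\<gamma>)\<close> is the signed sum of the \<open>a_I \<otimes> a_J\<close> over complementary \<open>I\<close>, \<open>J\<close>, the function \<open>A(u; \<zeta>)\<close>
  attached to the transform \<open>A\<close> of \<open>F\<close> is, up to a constant of absolute value one, the classical
  Fourier transform of \<open>F(u; x)\<close>.  The statement thus reduces to Fourier inversion on the
  classical Schwartz space.  A map \<open>A\<close> is recovered from the functions \<open>A(u; \<zeta>)\<close> since the \<open>d\<pi>(a_I)\<close>
  span \<open>\<H>\<close> for \<open>\<zeta> \<noteq> 0\<close>, and by continuity at \<open>\<zeta> = 0\<close>.
\<close>

section \<open>Fourier analysis on the real line\<close>

text \<open>Two obstacles shape the proof. The algebra on \<open>hspace\<close> varies with \<zeta>,
  and at \<zeta> = 0 the generators square to 0 and the pairing degenerates, so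
  \<open>pairing\<close> is only a limit there. Algebraic identities are therefore proved for
  \<zeta> \<noteq> 0 and carried to 0 by continuity of both sides. The second obstacle is the unit
  constant. It has three sources: the antipode gives (-1)^|I|, exchanging a_I with the complementary
  product gives (-1)^(|I| (n - |I|)), and T of the top element gives, besides (-2\<zeta>)^[n], a
  factor 1 or i. For even n all of this cancels; for odd n there remains i (-1)^|I|, which depends
  on the parity of u, so that the inversion formula then concerns homogeneous u. The seminorms of
  \<open>schwartz_RH\<close> carry no polynomial weights. These enter by replacing u with z^j u,
  which multiplies A(u; \<zeta>) by (i\<zeta>)^j; much of the classical analysis serves to move such
  weights across derivatives.\<close>

lemma nth_deriv_0 [simp]: "nth_deriv 0 f = f"
  by (simp add: nth_deriv_def)

lemma nth_deriv_Suc: "nth_deriv (Suc k) f = (\<lambda>x. vector_derivative (nth_deriv k f) (at x))"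
  by (simp add: nth_deriv_def)

lemma smooth_nth_deriv:
  "smooth f \<Longrightarrow> (nth_deriv k f has_vector_derivative nth_deriv (Suc k) f x) (at x)"
  by (simp add: smooth_def nth_deriv_Suc vector_derivative_works)

text \<open>\<open>vector_derivative\<close> is total, so a computation of iterated derivatives has
  to be accompanied by differentiability. A family \<open>G\<close> of candidates supplies
  both.\<close>

lemma nth_derivI:
  assumes "\<And>k x. (G k has_vector_derivative G (Suc k) x) (at x)"
  shows "nth_deriv k (G 0) = G k" and "smooth (G 0)"
proof -
  show *: "nth_deriv k (G 0) = G k" for k
    by (induction k) (auto simp: nth_deriv_Suc vector_derivative_at[OF assms])
  show "smooth (G 0)"
    unfolding smooth_def * using assms by (metis differentiableI_vector)
qed

lemma smooth_continuous: "smooth f \<Longrightarrow> continuous_on UNIV (nth_deriv k f)"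
  by (intro continuous_at_imp_continuous_on ballI)
    (rule has_vector_derivative_continuous[OF smooth_nth_deriv])

section \<open>Fourier integrals of functions with quadratic decay\<close>

lemma integrable_inverse_quadratic: "integrable lborel (\<lambda>x :: real. inverse (1 + x\<^sup>2))"
  and integral_inverse_quadratic: "(LINT x|lborel. inverse (1 + x\<^sup>2)) = pi"
  using integrable_inverse_1_plus_square LBINT_inverse_1_plus_square
  by (simp_all add: set_integrable_def interval_lebesgue_integral_def set_lebesgue_integral_def)

definition ft :: "(real \<Rightarrow> complex) \<Rightarrow> real \<Rightarrow> complex" where
  "ft f \<zeta> = (LINT x|lborel. f x * exp (- \<i> * \<zeta> * x))"

text \<open>One explicit majorant serves three purposes: integrability, limit 0 at both ends for
  integration by parts, and the bound \<open>C * pi\<close> on the transform, which later becomes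
  continuity in the seminorms.\<close>

definition quad_decay :: "real \<Rightarrow> (real \<Rightarrow> complex) \<Rightarrow> bool" where
  "quad_decay C f \<longleftrightarrow> continuous_on UNIV f \<and> (\<forall>x. norm (f x) \<le> C * inverse (1 + x\<^sup>2))"

lemma quad_decay_measurable: "quad_decay C f \<Longrightarrow> f \<in> borel_measurable borel"
  by (simp add: quad_decay_def borel_measurable_continuous_onI)

lemma quad_decay_nonneg: "quad_decay C f \<Longrightarrow> 0 \<le> C"
  unfolding quad_decay_def by (auto dest!: spec[of _ 0] intro: order_trans[OF norm_ge_zero])

lemma quad_decay_integrable:
  assumes "quad_decay C f"
  shows "integrable lborel f"
  by (rule Bochner_Integration.integrable_bound[of _ "\<lambda>x. C * inverse (1 + x\<^sup>2)"])
    (use assms quad_decay_nonneg[OF assms] in \<open>auto intro!: integrable_inverse_quadratic simp: quad_decay_measurable quad_decay_def\<close>)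

lemma quad_decayI:
  assumes "continuous_on UNIV f" "\<And>x. norm (f x) \<le> M" "\<And>x. norm (x\<^sup>2 * f x) \<le> N"
  shows "quad_decay (M + N) f"
  unfolding quad_decay_def
proof (intro conjI assms allI)
  fix x :: real
  have "(1 + x\<^sup>2) * norm (f x) \<le> M + N"
    using assms(2)[of x] assms(3)[of x] by (simp add: norm_mult norm_power distrib_right)
  then show "norm (f x) \<le> (M + N) * inverse (1 + x\<^sup>2)"
    by (simp add: field_simps add_pos_nonneg)
qed

lemma norm_ft_kernel [simp]: "norm (exp (- \<i> * complex_of_real \<zeta> * complex_of_real x)) = 1"
proof -
  have "- \<i> * complex_of_real \<zeta> * complex_of_real x = \<i> * complex_of_real (- \<zeta> * x)" by simp
  then show ?thesis by (simp only: norm_exp_i_times)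
qed

lemma quad_decay_mult:
  assumes "quad_decay C f" "continuous_on UNIV g" "\<And>x. norm (g x) \<le> 1"
  shows "quad_decay C (\<lambda>x. f x * g x)"
  unfolding quad_decay_def
proof (intro conjI allI)
  show "continuous_on UNIV (\<lambda>x. f x * g x)"
    using assms by (auto intro!: continuous_intros simp: quad_decay_def)
  show "norm (f x * g x) \<le> C * inverse (1 + x\<^sup>2)" for x
    using assms(1) assms(3)[of x] mult_left_le[of "norm (g x)" "norm (f x)"]
    unfolding quad_decay_def norm_mult by (meson norm_ge_zero order_trans)
qed

lemma quad_decay_kernel: "quad_decay C f \<Longrightarrow> quad_decay C (\<lambda>x. f x * exp (- \<i> * complex_of_real \<zeta> * complex_of_real x))"
  by (rule quad_decay_mult) (auto intro!: continuous_intros)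

lemmas ft_integrable = quad_decay_integrable[OF quad_decay_kernel]

lemma norm_ft_le:
  assumes "quad_decay C f"
  shows "norm (ft f \<zeta>) \<le> C * pi"
proof -
  let ?g = "\<lambda>x. f x * exp (- \<i> * complex_of_real \<zeta> * complex_of_real x)"
  have "norm (ft f \<zeta>) \<le> (LINT x|lborel. norm (?g x))"
    unfolding ft_def by (rule integral_norm_bound)
  also have "\<dots> \<le> (LINT x|lborel. C * inverse (1 + x\<^sup>2))"
    using quad_decay_kernel[OF assms, of \<zeta>] ft_integrable[OF assms, of \<zeta>]
    by (intro integral_mono integrable_norm integrable_mult_right integrable_inverse_quadratic)
      (auto simp: quad_decay_def)
  also have "\<dots> = C * pi" by (simp add: integral_inverse_quadratic)
  finally show ?thesis .
qed

text \<open>With a Taylor estimate of second order the derivative of a parameter integral is read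
  off from an inequality, without a limit under the integral sign.\<close>

lemma has_vector_derivative_quadratic_bound:
  fixes f :: "real \<Rightarrow> 'a::real_normed_vector"
  assumes "\<And>y. norm (f y - f x - (y - x) *\<^sub>R D) \<le> K * (y - x)\<^sup>2"
  shows "(f has_vector_derivative D) (at x)"
  unfolding has_vector_derivative_def has_derivative_at_alt
proof (intro conjI allI impI)
  show "bounded_linear (\<lambda>h. h *\<^sub>R D)" by (rule bounded_linear_scaleR_left)
  fix e :: real assume e: "e > 0"
  have K: "0 \<le> K" using assms[of "x + 1"] norm_ge_zero by (simp add: order_trans[OF norm_ge_zero])
  show "\<exists>d>0. \<forall>y. norm (y - x) < d \<longrightarrow> norm (f y - f x - (y - x) *\<^sub>R D) \<le> e * norm (y - x)"
  \<comment> \<open>Adding 1 keeps the denominator positive when \<open>K\<close> is 0.\<close>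
  proof (intro exI[of _ "e / (K + 1)"] conjI allI impI)
    show "0 < e / (K + 1)" using e K by simp
    fix y assume "norm (y - x) < e / (K + 1)"
    then have "\<bar>y - x\<bar> * (K + 1) \<le> e" using K by (simp add: field_simps)
    then have "K * \<bar>y - x\<bar> \<le> e" using K by (simp add: algebra_simps) 
    then have "K * \<bar>y - x\<bar> * \<bar>y - x\<bar> \<le> e * \<bar>y - x\<bar>" by (rule mult_right_mono) simp
    then have "K * (y - x)\<^sup>2 \<le> e * \<bar>y - x\<bar>" by (simp add: power2_eq_square mult.assoc)
    then show "norm (f y - f x - (y - x) *\<^sub>R D) \<le> e * norm (y - x)"
      using assms[of y] by simp
  qed
qed

text \<open>The first-order Taylor remainder of exp(it) is at most t^2 / 2. With t = -(w - \<zeta>)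
  x the error after integration is at most (w - \<zeta>)^2 / 2 times the integral of |x^2 g|, which
  the third hypothesis bounds.\<close>

lemma ft_has_derivative:
  assumes g: "quad_decay C g" and xg: "quad_decay C' (\<lambda>x. - \<i> * x * g x)"
    and xxg: "quad_decay C'' (\<lambda>x. - \<i> * x * (- \<i> * x * g x))"
  shows "(ft g has_vector_derivative ft (\<lambda>x. - \<i> * x * g x) \<zeta>) (at \<zeta>)"
proof (rule has_vector_derivative_quadratic_bound[of _ _ _ "C'' * pi / 2"])
  fix w
  let ?e = "\<lambda>w x :: real. exp (- \<i> * complex_of_real w * complex_of_real x)"
  let ?g' = "\<lambda>x. - \<i> * complex_of_real x * g x"
  let ?R = "\<lambda>x. g x * ?e w x - g x * ?e \<zeta> x - (w - \<zeta>) *\<^sub>R (?g' x * ?e \<zeta> x)"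
  note I = ft_integrable[OF g] ft_integrable[OF xg]
  have R: "norm (?R x) \<le> (C'' * (w - \<zeta>)\<^sup>2 / 2) * inverse (1 + x\<^sup>2)" for x
  proof -
    let ?t = "- (w - \<zeta>) * x"
    have ex: "?e w x = ?e \<zeta> x * exp (\<i> * complex_of_real ?t)"
      by (simp add: exp_add[symmetric] algebra_simps)
    have "?R x = (g x * ?e \<zeta> x) * (exp (\<i> * complex_of_real ?t) - (\<Sum>k\<le>1. (\<i> * complex_of_real ?t) ^ k / fact k))"
      unfolding ex by (simp add: scaleR_conv_of_real algebra_simps)
    also have "norm \<dots> \<le> norm (g x * ?e \<zeta> x) * (\<bar>?t\<bar> ^ (Suc 1) / fact (Suc 1))"
      unfolding norm_mult[of "g x * ?e \<zeta> x"] by (intro mult_left_mono iexp_approx1) simp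
    also have "\<dots> = norm (- \<i> * x * (- \<i> * x * g x)) * ((w - \<zeta>)\<^sup>2 / 2)"
    proof -
      have t: "\<bar>?t\<bar> ^ Suc 1 = (w - \<zeta>)\<^sup>2 * x\<^sup>2"
        by (simp only: Suc_1 power2_abs power_mult_distrib power2_minus)
      have r: "norm (- \<i> * x * (- \<i> * x * g x)) = x\<^sup>2 * norm (g x)"
        by (simp add: norm_mult power2_eq_square)
      show ?thesis
        unfolding t r norm_mult[of "g x" "?e \<zeta> x"] norm_ft_kernel by simp
    qed
    also have "\<dots> \<le> C'' * inverse (1 + x\<^sup>2) * ((w - \<zeta>)\<^sup>2 / 2)"
      using xxg unfolding quad_decay_def by (intro mult_right_mono) auto
    finally show ?thesis by (simp add: algebra_simps)
  qed
  note J = Bochner_Integration.integrable_diff[OF I(1)[of w] I(1)[of \<zeta>]]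
    integrable_scaleR_right[OF I(2)[of \<zeta>], of "w - \<zeta>"]
  note IR = Bochner_Integration.integrable_diff[OF J]
  have "(LINT x|lborel. ?R x) = ft g w - ft g \<zeta> - (w - \<zeta>) *\<^sub>R ft ?g' \<zeta>"
    unfolding ft_def Bochner_Integration.integral_diff[OF J] Bochner_Integration.integral_diff[OF I(1) I(1)]
      integral_scaleR_right ..
  then have "norm (ft g w - ft g \<zeta> - (w - \<zeta>) *\<^sub>R ft ?g' \<zeta>) \<le> (LINT x|lborel. norm (?R x))"
    using integral_norm_bound[of lborel ?R] by (simp only:)
  also have "\<dots> \<le> (LINT x|lborel. (C'' * (w - \<zeta>)\<^sup>2 / 2) * inverse (1 + x\<^sup>2))"
    by (rule integral_mono[OF integrable_norm[OF IR] integrable_mult_right[OF integrable_inverse_quadratic] R])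
  also have "\<dots> = C'' * pi / 2 * (w - \<zeta>)\<^sup>2" by (simp add: integral_inverse_quadratic)
  finally show "norm (ft g w - ft g \<zeta> - (w - \<zeta>) *\<^sub>R ft ?g' \<zeta>) \<le> C'' * pi / 2 * (w - \<zeta>)\<^sup>2" .
qed

lemma tendsto_inverse_quadratic:
  "((\<lambda>x :: real. C * inverse (1 + x\<^sup>2)) \<longlongrightarrow> 0) at_top" "((\<lambda>x :: real. C * inverse (1 + x\<^sup>2)) \<longlongrightarrow> 0) at_bot"
  by real_asymp+

text \<open>Integration by parts: \<open>?f\<close> is the derivative of g times the kernel, and its
  integral over the line vanishes because the decay kills both boundary terms.\<close>

lemma ft_derivative:
  assumes g: "quad_decay C g" and g': "quad_decay C' g'"
    and d: "\<And>x. (g has_vector_derivative g' x) (at x)"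
  shows "ft g' \<zeta> = \<i> * \<zeta> * ft g \<zeta>"
proof -
  let ?e = "\<lambda>x :: real. exp (- \<i> * complex_of_real \<zeta> * complex_of_real x)"
  let ?f = "\<lambda>x. g' x * ?e x - \<i> * \<zeta> * (g x * ?e x)"
  have I: "integrable lborel (\<lambda>x. g x * ?e x)" "integrable lborel (\<lambda>x. g' x * ?e x)"
    by (intro ft_integrable[OF g] ft_integrable[OF g'])+
  have D: "((\<lambda>x. g x * ?e x) has_vector_derivative ?f x) (at x)" for x
  proof -
    have "((\<lambda>x. - \<i> * complex_of_real \<zeta> * complex_of_real x) has_vector_derivative - \<i> * \<zeta>) (at x)"
      by (auto intro!: derivative_eq_intros simp: has_vector_derivative_def scaleR_conv_of_real)
    moreover have "(exp has_field_derivative ?e x) (at (- \<i> * complex_of_real \<zeta> * complex_of_real x))"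
      by (rule DERIV_exp)
    ultimately have "(?e has_vector_derivative (- \<i> * \<zeta> * ?e x)) (at x)"
      by (rule field_vector_diff_chain_at[unfolded o_def])
    from has_vector_derivative_mult[OF d[of x] this] show ?thesis
      by (simp add: algebra_simps)
  qed
  have cont: "continuous_on UNIV ?f"
    using g g' unfolding quad_decay_def by (auto intro!: continuous_intros)
  have lim: "((\<lambda>x. g x * ?e x) \<longlongrightarrow> 0) F" if "((\<lambda>x. C * inverse (1 + x\<^sup>2)) \<longlongrightarrow> 0) F" for F
    by (rule Lim_null_comparison[OF _ that])
      (use quad_decay_kernel[OF g, of \<zeta>] in \<open>auto simp: quad_decay_def\<close>)
  have "(LBINT x=-\<infinity>..\<infinity>. ?f x) = 0 - 0"
  proof (rule interval_integral_FTC_integrable)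
    show "((\<lambda>x. g x * ?e x) has_vector_derivative ?f x) (at x)" for x by (rule D)
    show "isCont ?f x" for x using cont by (simp add: continuous_on_eq_continuous_at)
    show "set_integrable lborel (einterval (-\<infinity>) \<infinity>) ?f"
      using I by (simp add: set_integrable_def Bochner_Integration.integrable_diff)
    show "(((\<lambda>x. g x * ?e x) \<circ> real_of_ereal) \<longlongrightarrow> 0) (at_right (-\<infinity>))"
      by (simp only: ereal_tendsto_simps) (rule lim, rule tendsto_inverse_quadratic)
    show "(((\<lambda>x. g x * ?e x) \<circ> real_of_ereal) \<longlongrightarrow> 0) (at_left \<infinity>)"
      by (simp only: ereal_tendsto_simps) (rule lim, rule tendsto_inverse_quadratic)
  qed simp
  then have "(LINT x|lborel. ?f x) = 0"
    by (simp add: interval_lebesgue_integral_def set_lebesgue_integral_def)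
  moreover have "(LINT x|lborel. ?f x) = ft g' \<zeta> - \<i> * \<zeta> * ft g \<zeta>"
    unfolding ft_def using I by (simp add: Bochner_Integration.integral_diff)
  ultimately show ?thesis by simp
qed

section \<open>Fourier inversion by Gaussian regularization\<close>

lemma gaussian_ft:
  fixes a :: real
  shows "(LINT t|lborel. exp (\<i> * complex_of_real (a * t)) * complex_of_real (exp (- t\<^sup>2 / 2)))
    = complex_of_real (sqrt (2 * pi) * exp (- a\<^sup>2 / 2))"
proof -
  \<comment> \<open>The Gaussian is sqrt(2 pi) times the standard normal density, so its transform
    is that multiple of a characteristic function.\<close>
  have "(LINT t|lborel. std_normal_density t *\<^sub>R exp (\<i> * complex_of_real (a * t)))
      = char std_normal_distribution a"
    unfolding char_def by (subst integral_density) auto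
  then have *: "(LINT t|lborel. std_normal_density t *\<^sub>R exp (\<i> * complex_of_real (a * t))) = exp (- (a^2) / 2)"
    by (simp add: char_std_normal_distribution)
  have "(LINT t|lborel. exp (\<i> * complex_of_real (a * t)) * complex_of_real (exp (- t\<^sup>2 / 2)))
    = (LINT t|lborel. sqrt (2 * pi) *\<^sub>R (std_normal_density t *\<^sub>R exp (\<i> * complex_of_real (a * t))))"
    by (intro Bochner_Integration.integral_cong refl)
      (simp add: std_normal_density_def scaleR_conv_of_real)
  also have "\<dots> = sqrt (2 * pi) *\<^sub>R complex_of_real (exp (- (a^2) / 2))"
    by (subst integral_scaleR_right) (simp only: *)
  finally show ?thesis by (simp add: scaleR_conv_of_real)
qed

lemma integrable_gaussian: "integrable lborel (\<lambda>t :: real. exp (- t\<^sup>2 / 2))"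
proof -
  have "integrable lborel (\<lambda>t. sqrt (2 * pi) * std_normal_density t)"
    using integrable_normal_density[of 1 0] by simp
  then show ?thesis by (simp add: std_normal_density_def)
qed

lemma integrable_gaussian_scaled: 
  assumes "s \<noteq> 0" shows "integrable lborel (\<lambda>t :: real. exp (- (s * t)\<^sup>2 / 2))"
  using lborel_integrable_real_affine[OF integrable_gaussian assms, of 0] by simp

text \<open>Swapping the integrals moves the Gaussian regularization from \<open>ft f\<close> to \<open>f\<close>, where it is an
  approximate identity.\<close>

lemma ft_gaussian:
  fixes x s :: real
  assumes f: "quad_decay C f" and s: "s > 0"
  shows "(LINT \<zeta>|lborel. ft f \<zeta> * exp (\<i> * x * \<zeta>) * complex_of_real (exp (- (s * \<zeta>)\<^sup>2 / 2)))
    = complex_of_real (sqrt (2 * pi)) * (LINT w|lborel. f (x + s * w) * complex_of_real (exp (- w\<^sup>2 / 2)))"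
proof -
  let ?G = "\<lambda>t :: real. complex_of_real (exp (- t\<^sup>2 / 2))"
  let ?K = "\<lambda>\<zeta> y :: real. exp (\<i> * complex_of_real ((x - y) * \<zeta>))"
  let ?k = "\<lambda>\<zeta> y. f y * ?K \<zeta> y * ?G (s * \<zeta>)"
  have [measurable]: "f \<in> borel_measurable borel" using f by (rule quad_decay_measurable)
  have nk: "norm (?k \<zeta> y) = norm (f y) * exp (- (s * \<zeta>)\<^sup>2 / 2)" for \<zeta> y
    by (simp add: norm_mult del: of_real_mult)
  \<comment> \<open>The Gaussian makes the kernel integrable in \<zeta>, where its modulus would
    otherwise be constant; the decay of \<open>f\<close> does the same in y.\<close>
  have int: "integrable (lborel \<Otimes>\<^sub>M lborel) (\<lambda>(\<zeta>, y). ?k \<zeta> y)"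
  proof (rule lborel_pair.Fubini_integrable)
    have e: "(LINT y|lborel. norm (?k \<zeta> y)) = (LINT y|lborel. norm (f y)) * exp (- (s * \<zeta>)\<^sup>2 / 2)" for \<zeta>
      unfolding nk by (rule integral_mult_left_zero)
    show "integrable lborel (\<lambda>\<zeta>. LINT y|lborel. norm (case (\<zeta>, y) of (\<zeta>, y) \<Rightarrow> ?k \<zeta> y))"
      unfolding prod.case e using s by (intro integrable_mult_right integrable_gaussian_scaled) simp
    have "integrable lborel (\<lambda>y. ?k \<zeta> y)" for \<zeta>
    proof (rule Bochner_Integration.integrable_bound[OF quad_decay_integrable[OF f]])
      show "(\<lambda>y. ?k \<zeta> y) \<in> borel_measurable lborel" by measurable
      have "norm (?k \<zeta> y) \<le> norm (f y)" for y
        unfolding nk by (rule mult_left_le) auto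
      then show "AE y in lborel. norm (?k \<zeta> y) \<le> norm (f y)" by (intro AE_I2)
    qed
    then show "AE \<zeta> in lborel. integrable lborel (\<lambda>y. case (\<zeta>, y) of (\<zeta>, y) \<Rightarrow> ?k \<zeta> y)"
      unfolding prod.case by (intro AE_I2)
    show "(\<lambda>(\<zeta>, y). ?k \<zeta> y) \<in> borel_measurable (lborel \<Otimes>\<^sub>M lborel)"
      by measurable
  qed
  have swap: "(LINT \<zeta>|lborel. LINT y|lborel. ?k \<zeta> y) = (LINT y|lborel. LINT \<zeta>|lborel. ?k \<zeta> y)"
    using lborel_pair.Fubini_integral[OF int] by (rule sym)
  have "(LINT y|lborel. ?k \<zeta> y) = ft f \<zeta> * exp (\<i> * x * \<zeta>) * ?G (s * \<zeta>)" for \<zeta>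
  proof -
    have eq: "?k \<zeta> y = (f y * exp (- \<i> * \<zeta> * y)) * (exp (\<i> * x * \<zeta>) * ?G (s * \<zeta>))" for y
    proof -
      have "?K \<zeta> y = exp (- \<i> * \<zeta> * y) * exp (\<i> * x * \<zeta>)"
        unfolding exp_add[symmetric] by (simp add: algebra_simps)
      then show ?thesis by (simp only: mult.assoc)
    qed
    show ?thesis
      unfolding eq ft_def integral_mult_left_zero by (rule mult.assoc[symmetric])
  qed
  then have lhs: "(LINT \<zeta>|lborel. ft f \<zeta> * exp (\<i> * x * \<zeta>) * ?G (s * \<zeta>)) = (LINT \<zeta>|lborel. LINT y|lborel. ?k \<zeta> y)"
    by simp
  have inner: "(LINT \<zeta>|lborel. ?K \<zeta> y * ?G (s * \<zeta>)) = complex_of_real (sqrt (2 * pi) / s) * ?G ((y - x) / s)" for y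
  proof -
    have "(LINT t|lborel. exp (\<i> * complex_of_real ((x - y) / s * t)) * ?G t)
       = \<bar>s\<bar> *\<^sub>R (LINT \<zeta>|lborel. exp (\<i> * complex_of_real ((x - y) / s * (0 + s * \<zeta>))) * ?G (0 + s * \<zeta>))"
      using s by (intro lborel_integral_real_affine[where c = s and t = 0
          and f = "\<lambda>t. exp (\<i> * complex_of_real ((x - y) / s * t)) * ?G t"]) simp
    also have "\<dots> = s *\<^sub>R (LINT \<zeta>|lborel. ?K \<zeta> y * ?G (s * \<zeta>))"
      using s by simp
    finally have e: "complex_of_real (sqrt (2 * pi) * exp (- ((x - y) / s)\<^sup>2 / 2)) = s *\<^sub>R (LINT \<zeta>|lborel. ?K \<zeta> y * ?G (s * \<zeta>))"
      unfolding gaussian_ft .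
    have "I = c / complex_of_real s" if "c = s *\<^sub>R I" for I c :: complex
      using that s by (simp add: scaleR_conv_of_real)
    from this[OF e] have "(LINT \<zeta>|lborel. ?K \<zeta> y * ?G (s * \<zeta>)) = complex_of_real (sqrt (2 * pi) * exp (- ((x - y) / s)\<^sup>2 / 2)) / complex_of_real s" .
    also have "((x - y) / s)\<^sup>2 = ((y - x) / s)\<^sup>2"
      unfolding power_divide by (subst power2_commute) (rule refl)
    finally show ?thesis by simp
  qed
  have outer: "(LINT \<zeta>|lborel. ?k \<zeta> y) = complex_of_real (sqrt (2 * pi) / s) * (f y * ?G ((y - x) / s))" for y
    unfolding mult.assoc integral_mult_right_zero inner by (rule mult.left_commute)
  have "(LINT y|lborel. LINT \<zeta>|lborel. ?k \<zeta> y)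
      = (LINT y|lborel. complex_of_real (sqrt (2 * pi) / s) * (f y * ?G ((y - x) / s)))"
    unfolding outer ..
  also have "\<dots> = complex_of_real (sqrt (2 * pi) / s) * (LINT y|lborel. f y * ?G ((y - x) / s))"
    by (rule integral_mult_right_zero)
  \<comment> \<open>The substitution y = x + s w; its factor s cancels the 1 / s from the inner
    integral.\<close>
  also have "(LINT y|lborel. f y * ?G ((y - x) / s))
     = \<bar>s\<bar> *\<^sub>R (LINT w|lborel. f (x + s * w) * ?G ((x + s * w - x) / s))"
    using s by (intro lborel_integral_real_affine[where c = s and t = x
          and f = "\<lambda>y. f y * ?G ((y - x) / s)"]) simp
  also have "\<dots> = s *\<^sub>R (LINT w|lborel. f (x + s * w) * ?G w)"
    using s by simp
  finally have "(LINT y|lborel. LINT \<zeta>|lborel. ?k \<zeta> y)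
      = complex_of_real (sqrt (2 * pi) / s) * (s *\<^sub>R (LINT w|lborel. f (x + s * w) * ?G w))" .
  moreover have "complex_of_real (c / s) * (s *\<^sub>R I) = complex_of_real c * I" for c and I :: complex
    using s by (simp add: scaleR_conv_of_real)
  ultimately show ?thesis by (simp only: lhs swap)
qed

text \<open>Let s tend to 0 in \<open>ft_gaussian\<close>. Dominated convergence applies on the left
  with majorant |ft f|, and on the right with a multiple of the Gaussian, as \<open>f\<close> is
  bounded and continuous. The constant 2 pi is sqrt(2 pi) squared: one factor comes from
  \<open>ft_gaussian\<close>, one is the total mass of the Gaussian.\<close>

theorem fourier_inversion:
  fixes f :: "real \<Rightarrow> complex" and x :: real
  assumes f: "quad_decay C f" and ff: "quad_decay C' (ft f)"
  shows "(LINT \<zeta>|lborel. ft f \<zeta> * exp (\<i> * x * \<zeta>)) = 2 * pi * f x"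
proof -
  let ?G = "\<lambda>t :: real. complex_of_real (exp (- t\<^sup>2 / 2))"
  define s where "s n = 1 / real (Suc n)" for n
  have s0: "s n > 0" for n by (simp add: s_def)
  have s: "s \<longlonglongrightarrow> 0" unfolding s_def by (rule LIMSEQ_Suc[OF lim_1_over_n]) 
  have [measurable]: "f \<in> borel_measurable borel" "ft f \<in> borel_measurable borel"
    using f ff by (auto intro: quad_decay_measurable)
  have cf: "isCont f x" using f by (simp add: quad_decay_def continuous_on_eq_continuous_at)
  have fC: "norm (f y) \<le> C" for y
  proof -
    have "norm (f y) \<le> C * inverse (1 + y\<^sup>2)" using f by (simp add: quad_decay_def)
    also have "\<dots> \<le> C * 1" using quad_decay_nonneg[OF f]
      by (intro mult_left_mono) (auto simp: inverse_le_1_iff add_pos_nonneg)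
    finally show ?thesis by simp
  qed
  have "(\<lambda>n. LINT \<zeta>|lborel. ft f \<zeta> * exp (\<i> * x * \<zeta>) * ?G (s n * \<zeta>))
      \<longlonglongrightarrow> (LINT \<zeta>|lborel. ft f \<zeta> * exp (\<i> * x * \<zeta>))"
  proof (rule integral_dominated_convergence[where w = "\<lambda>\<zeta>. norm (ft f \<zeta>)"])
    show "integrable lborel (\<lambda>\<zeta>. norm (ft f \<zeta>))"
      using quad_decay_integrable[OF ff] by simp
    have "(\<lambda>n. ft f \<zeta> * exp (\<i> * x * \<zeta>) * ?G (s n * \<zeta>)) \<longlonglongrightarrow> ft f \<zeta> * exp (\<i> * x * \<zeta>) * ?G (0 * \<zeta>)" for \<zeta>
      by (intro tendsto_intros s) auto
    then show "AE \<zeta> in lborel. (\<lambda>n. ft f \<zeta> * exp (\<i> * x * \<zeta>) * ?G (s n * \<zeta>)) \<longlonglongrightarrow> ft f \<zeta> * exp (\<i> * x * \<zeta>)"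
      by simp
    show "AE \<zeta> in lborel. norm (ft f \<zeta> * exp (\<i> * x * \<zeta>) * ?G (s n * \<zeta>)) \<le> norm (ft f \<zeta>)" for n
      by (simp add: norm_mult mult_left_le)
  qed measurable
  moreover have "(\<lambda>n. complex_of_real (sqrt (2 * pi)) * (LINT w|lborel. f (x + s n * w) * ?G w))
      \<longlonglongrightarrow> complex_of_real (sqrt (2 * pi)) * (LINT w|lborel. f x * ?G w)"
  proof (intro tendsto_mult_left integral_dominated_convergence[where w = "\<lambda>w. C * exp (- w\<^sup>2 / 2)"])
    show "integrable lborel (\<lambda>w. C * exp (- w\<^sup>2 / 2))"
      using integrable_gaussian by simp
    have "(\<lambda>n. f (x + s n * w) * ?G w) \<longlonglongrightarrow> f x * ?G w" for w
    proof -
      have "(\<lambda>n. x + s n * w) \<longlonglongrightarrow> x + 0 * w" by (intro tendsto_intros s)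
      then have "(\<lambda>n. f (x + s n * w)) \<longlonglongrightarrow> f x" using isCont_tendsto_compose[OF cf] by simp
      then show ?thesis by (intro tendsto_intros)
    qed
    then show "AE w in lborel. (\<lambda>n. f (x + s n * w) * ?G w) \<longlonglongrightarrow> f x * ?G w" by simp
    show "AE w in lborel. norm (f (x + s n * w) * ?G w) \<le> C * exp (- w\<^sup>2 / 2)" for n
      by (auto simp: norm_mult intro!: AE_I2 mult_right_mono fC)
  qed measurable
  ultimately have "(LINT \<zeta>|lborel. ft f \<zeta> * exp (\<i> * x * \<zeta>))
      = complex_of_real (sqrt (2 * pi)) * (LINT w|lborel. f x * ?G w)"
    unfolding ft_gaussian[OF f s0] by (rule LIMSEQ_unique)
  also have "(LINT w|lborel. f x * ?G w) = f x * (LINT w|lborel. ?G w)"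
    by (rule integral_mult_right_zero)
  also have "(LINT w|lborel. ?G w) = complex_of_real (sqrt (2 * pi))"
    using gaussian_ft[of 0] by simp
  finally have *: "(LINT \<zeta>|lborel. ft f \<zeta> * exp (\<i> * x * \<zeta>))
      = complex_of_real (sqrt (2 * pi)) * (f x * complex_of_real (sqrt (2 * pi)))" .
  have "complex_of_real (sqrt (2 * pi)) * complex_of_real (sqrt (2 * pi)) = complex_of_real (2 * pi)"
    unfolding of_real_mult[symmetric] by (subst real_sqrt_mult_self) simp
  then have "complex_of_real (sqrt (2 * pi)) * (f x * complex_of_real (sqrt (2 * pi))) = complex_of_real (2 * pi) * f x"
    by (simp only: mult_ac)
  then show ?thesis unfolding * .
qed

section \<open>Smooth functions and the classical Schwartz space\<close>

lemma nth_deriv_nth_deriv: "nth_deriv k (nth_deriv m f) = nth_deriv (k + m) f"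
  by (simp add: nth_deriv_def funpow_add)

lemma smooth_nth_deriv_smooth: "smooth f \<Longrightarrow> smooth (nth_deriv m f)"
  by (simp add: smooth_def nth_deriv_nth_deriv)

lemma nth_deriv_linear:
  assumes "smooth f" "smooth g"
  shows "nth_deriv k (\<lambda>x. a * f x + b * g x) = (\<lambda>x. a * nth_deriv k f x + b * nth_deriv k g x)"
    and "smooth (\<lambda>x. a * f x + b * g x)"
proof -
  let ?G = "\<lambda>k x. a * nth_deriv k f x + b * nth_deriv k g x"
  have "(?G k has_vector_derivative ?G (Suc k) x) (at x)" for k x
    by (intro derivative_intros smooth_nth_deriv assms)
  from nth_derivI[of ?G, OF this] 
  show "nth_deriv k (\<lambda>x. a * f x + b * g x) = (\<lambda>x. a * nth_deriv k f x + b * nth_deriv k g x)"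
    and "smooth (\<lambda>x. a * f x + b * g x)" by simp_all
qed

text \<open>The Leibniz rule stops after two terms because the second derivative of x is 0. For
  \<open>k = 0\<close> the truncated index \<open>k - 1\<close> is harmless, its coefficient being
  0.\<close>

lemma nth_deriv_times_ident:
  assumes "smooth f"
  shows "nth_deriv k (\<lambda>x. complex_of_real x * f x)
      = (\<lambda>x. complex_of_real x * nth_deriv k f x + of_nat k * nth_deriv (k - 1) f x)"
    and "smooth (\<lambda>x. complex_of_real x * f x)"
proof -
  let ?G = "\<lambda>k x. complex_of_real x * nth_deriv k f x + of_nat k * nth_deriv (k - 1) f x"
  have "(?G k has_vector_derivative ?G (Suc k) x) (at x)" for k x
  proof (cases k)
    case 0
    then show ?thesis
      using smooth_nth_deriv[OF assms, of k x]
      by (auto intro!: derivative_eq_intros has_vector_derivative_mult simp: scaleR_conv_of_real)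
  next
    case (Suc m)
    have "((\<lambda>x. complex_of_real x) has_vector_derivative 1) (at x)"
      by (auto intro!: derivative_eq_intros)
    from has_vector_derivative_add[OF has_vector_derivative_mult[OF this smooth_nth_deriv[OF assms, of k x]]
        has_vector_derivative_mult_right[OF smooth_nth_deriv[OF assms, of m x], of "of_nat k"]]
    show ?thesis
      using Suc by (simp add: algebra_simps)
  qed
  from nth_derivI[of ?G, OF this] 
  show "nth_deriv k (\<lambda>x. complex_of_real x * f x)
      = (\<lambda>x. complex_of_real x * nth_deriv k f x + of_nat k * nth_deriv (k - 1) f x)"
    and "smooth (\<lambda>x. complex_of_real x * f x)" by simp_all
qed

lemma nth_deriv_reflect:
  assumes "smooth f"
  shows "nth_deriv k (\<lambda>x. f (- x)) = (\<lambda>x. (- 1) ^ k * nth_deriv k f (- x))"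
    and "smooth (\<lambda>x. f (- x))"
proof -
  let ?G = "\<lambda>k x. (- 1) ^ k * nth_deriv k f (- x)"
  have "(?G k has_vector_derivative ?G (Suc k) x) (at x)" for k x
  proof -
    have "(uminus has_vector_derivative (- 1 :: real)) (at x)"
      by (auto intro!: derivative_eq_intros)
    from vector_diff_chain_at[OF this smooth_nth_deriv[OF assms, of k "- x"]]
    have "((\<lambda>x. nth_deriv k f (- x)) has_vector_derivative - nth_deriv (Suc k) f (- x)) (at x)"
      by (simp add: o_def)
    from has_vector_derivative_mult_right[OF this, of "(- 1) ^ k"] show ?thesis by simp
  qed
  from nth_derivI[of ?G, OF this] 
  show "nth_deriv k (\<lambda>x. f (- x)) = (\<lambda>x. (- 1) ^ k * nth_deriv k f (- x))"
    and "smooth (\<lambda>x. f (- x))" by simp_all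
qed

definition schwartz :: "(real \<Rightarrow> complex) \<Rightarrow> bool" where
  "schwartz f \<longleftrightarrow> smooth f \<and> (\<forall>j k. \<exists>C. \<forall>x. norm (complex_of_real x ^ j * nth_deriv k f x) \<le> C)"

lemma schwartz_smooth: "schwartz f \<Longrightarrow> smooth f"
  by (simp add: schwartz_def)

lemma schwartz_bound: "schwartz f \<Longrightarrow> \<exists>C. \<forall>x. norm (complex_of_real x ^ j * nth_deriv k f x) \<le> C"
  by (simp add: schwartz_def)

lemma schwartz_nth_deriv: "schwartz f \<Longrightarrow> schwartz (nth_deriv m f)"
  by (simp add: schwartz_def nth_deriv_nth_deriv smooth_nth_deriv_smooth)

lemma schwartz_quad_decay:
  assumes "schwartz f" shows "\<exists>C. quad_decay C f"
proof -
  obtain M N where "\<And>x. norm (complex_of_real x ^ 0 * nth_deriv 0 f x) \<le> M"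
    "\<And>x. norm (complex_of_real x ^ 2 * nth_deriv 0 f x) \<le> N"
    using schwartz_bound[OF assms] by meson
  then have "quad_decay (M + N) f"
    using smooth_continuous[of f 0] assms by (intro quad_decayI) (auto simp: schwartz_smooth)
  then show ?thesis ..
qed

lemma schwartz_linear:
  assumes "schwartz f" "schwartz g"
  shows "schwartz (\<lambda>x. a * f x + b * g x)"
  unfolding schwartz_def
proof (intro conjI allI)
  show "smooth (\<lambda>x. a * f x + b * g x)" using assms by (intro nth_deriv_linear) (auto simp: schwartz_smooth)
  fix j k
  obtain M N where 1: "\<And>x. norm (complex_of_real x ^ j * nth_deriv k f x) \<le> M"
    "\<And>x. norm (complex_of_real x ^ j * nth_deriv k g x) \<le> N"
    using schwartz_bound[OF assms(1)] schwartz_bound[OF assms(2)] by meson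
  have "norm (complex_of_real x ^ j * nth_deriv k (\<lambda>x. a * f x + b * g x) x) \<le> norm a * M + norm b * N" for x
  proof -
    have "complex_of_real x ^ j * nth_deriv k (\<lambda>x. a * f x + b * g x) x
      = a * (complex_of_real x ^ j * nth_deriv k f x) + b * (complex_of_real x ^ j * nth_deriv k g x)"
      using assms by (simp add: nth_deriv_linear schwartz_smooth algebra_simps)
    also have "norm \<dots> \<le> norm a * M + norm b * N"
      by (intro order_trans[OF norm_triangle_ineq] add_mono) (auto simp: norm_mult[of a] norm_mult[of b] intro!: mult_left_mono 1)
    finally show ?thesis .
  qed
  then show "\<exists>C. \<forall>x. norm (complex_of_real x ^ j * nth_deriv k (\<lambda>x. a * f x + b * g x) x) \<le> C" by blast
qed

lemma schwartz_zero [simp]: "schwartz (\<lambda>x. 0)"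
proof -
  have "nth_deriv k (\<lambda>x. 0 :: complex) = (\<lambda>x. 0)" "smooth (\<lambda>x. 0 :: complex)" for k
    using nth_derivI[of "\<lambda>k x. 0 :: complex"] by simp_all
  then show ?thesis by (auto simp: schwartz_def)
qed

lemma schwartz_cmult: "schwartz f \<Longrightarrow> schwartz (\<lambda>x. a * f x)"
  using schwartz_linear[of f "\<lambda>x. 0" a 0] by simp

lemma schwartz_times_ident:
  assumes "schwartz f"
  shows "schwartz (\<lambda>x. complex_of_real x * f x)"
  unfolding schwartz_def
proof (intro conjI allI)
  show "smooth (\<lambda>x. complex_of_real x * f x)" using assms by (intro nth_deriv_times_ident) (auto simp: schwartz_smooth)
  fix j k
  obtain M N where 1: "\<And>x. norm (complex_of_real x ^ Suc j * nth_deriv k f x) \<le> M"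
    "\<And>x. norm (complex_of_real x ^ j * nth_deriv (k - 1) f x) \<le> N"
    using schwartz_bound[OF assms] by meson
  have "norm (complex_of_real x ^ j * nth_deriv k (\<lambda>x. complex_of_real x * f x) x) \<le> M + real k * N" for x
  proof -
    have "complex_of_real x ^ j * nth_deriv k (\<lambda>x. complex_of_real x * f x) x
      = (complex_of_real x ^ Suc j * nth_deriv k f x) + of_nat k * (complex_of_real x ^ j * nth_deriv (k - 1) f x)"
      using assms by (simp add: nth_deriv_times_ident schwartz_smooth algebra_simps)
    also have "norm \<dots> \<le> M + real k * N"
      by (intro order_trans[OF norm_triangle_ineq] add_mono 1)
        (simp only: norm_mult[of "of_nat k"] norm_of_nat mult_left_mono 1 of_nat_0_le_iff)
    finally show ?thesis .
  qed
  then show "\<exists>C. \<forall>x. norm (complex_of_real x ^ j * nth_deriv k (\<lambda>x. complex_of_real x * f x) x) \<le> C" by blast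
qed

lemma schwartz_reflect:
  assumes "schwartz f"
  shows "schwartz (\<lambda>x. f (- x))"
  unfolding schwartz_def
proof (intro conjI allI)
  show "smooth (\<lambda>x. f (- x))" using assms by (intro nth_deriv_reflect) (auto simp: schwartz_smooth)
  fix j k
  obtain M where 1: "\<And>x. norm (complex_of_real x ^ j * nth_deriv k f x) \<le> M"
    using schwartz_bound[OF assms] by meson
  have "norm (complex_of_real x ^ j * nth_deriv k (\<lambda>x. f (- x)) x) \<le> M" for x
    using 1[of "- x"] assms by (simp add: nth_deriv_reflect schwartz_smooth norm_mult norm_power)
  then show "\<exists>C. \<forall>x. norm (complex_of_real x ^ j * nth_deriv k (\<lambda>x. f (- x)) x) \<le> C" by blast
qed

lemma schwartz_power: "schwartz f \<Longrightarrow> schwartz (\<lambda>x. (- \<i> * complex_of_real x) ^ k * f x)"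
proof (induction k)
  case (Suc k)
  from schwartz_cmult[OF schwartz_times_ident[OF this(1)[OF this(2)]], of "- \<i>"]
  show ?case by (simp add: algebra_simps)
qed simp

lemma
  assumes f: "schwartz f"
  shows nth_deriv_ft: "nth_deriv k (ft f) = ft (\<lambda>x. (- \<i> * complex_of_real x) ^ k * f x)"
    and smooth_ft: "smooth (ft f)"
proof -
  let ?G = "\<lambda>k. ft (\<lambda>x. (- \<i> * complex_of_real x) ^ k * f x)"
  have "(?G k has_vector_derivative ?G (Suc k) x) (at x)" for k x
  proof -
    have e: "(- \<i> * complex_of_real x) ^ Suc k * f x = - \<i> * complex_of_real x * ((- \<i> * complex_of_real x) ^ k * f x)" for x k
      by (simp only: power_Suc mult.assoc)
    \<comment> \<open>Three consecutive powers of x supply the three decay hypotheses of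
      \<open>ft_has_derivative\<close>.\<close>
    show ?thesis unfolding e 
      by (rule schwartz_quad_decay[OF schwartz_power[OF f, of k], THEN exE],
          rule schwartz_quad_decay[OF schwartz_power[OF f, of "Suc k"], unfolded e, THEN exE],
          rule schwartz_quad_decay[OF schwartz_power[OF f, of "Suc (Suc k)"], unfolded e, THEN exE],
          rule ft_has_derivative)
  qed
  from nth_derivI[of ?G, OF this] show "nth_deriv k (ft f) = ?G k" "smooth (ft f)"
    by simp_all
qed

lemma ft_nth_deriv:
  assumes f: "schwartz f"
  shows "ft (nth_deriv j f) \<zeta> = (\<i> * \<zeta>) ^ j * ft f \<zeta>"
proof (induction j)
  case (Suc j)
  obtain C C' where "quad_decay C (nth_deriv j f)" "quad_decay C' (nth_deriv (Suc j) f)"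
    using schwartz_nth_deriv[OF f] schwartz_quad_decay by meson
  from ft_derivative[OF this smooth_nth_deriv[OF schwartz_smooth[OF f]]] Suc show ?case by simp
qed simp

text \<open>Up to a factor of modulus 1, \<zeta>^j times the k-th derivative of the transform is the
  transform of the j-th derivative of (-ix)^k f. That is again a Schwartz function, and its
  transform is bounded.\<close>

lemma schwartz_ft:
  assumes f: "schwartz f"
  shows "schwartz (ft f)"
  unfolding schwartz_def
proof (intro conjI allI)
  show "smooth (ft f)" by (rule smooth_ft[OF f])
  fix j k
  let ?g = "\<lambda>x. (- \<i> * complex_of_real x) ^ k * f x"
  obtain C where C: "quad_decay C (nth_deriv j ?g)"
    using schwartz_nth_deriv[OF schwartz_power[OF f]] schwartz_quad_decay by meson
  have "norm (complex_of_real \<zeta> ^ j * nth_deriv k (ft f) \<zeta>) \<le> C * pi" for \<zeta>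
    using norm_ft_le[OF C, of \<zeta>] unfolding ft_nth_deriv[OF schwartz_power[OF f]] nth_deriv_ft[OF f]
    by (simp add: norm_mult norm_power)
  then show "\<exists>C. \<forall>\<zeta>. norm (complex_of_real \<zeta> ^ j * nth_deriv k (ft f) \<zeta>) \<le> C" by blast
qed

lemma ft_linear:
  assumes "schwartz f" "schwartz g"
  shows "ft (\<lambda>x. a * f x + b * g x) \<zeta> = a * ft f \<zeta> + b * ft g \<zeta>"
proof -
  obtain C D where "quad_decay C f" "quad_decay D g"
    using assms schwartz_quad_decay by meson
  note I = this[THEN ft_integrable, of \<zeta>]
  have "(a * f x + b * g x) * exp (- \<i> * complex_of_real \<zeta> * complex_of_real x)
    = a * (f x * exp (- \<i> * complex_of_real \<zeta> * complex_of_real x))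
      + b * (g x * exp (- \<i> * complex_of_real \<zeta> * complex_of_real x))" for x
    by (simp add: algebra_simps)
  then show ?thesis
    unfolding ft_def using I by (simp add: Bochner_Integration.integral_add)
qed

text \<open>Expressed through \<open>ft\<close> of the reflected function, so that every property of
  \<open>ft\<close> carries over; \<open>ift_eq\<close> gives the usual integral.\<close>

definition ift :: "(real \<Rightarrow> complex) \<Rightarrow> real \<Rightarrow> complex" where
  "ift g x = ft (\<lambda>y. g (- y)) x / (2 * pi)"

lemma ift_eq: "ift g x = 1 / (2 * pi) * (LINT \<zeta>|lborel. g \<zeta> * exp (\<i> * x * \<zeta>))"
proof -
  have "(LINT \<zeta>|lborel. g \<zeta> * exp (\<i> * x * \<zeta>))
      = \<bar>- 1\<bar> *\<^sub>R (LINT \<zeta>|lborel. g (0 + - 1 * \<zeta>) * exp (\<i> * x * complex_of_real (0 + - 1 * \<zeta>)))"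
    by (rule lborel_integral_real_affine[where c = "- 1" and t = 0
          and f = "\<lambda>\<zeta>. g \<zeta> * exp (\<i> * x * complex_of_real \<zeta>)"]) simp
  then show ?thesis by (simp add: ift_def ft_def)
qed

lemma schwartz_ift:
  assumes "schwartz g" shows "schwartz (ift g)"
  unfolding ift_def[abs_def]
  using schwartz_cmult[OF schwartz_ft[OF schwartz_reflect[OF assms]], of "1 / (2 * pi)"] by simp

lemma ift_ft:
  assumes "schwartz f" shows "ift (ft f) = f"
proof
  fix x
  obtain C D where "quad_decay C f" "quad_decay D (ft f)"
    using assms schwartz_ft schwartz_quad_decay by meson
  from fourier_inversion[OF this] show "ift (ft f) x = f x" by (simp add: ift_eq)
qed

text \<open>The inversion theorem for the reflected function, read at -x.\<close>

lemma ft_ift: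
  assumes "schwartz g" shows "ft (ift g) = g"
proof
  fix x
  let ?r = "\<lambda>x. g (- x)"
  have r: "schwartz ?r" using assms by (rule schwartz_reflect)
  obtain C D where "quad_decay C ?r" "quad_decay D (ft ?r)"
    using r schwartz_ft schwartz_quad_decay by meson
  from fourier_inversion[OF this, of "- x"] show "ft (ift g) x = g x"
    by (simp add: ft_def[of "ift g"]) (simp add: ift_def[abs_def])
qed

lemma ift_linear:
  assumes "schwartz f" "schwartz g"
  shows "ift (\<lambda>x. a * f x + b * g x) \<zeta> = a * ift f \<zeta> + b * ift g \<zeta>"
  using ft_linear[OF assms[THEN schwartz_reflect]] by (simp add: ift_def add_divide_distrib)

lemma ift_times_ident:
  assumes "schwartz h"
  shows "ift (\<lambda>\<zeta>. \<i> * complex_of_real \<zeta> * h \<zeta>) x = nth_deriv 1 (ift h) x"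
proof -
  let ?r = "\<lambda>x. h (- x)"
  have r: "schwartz ?r" using assms by (rule schwartz_reflect)
  have "nth_deriv 1 (\<lambda>x. 1 / (2 * pi) * ft ?r x + 0 * ft ?r x) x = 1 / (2 * pi) * nth_deriv 1 (ft ?r) x + 0 * nth_deriv 1 (ft ?r) x"
    by (subst nth_deriv_linear) (simp_all add: smooth_ft[OF r])
  also have "nth_deriv 1 (ft ?r) = ft (\<lambda>x. - \<i> * complex_of_real x * h (- x))"
    by (simp add: nth_deriv_ft[OF r])
  finally show ?thesis by (simp add: ift_def[abs_def])
qed

text \<open>The quantitative form behind continuity of the inverse. Bounding the transform of the
  j-th derivative of h by \<open>norm_ft_le\<close> requires the weight \<zeta>^2 outside the
  derivative, whereas the seminorms of \<open>schwartz_RH\<close> control derivatives of \<zeta>^l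
  h, with the weight inside. The hypotheses are the terms that arise when the weight is moved
  inside.\<close>

lemma norm_ift_le:
  assumes h: "schwartz h"
    and 0: "\<And>\<zeta>. norm (nth_deriv j h \<zeta>) \<le> M0"
    and 1: "\<And>\<zeta>. norm (nth_deriv (j - 1) (\<lambda>\<zeta>. complex_of_real \<zeta> * h \<zeta>) \<zeta>) \<le> M1"
    and 2: "\<And>\<zeta>. norm (nth_deriv j (\<lambda>\<zeta>. complex_of_real \<zeta> ^ 2 * h \<zeta>) \<zeta>) \<le> M2"
    and 3: "\<And>\<zeta>. norm (nth_deriv (j - 2) h \<zeta>) \<le> M3"
  shows "norm (complex_of_real x ^ j * ift h x) \<le> M0 + real (2 * j) * M1 + M2 + real (j * (j - 1)) * M3"
proof -
  let ?x = complex_of_real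
  let ?r = "\<lambda>x. h (- x)"
  have r: "schwartz ?r" using h by (rule schwartz_reflect)
  note s = schwartz_smooth[OF h]
  note s1 = nth_deriv_times_ident(2)[OF s]
  \<comment> \<open>The Leibniz rule for \<zeta>^2 h produces the corrections 2j \<zeta> h^(j-1) and
    j(j-1) h^(j-2). Replacing \<zeta> h^(j-1) by the (j-1)-st derivative of \<zeta> h adds 2j(j-1)
    h^(j-2) and so reverses the sign of the last term.\<close>
  have sq: "?x \<zeta> ^ 2 * nth_deriv j h \<zeta> = nth_deriv j (\<lambda>\<zeta>. ?x \<zeta> ^ 2 * h \<zeta>) \<zeta>
      - of_nat (2 * j) * nth_deriv (j - 1) (\<lambda>\<zeta>. ?x \<zeta> * h \<zeta>) \<zeta> + of_nat (j * (j - 1)) * nth_deriv (j - 2) h \<zeta>" for \<zeta>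
  proof -
    have "nth_deriv j (\<lambda>\<zeta>. ?x \<zeta> ^ 2 * h \<zeta>) \<zeta> = nth_deriv j (\<lambda>\<zeta>. ?x \<zeta> * (?x \<zeta> * h \<zeta>)) \<zeta>"
      by (simp add: power2_eq_square mult.assoc)
    then show ?thesis
      by (cases j) (simp_all add: nth_deriv_times_ident(1)[OF s1] nth_deriv_times_ident(1)[OF s] algebra_simps power2_eq_square numeral_2_eq_2)
  qed
  have b: "norm (?x \<zeta> ^ 2 * nth_deriv j h \<zeta>) \<le> M2 + (2 * j) * M1 + (j * (j - 1)) * M3" for \<zeta>
    unfolding sq
    by (intro order_trans[OF norm_triangle_ineq] order_trans[OF norm_triangle_ineq4] add_mono)
      (simp_all only: norm_mult norm_of_nat mult_left_mono 1 2 3 of_nat_0_le_iff)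
  have "quad_decay (M0 + (M2 + (2 * j) * M1 + (j * (j - 1)) * M3)) (nth_deriv j ?r)"
  proof (rule quad_decayI)
    show "continuous_on UNIV (nth_deriv j ?r)" using r by (intro smooth_continuous schwartz_smooth)
    show "norm (nth_deriv j ?r \<zeta>) \<le> M0" for \<zeta>
      using 0 by (simp add: nth_deriv_reflect[OF s] norm_mult norm_power)
    show "norm (\<zeta>\<^sup>2 * nth_deriv j ?r \<zeta>) \<le> M2 + (2 * j) * M1 + (j * (j - 1)) * M3" for \<zeta> :: real
      using b[of "- \<zeta>"] by (simp add: nth_deriv_reflect[OF s] norm_mult norm_power)
  qed
  from norm_ft_le[OF this, of x]
  have "norm (?x x ^ j * ft ?r x) \<le> (M0 + (M2 + (2 * j) * M1 + (j * (j - 1)) * M3)) * pi"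
    unfolding ft_nth_deriv[OF r] by (simp add: norm_mult norm_power)
  then have "norm (?x x ^ j * ift h x) * (2 * pi) \<le> (M0 + (M2 + (2 * j) * M1 + (j * (j - 1)) * M3)) * pi"
    by (simp add: ift_def norm_mult norm_divide)
  then have "2 * norm (?x x ^ j * ift h x) \<le> M0 + (M2 + (2 * j) * M1 + (j * (j - 1)) * M3)"
    by (simp add: mult.assoc[symmetric] mult.commute[of "norm _"])
  \<comment> \<open>The factor 1/2 from pi / (2 pi) is given away.\<close>
  then show ?thesis using norm_ge_zero[of "?x x ^ j * ift h x"] by linarith
qed

text \<open>The weights stand inside the derivatives, as in \<open>schwartz_RH\<close>. The
  hypotheses pass from h to h' because x^j h' = (x^j h)' - j x^(j-1) h; after k such passages, the
  case without derivative bounds x^j times the k-th derivative of h.\<close>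

lemma schwartzI_bounded_derivs:
  assumes "\<And>j. smooth (\<lambda>x. complex_of_real x ^ j * h x)"
    and "\<And>j k. \<exists>C. \<forall>x. norm (nth_deriv k (\<lambda>x. complex_of_real x ^ j * h x) x) \<le> C"
  shows "schwartz h"
proof -
  define P where "P h \<longleftrightarrow> (\<forall>j. smooth (\<lambda>x. complex_of_real x ^ j * h x)) \<and>
    (\<forall>j k. \<exists>C. \<forall>x. norm (nth_deriv k (\<lambda>x. complex_of_real x ^ j * h x) x) \<le> C)" for h
  have step: "P (nth_deriv 1 h)" if "P h" for h
  proof -
    have sm: "smooth (\<lambda>x. complex_of_real x ^ j * h x)" for j using that by (simp add: P_def)
    have "smooth h" using sm[of 0] by simp
    note d = smooth_nth_deriv[OF this, of 0, simplified]
    have "nth_deriv 1 (\<lambda>x. complex_of_real x ^ j * h x)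
        = (\<lambda>x. complex_of_real x ^ j * nth_deriv 1 h x + of_nat j * (complex_of_real x ^ (j - 1) * h x))" for j
    proof
      fix x
      have "((\<lambda>x. complex_of_real x ^ j * h x) has_vector_derivative
          complex_of_real x ^ j * nth_deriv 1 h x + of_nat j * complex_of_real x ^ (j - 1) * h x) (at x)"
        using d[of x] by (auto intro!: derivative_eq_intros has_vector_derivative_mult simp: scaleR_conv_of_real has_vector_derivative_def algebra_simps)
      then show "nth_deriv 1 (\<lambda>x. complex_of_real x ^ j * h x) x
        = complex_of_real x ^ j * nth_deriv 1 h x + of_nat j * (complex_of_real x ^ (j - 1) * h x)"
        by (simp add: nth_deriv_Suc vector_derivative_at mult.assoc)
    qed
    then have eq: "(\<lambda>x. complex_of_real x ^ j * nth_deriv 1 h x)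
        = (\<lambda>x. 1 * nth_deriv 1 (\<lambda>x. complex_of_real x ^ j * h x) x + (- of_nat j) * (complex_of_real x ^ (j - 1) * h x))" for j
      by (simp add: fun_eq_iff)
    show "P (nth_deriv 1 h)"
      unfolding P_def eq
    proof (intro conjI allI)
      fix j k
      note s2 = smooth_nth_deriv_smooth[OF sm[of j], of 1] sm[of "j - 1"]
      show "smooth (\<lambda>x. 1 * nth_deriv 1 (\<lambda>x. complex_of_real x ^ j * h x) x + (- of_nat j) * (complex_of_real x ^ (j - 1) * h x))"
        by (rule nth_deriv_linear(2)[OF s2])
      obtain C D where C: "\<And>x. norm (nth_deriv (k + 1) (\<lambda>x. complex_of_real x ^ j * h x) x) \<le> C"
        and D: "\<And>x. norm (nth_deriv k (\<lambda>x. complex_of_real x ^ (j - 1) * h x) x) \<le> D"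
        using \<open>P h\<close> unfolding P_def by meson
      have "norm (nth_deriv k (\<lambda>x. 1 * nth_deriv 1 (\<lambda>x. complex_of_real x ^ j * h x) x + (- of_nat j) * (complex_of_real x ^ (j - 1) * h x)) x)
        \<le> C + real j * D" for x
        unfolding nth_deriv_linear(1)[OF s2] nth_deriv_nth_deriv
        by (intro order_trans[OF norm_triangle_ineq] add_mono)
           (simp_all only: norm_mult norm_minus_cancel norm_of_nat norm_one mult_1_left C D mult_left_mono of_nat_0_le_iff)
      then show "\<exists>C. \<forall>x. norm (nth_deriv k (\<lambda>x. 1 * nth_deriv 1 (\<lambda>x. complex_of_real x ^ j * h x) x + (- of_nat j) * (complex_of_real x ^ (j - 1) * h x)) x) \<le> C"
        by blast
    qed
  qed
  have P: "P (nth_deriv k h)" for k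
  proof (induction k)
    case 0 then show ?case using assms by (simp add: P_def)
  next
    case (Suc k)
    from step[OF this] show ?case by (simp add: nth_deriv_nth_deriv)
  qed
  show ?thesis
    unfolding schwartz_def
  proof (intro conjI allI)
    show "smooth h" using assms(1)[of 0] by simp
    fix j k
    from P[of k] have "\<exists>C. \<forall>x. norm (nth_deriv 0 (\<lambda>x. complex_of_real x ^ j * nth_deriv k h x) x) \<le> C"
      unfolding P_def by blast
    then show "\<exists>C. \<forall>x. norm (complex_of_real x ^ j * nth_deriv k h x) \<le> C" by simp
  qed
qed

section \<open>The representation as an algebra homomorphism\<close>

text \<open>
  The product of \<open>\<H>\<^sub>\<zeta>\<close> depends on \<open>\<zeta>\<close>, so \<open>\<H>\<^sub>\<zeta>\<close> is not an instance of an algebra class.  Letting it act on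
  the spin module embeds it into an algebra to which the universal property of the enveloping
  algebra applies.
\<close>

typedef (overloaded) ('a::real_vector) endo = "{f :: 'a \<Rightarrow> 'a. linear f}"
  morphisms app Endo
  by (rule exI[of _ id]) (simp add: linear_id)

setup_lifting type_definition_endo

lemma endo_eqI: "(\<And>x. app f x = app g x) \<Longrightarrow> f = g"
  by (simp add: app_inject[symmetric] fun_eq_iff)

instantiation endo :: (euclidean_space) real_algebra_1
begin

lift_definition zero_endo :: "'a endo" is "\<lambda>_. 0" by (rule module_hom_zero)
lift_definition one_endo :: "'a endo" is "\<lambda>x. x" by (rule linear_ident)
lift_definition plus_endo :: "'a endo \<Rightarrow> 'a endo \<Rightarrow> 'a endo" is "\<lambda>f g x. f x + g x"
  by (rule linear_compose_add)
lift_definition minus_endo :: "'a endo \<Rightarrow> 'a endo \<Rightarrow> 'a endo" is "\<lambda>f g x. f x - g x"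
  by (rule linear_compose_sub)
lift_definition uminus_endo :: "'a endo \<Rightarrow> 'a endo" is "\<lambda>f x. - f x"
  by (rule linear_compose_neg)
lift_definition scaleR_endo :: "real \<Rightarrow> 'a endo \<Rightarrow> 'a endo" is "\<lambda>r f x. r *\<^sub>R f x"
  by (rule linear_compose_scale_right)
lift_definition times_endo :: "'a endo \<Rightarrow> 'a endo \<Rightarrow> 'a endo" is "\<lambda>f g x. f (g x)"
  using linear_compose[unfolded o_def] by blast

instance
proof
  \<comment> \<open>This needs a nonzero vector, which the sort \<open>euclidean_space\<close>
    provides.\<close>
  show "(0 :: 'a endo) \<noteq> 1"
  proof
    assume "(0 :: 'a endo) = 1"
    then have "app (0 :: 'a endo) b = app 1 b" for b by simp
    then have "b = 0" for b :: 'a by (simp add: zero_endo.rep_eq one_endo.rep_eq)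
    moreover obtain b :: 'a where "b \<in> Basis" using nonempty_Basis by blast
    ultimately show False using nonzero_Basis by metis
  qed
qed (transfer; simp add: fun_eq_iff algebra_simps linear_add linear_scale)+

end

lemma cscale_simps [simp]:
  "cscale c A $ i $ j = c * A $ i $ j"
  "cscale 1 A = A" "cscale 0 A = 0" "cscale c 0 = 0"
  "cscale c (A + B) = cscale c A + cscale c B" "cscale c (cscale d A) = cscale (c * d) A"
  "cscale c (A - B) = cscale c A - cscale c B" "cscale c (- A) = - cscale c A"
  by (simp_all add: cscale_def vec_eq_iff algebra_simps)

lemma cscale_matrix_mult [simp]:
  "cscale c A ** B = cscale c (A ** B)" "A ** cscale c B = cscale c (A ** B)"
  by (simp_all add: cscale_def matrix_matrix_mult_def vec_eq_iff sum_distrib_left algebra_simps)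

lemma cscale_matrix_vector [simp]: "cscale c A *v v = c *s (A *v v)"
  by (simp add: cscale_def matrix_vector_mult_def vec_eq_iff sum_distrib_left algebra_simps)

lemma cscale_minus_one: "cscale (- 1) A = - A"
  by (simp add: cscale_def vec_eq_iff)

lemma cscale_add_left: "cscale (c + d) A = cscale c A + cscale d A"
  by (simp add: vec_eq_iff algebra_simps)

lemma scaleR_cmat: "r *\<^sub>R A = cscale (of_real r) A"
  unfolding cscale_def vec_eq_iff vector_scaleR_component vec_lambda_beta by (simp add: scaleR_conv_of_real)

lemma scaleR_hmat: "r *\<^sub>R X = hscale (of_real r) X"
  by (simp add: hscale_def prod_eq_iff scaleR_cmat)

lemma hscale_simps [simp]:
  "hscale 1 X = X" "hscale c (hscale d X) = hscale (c * d) X"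
  "hscale c (X + Y) = hscale c X + hscale c Y" "hscale c 0 = 0" "hscale 0 X = 0"
  "hscale c (X - Y) = hscale c X - hscale c Y"
  "fst (hscale c X) = cscale c (fst X)" "snd (hscale c X) = cscale c (snd X)"
  by (simp_all add: hscale_def prod_eq_iff)

lemma hscale_add_left: "hscale (c + d) X = hscale c X + hscale d X"
  by (simp add: hscale_def prod_eq_iff cscale_add_left)

lemma hscale_minus_one: "hscale (- 1) X = - X"
  by (simp add: hscale_def prod_eq_iff cscale_minus_one)

lemma hscale_sum: "hscale c (sum f A) = (\<Sum>x\<in>A. hscale c (f x))"
  by (induction A rule: infinite_finite_induct) auto

lemma matrix_add_rdistrib:
  fixes A B :: "'a::semiring_1 ^ 'n ^ 'm"
  shows "(A + B) ** C = A ** C + B ** C"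
  by (simp add: matrix_matrix_mult_def vec_eq_iff distrib_right sum.distrib)

lemma hmul_scale [simp]:
  "hmul \<zeta> (hscale c X) Y = hscale c (hmul \<zeta> X Y)" "hmul \<zeta> X (hscale c Y) = hscale c (hmul \<zeta> X Y)"
  by (simp_all add: hmul_def prod_eq_iff mult.commute)

lemma hmul_add:
  "hmul \<zeta> (X + Y) Z = hmul \<zeta> X Z + hmul \<zeta> Y Z" "hmul \<zeta> X (Y + Z) = hmul \<zeta> X Y + hmul \<zeta> X Z"
  by (simp_all add: hmul_def prod_eq_iff matrix_add_ldistrib matrix_add_rdistrib)

lemma hmul_zero [simp]: "hmul \<zeta> 0 X = 0" "hmul \<zeta> X 0 = 0"
  by (simp_all add: hmul_def prod_eq_iff)

lemma hmul_one [simp]: "hmul \<zeta> hone X = X" "hmul \<zeta> X hone = X"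
  by (simp_all add: hmul_def hone_def)

lemma hmul_assoc: "hmul \<zeta> (hmul \<zeta> X Y) Z = hmul \<zeta> X (hmul \<zeta> Y Z)"
  by (simp add: hmul_def matrix_add_ldistrib matrix_add_rdistrib matrix_mul_assoc)

lemma hact_mul: "hact \<zeta> (hmul \<zeta> X Y) w = hact \<zeta> X (hact \<zeta> Y w)"
  by (simp add: hmul_def hact_def matrix_vector_mul_assoc[symmetric] matrix_vector_right_distrib
      matrix_vector_mult_add_rdistrib vector_add_ldistrib vector_scalar_commute algebra_simps)

lemma linear_hact: "linear (hact \<zeta> X)"
  by (rule linearI)
    (simp_all add: hact_def prod_eq_iff matrix_vector_right_distrib vector_add_ldistrib
      linear_scale[OF matrix_vector_mul_linear] scaleR_add_right vec_eq_iff)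

text \<open>A vector (x, 0) is sent to the pair of values of the two components of X at x, so the
  action is faithful for every \<zeta>, including 0.\<close>

lemma hact_inject:
  assumes "\<And>x. hact \<zeta> X (x, 0) = hact \<zeta> Y (x, 0)"
  shows "X = Y"
  using assms by (simp add: hact_def prod_eq_iff matrix_eq)

definition repr :: "complex \<Rightarrow> 'n::finite hmat \<Rightarrow> 'n svec endo" where
  "repr \<zeta> X = Endo (hact \<zeta> X)"

lemma app_repr: "app (repr \<zeta> X) = hact \<zeta> X"
  by (simp add: repr_def Endo_inverse linear_hact)

lemma repr_inject: "repr \<zeta> X = repr \<zeta> Y \<Longrightarrow> X = Y"
  by (rule hact_inject[of \<zeta>]) (metis app_repr)

lemma repr_hmul: "repr \<zeta> (hmul \<zeta> X Y) = repr \<zeta> X * repr \<zeta> Y"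
  by (rule endo_eqI) (simp add: app_repr times_endo.rep_eq hact_mul)

lemma repr_hone: "repr \<zeta> hone = 1"
  by (rule endo_eqI) (simp add: app_repr one_endo.rep_eq hact_def hone_def)

lemma repr_add: "repr \<zeta> (X + Y) = repr \<zeta> X + repr \<zeta> Y"
  by (rule endo_eqI) (simp add: app_repr plus_endo.rep_eq hact_def matrix_vector_mult_add_rdistrib
      vector_add_ldistrib)

lemma repr_uminus: "repr \<zeta> (- X) = - repr \<zeta> X"
  by (metis add_eq_0_iff repr_add add.right_neutral add_left_cancel)

lemma scaleR_complex_vec: "(r *\<^sub>R v) $ i = complex_of_real r * v $ i"
  unfolding vector_scaleR_component by (rule scaleR_conv_of_real)

lemma repr_scaleR: "repr \<zeta> (r *\<^sub>R X) = r *\<^sub>R repr \<zeta> X"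
proof (rule endo_eqI)
  fix w
  have "hact \<zeta> (r *\<^sub>R X) w = r *\<^sub>R hact \<zeta> X w"
    unfolding hact_def scaleR_hmat prod_eq_iff vec_eq_iff
    by (simp only: hscale_simps cscale_matrix_vector fst_conv snd_conv fst_scaleR snd_scaleR vector_add_component
        vector_smult_component scaleR_complex_vec) (simp add: algebra_simps)
  then show "app (repr \<zeta> (r *\<^sub>R X)) w = app (r *\<^sub>R repr \<zeta> X) w"
    by (simp only: app_repr scaleR_endo.rep_eq)
qed

lemma linear_repr: "linear (repr \<zeta>)"
  by (rule linearI) (simp_all add: repr_add repr_scaleR)

section \<open>Matrices of tensor products\<close>

definition mul2 :: "(bool \<Rightarrow> bool \<Rightarrow> complex) \<Rightarrow> (bool \<Rightarrow> bool \<Rightarrow> complex) \<Rightarrow> bool \<Rightarrow> bool \<Rightarrow> complex" where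
  "mul2 M N i j = M i True * N True j + M i False * N False j"

lemma bij_odd_positions: "bij_betw (odd_positions :: 'n::finite spin \<Rightarrow> _) UNIV (Pow {1..CARD('n) div 2})"
proof (rule bij_betwI[where g = Abs_spin])
  show "odd_positions \<in> (UNIV :: 'n spin set) \<rightarrow> Pow {1..CARD('n) div 2}"
    using odd_positions[where 'n = 'n] by (auto simp: Pow_def)
qed (auto simp: odd_positions_inverse Abs_spin_inverse)

text \<open>The distributive law: in the expanded product each basis index records the set of
  positions at which the term for \<open>True\<close> is taken.\<close>

lemma sum_spin_prod:
  "(\<Sum>K\<in>(UNIV :: 'n::finite spin set). \<Prod>p\<in>{1..CARD('n) div 2}. f p (p \<in> odd_positions K) :: complex)
    = (\<Prod>p\<in>{1..CARD('n) div 2}. f p True + f p False)"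
proof -
  let ?A = "{1..CARD('n) div 2}"
  have "(\<Sum>K\<in>(UNIV :: 'n spin set). \<Prod>p\<in>?A. f p (p \<in> odd_positions K)) = (\<Sum>S\<in>Pow ?A. \<Prod>p\<in>?A. f p (p \<in> S))"
    by (rule sum.reindex_bij_betw[OF bij_odd_positions])
  also have "\<dots> = (\<Sum>S\<in>Pow ?A. (\<Prod>p\<in>S. f p True) * (\<Prod>p\<in>?A - S. f p False))"
  proof (rule sum.cong[OF refl])
    fix S assume "S \<in> Pow ?A"
    then have "S \<subseteq> ?A" by simp
    from prod.subset_diff[OF this finite_atLeastAtMost, of "\<lambda>p. f p (p \<in> S)"]
    have "(\<Prod>p\<in>?A. f p (p \<in> S)) = (\<Prod>p\<in>S. f p (p \<in> S)) * (\<Prod>p\<in>?A - S. f p (p \<in> S))"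
      by (simp only: mult.commute)
    then show "(\<Prod>p\<in>?A. f p (p \<in> S)) = (\<Prod>p\<in>S. f p True) * (\<Prod>p\<in>?A - S. f p False)"
      by simp
  qed
  also have "\<dots> = (\<Prod>p\<in>?A. f p True + f p False)"
    by (rule prod_add[symmetric]) simp
  finally show ?thesis .
qed

lemma tensor_mat_mult:
  "tensor_mat M ** tensor_mat N = (tensor_mat (\<lambda>p. mul2 (M p) (N p)) :: 'a::finite cmat)"
proof -
  have "(\<Sum>K\<in>(UNIV :: 'a spin set). (\<Prod>p\<in>{1..CARD('a) div 2}. M p (p \<in> odd_positions I) (p \<in> odd_positions K)) *
      (\<Prod>p\<in>{1..CARD('a) div 2}. N p (p \<in> odd_positions K) (p \<in> odd_positions J)))
    = (\<Prod>p\<in>{1..CARD('a) div 2}. mul2 (M p) (N p) (p \<in> odd_positions I) (p \<in> odd_positions J))"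
    for I J :: "'a spin"
  proof -
    let ?f = "\<lambda>p b. M p (p \<in> odd_positions I) b * N p b (p \<in> odd_positions J)"
    have "(\<Sum>K\<in>(UNIV :: 'a spin set). \<Prod>p\<in>{1..CARD('a) div 2}. ?f p (p \<in> odd_positions K))
      = (\<Prod>p\<in>{1..CARD('a) div 2}. ?f p True + ?f p False)"
      by (rule sum_spin_prod)
    then show ?thesis by (simp add: mul2_def prod.distrib)
  qed
  then show ?thesis
    by (simp add: tensor_mat_def matrix_matrix_mult_def vec_eq_iff)
qed

lemma tensor_mat_scale:
  "tensor_mat (\<lambda>p a b. c p * M p a b) = cscale (\<Prod>p\<in>{1..CARD('n) div 2}. c p) (tensor_mat M :: 'n::finite cmat)"
  by (simp add: tensor_mat_def vec_eq_iff prod.distrib)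

lemma tensor_mat_cong:
  "(\<And>p. p \<in> {1..CARD('n) div 2} \<Longrightarrow> M p = N p) \<Longrightarrow> tensor_mat M = (tensor_mat N :: 'n::finite cmat)"
  by (simp add: tensor_mat_def vec_eq_iff)

lemma tensor_mat_one: "tensor_mat (\<lambda>_. one2) = (mat 1 :: 'n::finite cmat)"
proof -
  have "(\<Prod>p\<in>{1..CARD('n) div 2}. one2 (p \<in> odd_positions I) (p \<in> odd_positions J)) = (if I = J then 1 else 0)"
    for I J :: "'n spin"
  proof (cases "I = J")
    case True
    then show ?thesis by (auto simp: one2_def mat2_def intro!: prod.neutral)
  next
    case False
    then have "odd_positions I \<noteq> odd_positions J" by (simp add: odd_positions_inject)
    then obtain p where p: "(p \<in> odd_positions I) \<noteq> (p \<in> odd_positions J)" by blast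
    then have "p \<in> {1..CARD('n) div 2}" using odd_positions[of I] odd_positions[of J] by blast
    moreover have "one2 (p \<in> odd_positions I) (p \<in> odd_positions J) = 0"
      using p by (auto simp: one2_def mat2_def)
    ultimately show ?thesis using False by (auto intro!: prod_zero)
  qed
  then show ?thesis by (simp add: tensor_mat_def mat_def vec_eq_iff)
qed

text \<open>The factor of \<open>spin_gen\<close> at one position, named so that relations between
  tensor products become identities of 2x2 matrices in which each position contributes a
  scalar.\<close>

definition spin_factor :: "complex \<Rightarrow> nat \<Rightarrow> nat \<Rightarrow> bool \<Rightarrow> bool \<Rightarrow> complex" where
  "spin_factor \<zeta> j p = (if p < (j + 1) div 2 then sigma2
    else if p = (j + 1) div 2 then (if odd j then X2 \<zeta> else Y2 \<zeta>)
    else one2)"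

lemma spin_gen_factor: "spin_gen \<zeta> j = tensor_mat (spin_factor \<zeta> j)"
  unfolding spin_gen_def spin_factor_def[abs_def] ..

lemmas mat2_defs = mul2_def one2_def sigma2_def X2_def Y2_def mat2_def

text \<open>For i < j the factors commute except at the position where generator i carries X or Y;
  there generator j has sigma, or Y against X. The scalars over all positions multiply to
  -1.\<close>

lemma spin_factor_anticomm:
  assumes "i < j"
  shows "mul2 (spin_factor \<zeta> i p) (spin_factor \<zeta> j p)
    = (\<lambda>a b. (if p = (i + 1) div 2 then - 1 else 1) * mul2 (spin_factor \<zeta> j p) (spin_factor \<zeta> i p) a b)"
proof -
  \<comment> \<open>The consecutive i = 2m - 1 and j = 2m share the position m; this is the third
    case.\<close>
  consider "p < (i + 1) div 2" | "p = (i + 1) div 2" "p < (j + 1) div 2" 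
    | "p = (i + 1) div 2" "p = (j + 1) div 2" "odd i" "even j" | "p > (i + 1) div 2"
  proof -
    have ab1: "(i + 1) div 2 \<le> (j + 1) div 2" using assms by (intro div_le_mono) simp
    have ab2: "odd i" "even j" if "(i + 1) div 2 = (j + 1) div 2"
    proof -
      have "j = Suc i" using that assms by linarith
      then show "odd i" "even j" using that by (cases "even i"; simp)+
    qed
    show ?thesis
    proof (cases p "(i + 1) div 2" rule: linorder_cases)
      case less then show ?thesis by (rule that(1))
    next
      case greater then show ?thesis by (rule that(4))
    next
      case equal
      show ?thesis
      proof (cases "(i + 1) div 2 = (j + 1) div 2")
        case True
        show ?thesis by (rule that(3)[OF equal trans[OF equal True] ab2[OF True]])
      next
        case False
        have "p < (j + 1) div 2" unfolding equal using ab1 False by (rule le_neq_implies_less)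
        then show ?thesis by (rule that(2)[OF equal])
      qed
    qed
  qed
  then show ?thesis
  proof cases
    case 1
    then have "p < (j + 1) div 2" using assms by presburger
    with 1 show ?thesis by (auto simp: fun_eq_iff spin_factor_def)
  qed (auto simp: fun_eq_iff spin_factor_def mat2_defs)
qed

lemma spin_factor_sq:
  "mul2 (spin_factor \<zeta> j p) (spin_factor \<zeta> j p) = (\<lambda>a b. (if p = (j + 1) div 2 then \<zeta> else 1) * one2 a b)"
  by (auto simp: fun_eq_iff spin_factor_def mat2_defs)

lemma sigma2_spin_factor:
  "mul2 sigma2 (spin_factor \<zeta> j p) = (\<lambda>a b. (if p = (j + 1) div 2 then - 1 else 1) * mul2 (spin_factor \<zeta> j p) sigma2 a b)"
  by (auto simp: fun_eq_iff spin_factor_def mat2_defs)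

lemma prod_single_position:
  "m \<in> {1..k} \<Longrightarrow> (\<Prod>p\<in>{1..k :: nat}. if p = m then c else 1 :: complex) = c"
  by (simp add: prod.delta)

lemma spin_gen_anticomm:
  assumes "1 \<le> i" "1 \<le> j" "i \<le> 2 * (CARD('n) div 2)" "j \<le> 2 * (CARD('n) div 2)" "i \<noteq> j"
  shows "spin_gen \<zeta> i ** spin_gen \<zeta> j = - (spin_gen \<zeta> j ** spin_gen \<zeta> i :: 'n::finite cmat)"
proof -
  have *: "spin_gen \<zeta> i ** spin_gen \<zeta> j = - (spin_gen \<zeta> j ** spin_gen \<zeta> i :: 'n::finite cmat)"
    if "i < j" "1 \<le> i" "i \<le> 2 * (CARD('n) div 2)" for i j
  proof -
    have "(i + 1) div 2 \<in> {1..CARD('n) div 2}" using that by auto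
    then show ?thesis
      unfolding spin_gen_factor tensor_mat_mult spin_factor_anticomm[OF \<open>i < j\<close>] tensor_mat_scale
      by (simp only: prod_single_position cscale_minus_one)
  qed
  show ?thesis
    using assms *[of i j] *[of j i] by (metis add.inverse_inverse linorder_neqE_nat)
qed

lemma spin_gen_sq:
  assumes "1 \<le> i" "i \<le> 2 * (CARD('n) div 2)"
  shows "spin_gen \<zeta> i ** spin_gen \<zeta> i = cscale \<zeta> (mat 1 :: 'n::finite cmat)"
proof -
  have "(i + 1) div 2 \<in> {1..CARD('n) div 2}" using assms by auto
  then show ?thesis
    unfolding spin_gen_factor tensor_mat_mult spin_factor_sq tensor_mat_scale tensor_mat_one
    by (simp only: prod_single_position)
qed

lemma Gamma_sq: "Gamma_mat ** Gamma_mat = (mat 1 :: 'n::finite cmat)"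
proof -
  have "mul2 sigma2 sigma2 = one2" by (auto simp: fun_eq_iff mat2_defs)
  then show ?thesis unfolding Gamma_mat_def tensor_mat_mult by (simp add: tensor_mat_one)
qed

lemma Gamma_spin_gen:
  assumes "1 \<le> i" "i \<le> 2 * (CARD('n) div 2)"
  shows "Gamma_mat ** spin_gen \<zeta> i = - (spin_gen \<zeta> i ** Gamma_mat :: 'n::finite cmat)"
proof -
  have "(i + 1) div 2 \<in> {1..CARD('n) div 2}" using assms by auto
  then show ?thesis
    unfolding Gamma_mat_def spin_gen_factor tensor_mat_mult sigma2_spin_factor tensor_mat_scale
    by (simp only: prod_single_position cscale_minus_one)
qed

section \<open>Clifford relations\<close>

lemma bij_pos: "bij_betw (pos :: 'n::{finite,linorder} \<Rightarrow> nat) UNIV {1..CARD('n)}"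
proof -
  have mono: "pos i < pos j" if "i < j" for i j :: 'n
  proof -
    have "j \<in> {k. k \<le> j}" "j \<notin> {k. k \<le> i}" "{k. k \<le> i} \<subseteq> {k. k \<le> j}" using that by auto
    then show ?thesis unfolding pos_def by (intro psubset_card_mono) (simp, blast)
  qed
  then have inj: "inj (pos :: 'n \<Rightarrow> nat)"
    by (intro injI) (metis less_irrefl linorder_neqE)
  have "pos i \<in> {1..CARD('n)}" for i :: 'n
  proof -
    have "card {i} \<le> pos i" unfolding pos_def by (intro card_mono) auto
    moreover have "pos i \<le> CARD('n)" unfolding pos_def by (intro card_mono) auto
    ultimately show ?thesis by simp
  qed
  then have "range (pos :: 'n \<Rightarrow> nat) \<subseteq> {1..CARD('n)}" by auto
  moreover have "card (range (pos :: 'n \<Rightarrow> nat)) = card {1..CARD('n)}"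
    using inj by (simp add: card_image)
  ultimately have "range (pos :: 'n \<Rightarrow> nat) = {1..CARD('n)}"
    by (intro card_subset_eq) auto
  with inj show ?thesis by (simp add: bij_betw_def)
qed

lemma pos_bounds: "1 \<le> pos i" "pos i \<le> CARD('n)" for i :: "'n::{finite,linorder}"
  using bij_pos[where 'n = 'n] by (auto simp: bij_betw_def)

lemma pos_eq_iff [simp]: "pos i = pos j \<longleftrightarrow> i = (j :: 'n::{finite,linorder})"
  using bij_pos[where 'n = 'n] by (auto simp: bij_betw_def inj_on_def)

text \<open>Generators indexed by their number, which permits arithmetic on indices and induction
  along initial segments of the generators.\<close>

definition cgen_pos :: "complex \<Rightarrow> nat \<Rightarrow> 'n::finite hmat" where
  "cgen_pos \<zeta> j = (if even CARD('n) then (spin_gen \<zeta> j, 0)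
     else if j = 1 then (0, Gamma_mat)
     else (0, cscale (- \<i>) (Gamma_mat ** spin_gen 1 (j - 1))))"

lemma cgen_eq: "cgen \<zeta> i = cgen_pos \<zeta> (pos i)"
  by (simp add: cgen_def cgen_pos_def)

lemma matrix_uminus_mult: "(- A) ** B = - (A ** B)" "A ** (- B) = - (A ** B)"
  for A :: "'a::ring_1 ^ 'n ^ 'm"
  by (simp_all add: matrix_matrix_mult_def vec_eq_iff sum_negf)

text \<open>\<open>Gamma_mat\<close> anticommutes with the generator, so its two copies meet at the
  price of a sign and then cancel.\<close>

lemma odd_generator_product:
  assumes "1 \<le> i" "i \<le> 2 * (CARD('n) div 2)"
  shows "(Gamma_mat ** spin_gen \<zeta> i) ** (Gamma_mat ** B) = - (spin_gen \<zeta> i ** B :: 'n::finite cmat)"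
proof -
  have "(Gamma_mat ** spin_gen \<zeta> i) ** (Gamma_mat ** B) = - ((spin_gen \<zeta> i ** Gamma_mat) ** (Gamma_mat ** B))"
    unfolding Gamma_spin_gen[OF assms] matrix_uminus_mult ..
  also have "(spin_gen \<zeta> i ** Gamma_mat) ** (Gamma_mat ** B) = spin_gen \<zeta> i ** (Gamma_mat ** Gamma_mat) ** B"
    by (simp only: matrix_mul_assoc)
  finally show ?thesis by (simp add: Gamma_sq)
qed

text \<open>For odd n the factor -i makes the squares right: (-i)^2 cancels the sign from exchanging
  Gamma and C_j, and \<epsilon>^2 contributes \<zeta>.\<close>

lemma cgen_pos_sq:
  assumes "1 \<le> i" "i \<le> CARD('n)"
  shows "hmul \<zeta> (cgen_pos \<zeta> i) (cgen_pos \<zeta> i) = hscale \<zeta> (hone :: 'n::finite hmat)"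
proof (cases "even CARD('n)")
  case True
  then have "i \<le> 2 * (CARD('n) div 2)" using assms by simp
  with True assms show ?thesis
    by (simp add: cgen_pos_def hmul_def hone_def hscale_def spin_gen_sq)
next
  case False
  have "i - 1 \<le> 2 * (CARD('n) div 2)" using assms False by simp
  moreover have "1 \<le> i - 1" if "i \<noteq> 1" using that assms by simp
  ultimately show ?thesis
    using False by (auto simp: cgen_pos_def hmul_def hone_def hscale_def Gamma_sq odd_generator_product spin_gen_sq
        vec_eq_iff)
qed

lemma cgen_pos_anticomm:
  assumes "1 \<le> i" "i \<le> CARD('n)" "1 \<le> j" "j \<le> CARD('n)" "i \<noteq> j"
  shows "hmul \<zeta> (cgen_pos \<zeta> i) (cgen_pos \<zeta> j) = - (hmul \<zeta> (cgen_pos \<zeta> j) (cgen_pos \<zeta> i) :: 'n::finite hmat)"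
proof (cases "even CARD('n)")
  case True
  then have "i \<le> 2 * (CARD('n) div 2)" "j \<le> 2 * (CARD('n) div 2)" using assms by simp_all
  with True assms show ?thesis
    by (simp add: cgen_pos_def hmul_def spin_gen_anticomm[of i j])
next
  case False
  let ?D = "\<lambda>j. cscale (- \<i>) (Gamma_mat ** spin_gen 1 (j - 1)) :: 'n cmat"
  have D1: "Gamma_mat ** ?D j = - (?D j ** Gamma_mat)" if "j \<noteq> 1" "1 \<le> j" "j \<le> CARD('n)" for j
  proof -
    have b: "1 \<le> j - 1" "j - 1 \<le> 2 * (CARD('n) div 2)" using that False by simp_all
    have "(Gamma_mat ** spin_gen 1 (j - 1)) ** Gamma_mat = - (spin_gen 1 (j - 1) :: 'n cmat)"
      using odd_generator_product[OF b, of 1 "mat 1"] by simp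
    moreover have "Gamma_mat ** (Gamma_mat ** spin_gen 1 (j - 1)) = (spin_gen 1 (j - 1) :: 'n cmat)"
      by (simp add: matrix_mul_assoc Gamma_sq)
    ultimately show ?thesis by simp
  qed
  have D2: "?D i ** ?D j = - (?D j ** ?D i)" if "i \<noteq> 1" "j \<noteq> 1"
  proof -
    have b: "1 \<le> i - 1" "i - 1 \<le> 2 * (CARD('n) div 2)" "1 \<le> j - 1" "j - 1 \<le> 2 * (CARD('n) div 2)"
      "i - 1 \<noteq> j - 1"
      using that assms False by simp_all
    show ?thesis
      unfolding cscale_matrix_mult odd_generator_product[OF b(1,2)] odd_generator_product[OF b(3,4)]
        spin_gen_anticomm[OF b(1,3,2,4,5), of 1] by simp
  qed
  have "hmul \<zeta> (0, A) (0, B) = - hmul \<zeta> (0, B) (0, A)" if "A ** B = - (B ** A)" for A B :: "'n cmat"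
    using that by (simp add: hmul_def)
  note neg = this
  consider "i = 1" "j \<noteq> 1" | "i \<noteq> 1" "j = 1" | "i \<noteq> 1" "j \<noteq> 1" using assms by blast
  then show ?thesis
  proof cases
    case 1
    with False neg[OF D1[OF 1(2) assms(3,4)]] show ?thesis by (simp add: cgen_pos_def)
  next
    case 2
    with False neg[OF D1[OF 2(1) assms(1,2)]] show ?thesis by (simp add: cgen_pos_def)
  next
    case 3
    with False neg[OF D2[OF 3]] show ?thesis by (simp add: cgen_pos_def)
  qed
qed

lemma cgen_sq: "hmul \<zeta> (cgen \<zeta> i) (cgen \<zeta> i) = hscale \<zeta> hone"
  unfolding cgen_eq by (intro cgen_pos_sq pos_bounds)

lemma cgen_anticomm: "i \<noteq> j \<Longrightarrow> hmul \<zeta> (cgen \<zeta> i) (cgen \<zeta> j) = - hmul \<zeta> (cgen \<zeta> j) (cgen \<zeta> i)"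
  unfolding cgen_eq by (intro cgen_pos_anticomm pos_bounds) simp

abbreviation dpi_gen :: "complex \<Rightarrow> 'n::{finite,linorder} \<Rightarrow> 'n hmat" where
  "dpi_gen \<zeta> i \<equiv> hscale (cis (pi / 4)) (cgen \<zeta> i)"

lemma cis_pi4_sq: "cis (pi / 4) * cis (pi / 4) = \<i>"
  by (simp add: cis_mult)

lemma linear_dpi: "linear (dpi \<zeta>)"
  unfolding dpi_def by (rule linear_lin_ext)

lemma dpi_basis: "dpi \<zeta> (basis_elt m) = hscale ((\<i> * \<zeta>) ^ zdeg m)
    (foldr (hmul \<zeta>) (map (dpi_gen \<zeta>) (sorted_list_of_set (gens m))) hone)"
  by (simp add: dpi_def)

lemma dpi_one: "dpi \<zeta> 1 = hone"
  and dpi_agen: "dpi \<zeta> (agen i) = dpi_gen \<zeta> i"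
  and dpi_zgen: "dpi \<zeta> zgen = hscale (\<i> * \<zeta>) hone"
  by (simp_all add: one_salg_def agen_def zgen_def dpi_basis bone_mon_def)

text \<open>\<open>dpi\<close> is given by its values on monomials, where multiplicativity is not
  visible. Composed with the faithful \<open>repr\<close> it becomes a \<open>gen_hom\<close>, whose
  multiplicativity follows from the Clifford relations.\<close>

lemma repr_dpi:
  fixes u :: "'n::{finite,linorder} uhc"
  shows "repr \<zeta> (dpi \<zeta> u) = gen_hom (\<lambda>i. repr \<zeta> (dpi_gen \<zeta> i)) (repr \<zeta> (hscale (\<i> * \<zeta>) hone)) u"
proof (rule linear_eq_on_basis[of _ _ u])
  show "linear (\<lambda>u :: 'n uhc. repr \<zeta> (dpi \<zeta> u))"
    using linear_compose[OF linear_dpi linear_repr] by (simp add: o_def)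
  show "linear (gen_hom (\<lambda>i :: 'n. repr \<zeta> (dpi_gen \<zeta> i)) (repr \<zeta> (hscale (\<i> * \<zeta>) hone)))"
    unfolding gen_hom_def by (rule linear_lin_ext)
  fix m :: "'n mon"
  have 1: "repr \<zeta> (hscale c hone) ^ k * repr \<zeta> X = repr \<zeta> (hscale (c ^ k) X)" for c k and X :: "'n hmat"
    by (induction k) (simp_all add: mult.assoc repr_hmul[symmetric] mult.commute[of c])
  have 2: "prod_list (map (\<lambda>i. repr \<zeta> (dpi_gen \<zeta> i)) xs) = repr \<zeta> (foldr (hmul \<zeta>) (map (dpi_gen \<zeta>) xs) hone)"
    for xs :: "'n list"
    by (induction xs) (simp_all add: repr_hmul repr_hone del: hmul_scale)
  show "repr \<zeta> (dpi \<zeta> (basis_elt m)) = gen_hom (\<lambda>i. repr \<zeta> (dpi_gen \<zeta> i)) (repr \<zeta> (hscale (\<i> * \<zeta>) hone)) (basis_elt m)"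
    unfolding gen_hom_def lin_ext_basis dpi_basis unfolding 2 unfolding 1 ..
qed

lemma dpi_mult:
  fixes u v :: "'n::{finite,linorder} uhc"
  shows "dpi \<zeta> (u * v) = hmul \<zeta> (dpi \<zeta> u) (dpi \<zeta> v)"
proof -
  have "repr \<zeta> (dpi \<zeta> (u * v)) = repr \<zeta> (dpi \<zeta> u) * repr \<zeta> (dpi \<zeta> v)"
    unfolding repr_dpi
  proof (rule gen_hom_hom(5))
    fix i j :: 'n
    show "repr \<zeta> (dpi_gen \<zeta> i) * repr \<zeta> (dpi_gen \<zeta> j) = - (repr \<zeta> (dpi_gen \<zeta> j) * repr \<zeta> (dpi_gen \<zeta> i))" if "i \<noteq> j"
      unfolding repr_hmul[symmetric] repr_uminus[symmetric] using that 
      by (simp add: cgen_anticomm[OF that] hscale_minus_one[symmetric])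
    show "repr \<zeta> (dpi_gen \<zeta> i) * repr \<zeta> (dpi_gen \<zeta> i) = repr \<zeta> (hscale (\<i> * \<zeta>) hone)"
      unfolding repr_hmul[symmetric] by (simp add: cgen_sq cis_pi4_sq mult.assoc[symmetric])
    show "repr \<zeta> (hscale (\<i> * \<zeta>) hone) * repr \<zeta> (dpi_gen \<zeta> i) = repr \<zeta> (dpi_gen \<zeta> i) * repr \<zeta> (hscale (\<i> * \<zeta>) hone)"
      unfolding repr_hmul[symmetric] by (simp add: mult.commute)
  qed
  then show ?thesis
    unfolding repr_hmul[symmetric] by (rule repr_inject)
qed

section \<open>Gradings\<close>

lemma prod_odd_positions:
  "(\<Prod>p\<in>{1..CARD('n) div 2}. if p \<in> odd_positions (I :: 'n::finite spin) then c else 1 :: complex)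
    = c ^ card (odd_positions I)"
proof -
  have "{1..CARD('n) div 2} \<inter> {p. p \<in> odd_positions I} = odd_positions I"
    using odd_positions[of I] by auto
  then show ?thesis by (simp add: prod.If_cases)
qed

lemma Gamma_entry:
  "Gamma_mat $ I $ J = (if I = J then (- 1) ^ card (odd_positions I) else 0 :: complex)"
  for I J :: "'n::finite spin"
proof -
  have "sigma2 a b = (if a then - 1 else 1) * one2 a b" for a b
    by (auto simp: mat2_defs)
  then have "(Gamma_mat :: 'n cmat) $ I $ J = (\<Prod>p\<in>{1..CARD('n) div 2}. if p \<in> odd_positions I then - 1 else 1)
      * (tensor_mat (\<lambda>_. one2) :: 'n cmat) $ I $ J"
    by (simp add: Gamma_mat_def tensor_mat_def prod.distrib)
  then show ?thesis
    unfolding prod_odd_positions tensor_mat_one by (simp add: mat_def)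
qed

lemma Gamma_mult_entry:
  fixes M :: "'n::finite cmat"
  shows "(Gamma_mat ** M) $ I $ J = (- 1) ^ card (odd_positions I) * M $ I $ J"
    and "(M ** Gamma_mat) $ I $ J = M $ I $ J * (- 1) ^ card (odd_positions J)"
  by (simp_all add: matrix_matrix_mult_def Gamma_entry if_distrib[of "\<lambda>x. x * _"] if_distrib[of "(*) _"] cong: if_cong)

text \<open>For even \<open>n\<close>, \<open>\<Gamma>\<close> is the grading operator of the spin module.\<close>

definition hhom :: "bool \<Rightarrow> 'n::finite hmat \<Rightarrow> bool" where
  "hhom b X \<longleftrightarrow> (if even CARD('n)
     then snd X = 0 \<and> Gamma_mat ** fst X = cscale (if b then - 1 else 1) (fst X ** Gamma_mat)
     else if b then fst X = 0 else snd X = 0)"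

lemma hhom_add: "hhom b X \<Longrightarrow> hhom b Y \<Longrightarrow> hhom b (X + Y)"
  by (auto simp: hhom_def matrix_add_ldistrib matrix_add_rdistrib split: if_splits)

lemma hhom_scale: "hhom b X \<Longrightarrow> hhom b (hscale c X)"
  by (auto simp: hhom_def mult.commute split: if_splits)

lemma hhom_zero [simp]: "hhom b 0"
  by (simp add: hhom_def)

lemma hhom_one: "hhom False hone"
  by (simp add: hhom_def hone_def)

lemma hhom_mul:
  fixes X Y :: "'n::finite hmat"
  assumes "hhom b X" "hhom c Y"
  shows "hhom (b \<noteq> c) (hmul \<zeta> X Y)"
proof (cases "even CARD('n)")
  case True
  then have X: "snd X = 0" "Gamma_mat ** fst X = cscale (if b then - 1 else 1) (fst X ** Gamma_mat)"
    and Y: "snd Y = 0" "Gamma_mat ** fst Y = cscale (if c then - 1 else 1) (fst Y ** Gamma_mat)"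
    using assms by (simp_all add: hhom_def)
  have "Gamma_mat ** (fst X ** fst Y) = cscale (if b then - 1 else 1) (fst X ** (Gamma_mat ** fst Y))"
    by (simp only: matrix_mul_assoc X cscale_matrix_mult)
  also have "\<dots> = cscale (if b \<noteq> c then - 1 else 1) (fst X ** fst Y ** Gamma_mat)"
    by (simp only: Y cscale_matrix_mult cscale_simps matrix_mul_assoc) simp
  finally show ?thesis
    using True by (simp only: hhom_def hmul_def X Y fst_conv snd_conv if_True) simp
next
  case False
  with assms show ?thesis by (auto simp: hhom_def hmul_def split: if_splits)
qed

lemma hhom_cgen_pos:
  assumes "1 \<le> j" "j \<le> CARD('n)"
  shows "hhom True (cgen_pos \<zeta> j :: 'n::finite hmat)"
proof (cases "even CARD('n)")
  case True
  then show ?thesis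
    using Gamma_spin_gen[of j \<zeta>, where 'n = 'n] assms by (simp add: hhom_def cgen_pos_def cscale_minus_one)
qed (simp add: hhom_def cgen_pos_def)

lemma hhom_dpi_basis: "hhom (bodd m) (dpi \<zeta> (basis_elt m))"
proof -
  have "hhom (odd (length xs)) (foldr (hmul \<zeta>) (map (dpi_gen \<zeta>) xs) hone)" for xs :: "'a list"
  proof (induction xs)
    case (Cons i xs)
    have "hhom True (dpi_gen \<zeta> i)"
      unfolding cgen_eq by (intro hhom_scale hhom_cgen_pos pos_bounds)
    from hhom_mul[OF this Cons.IH, of \<zeta>] show ?case by simp
  qed (simp add: hhom_one)
  from this[of "sorted_list_of_set (gens m)"] show ?thesis
    by (simp add: dpi_basis bodd_mon_def hhom_scale)
qed

text \<open>Complements \<open>linear_eq_on_basis\<close>: it covers closure statements, such as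
  homogeneity or the existence of bounds, that are not equations between linear maps.\<close>

lemma salg_induct:
  assumes "\<And>b. P (basis_elt b)" "P 0" "\<And>x y. P x \<Longrightarrow> P y \<Longrightarrow> P (x + y)" "\<And>r x. P x \<Longrightarrow> P (r *\<^sub>R x)"
  shows "P (x :: 'b salg)"
proof -
  have "P (\<Sum>b\<in>B. coord x b *\<^sub>R basis_elt b)" for B
    by (induction B rule: infinite_finite_induct) (use assms in auto)
  from this[of "{b. coord x b \<noteq> 0}"] show ?thesis
    by (simp only: lin_ext_def[symmetric] salg_expand[symmetric])
qed

lemmas parity_part_add = linear_add[OF linear_parity_part]
  and parity_part_scale = linear_scale[OF linear_parity_part]
  and parity_part_zero = linear_0[OF linear_parity_part]
  and dpi_add = linear_add[OF linear_dpi]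
  and dpi_scale = linear_scale[OF linear_dpi]
  and dpi_zero = linear_0[OF linear_dpi]
  and antipode_add = linear_add[OF antipode_props(1)]
  and antipode_scale = linear_scale[OF antipode_props(1)]
  and antipode_zero = linear_0[OF antipode_props(1)]

lemma parity_part_basis: "parity_part p (basis_elt m) = (if bodd m = p then basis_elt m else 0)"
  by (simp add: parity_part_def)

lemma parity_part_sum: "u = parity_part False u + parity_part True u"
  by (rule linear_eq_on_basis[of "\<lambda>u. u" "\<lambda>u. parity_part False u + parity_part True u"])
    (auto intro!: linearI simp: parity_part_basis parity_part_add parity_part_scale algebra_simps)

lemma parity_part_parity_part: "parity_part p (parity_part q u) = (if p = q then parity_part q u else 0)"
  by (induction u rule: salg_induct)
    (auto simp: parity_part_basis parity_part_zero parity_part_add parity_part_scale)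

lemma hhom_dpi: "hhom p (dpi \<zeta> (parity_part p u))"
proof (induction u rule: salg_induct)
  case (1 b)
  then show ?case using hhom_dpi_basis[of b \<zeta>] by (auto simp: parity_part_basis dpi_zero)
qed (simp_all add: parity_part_zero parity_part_add parity_part_scale dpi_zero dpi_add dpi_scale hhom_add scaleR_hmat hhom_scale)

lemma hmat_part_add: "hmat_part p (X + Y) = hmat_part p X + hmat_part p Y"
  by (auto simp: hmat_part_def prod_eq_iff vec_eq_iff)

text \<open>Entrywise, the relation with the diagonal matrix \<open>Gamma_mat\<close> forces an
  entry whose parity differs from \<open>b\<close> to equal its own negative.\<close>

lemma hmat_part_hhom:
  fixes X :: "'n::finite hmat"
  assumes "hhom b X"
  shows "hmat_part p X = (if p = b then X else 0)"
proof (cases "even CARD('n)")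
  case True
  then have X: "snd X = 0" "Gamma_mat ** fst X = cscale (if b then - 1 else 1) (fst X ** Gamma_mat)"
    using assms by (simp_all add: hhom_def)
  have "fst X $ I $ J = 0" if "odd (card (odd_positions I) + card (odd_positions J)) \<noteq> b" for I J
  proof -
    have "(- 1) ^ card (odd_positions I) * fst X $ I $ J
      = (if b then - 1 else 1) * (fst X $ I $ J * (- 1) ^ card (odd_positions J))"
      using X(2) by (simp only: Gamma_mult_entry[symmetric] cscale_simps)
    then show ?thesis
      using that by (cases b; cases "even (card (odd_positions I))"; cases "even (card (odd_positions J))") auto
  qed
  then show ?thesis using True X(1) by (auto simp: hmat_part_def prod_eq_iff vec_eq_iff)
next
  case False
  with assms show ?thesis by (auto simp: hmat_part_def hhom_def prod_eq_iff split: if_splits)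
qed

lemma hmat_part_dpi: "hmat_part p (dpi \<zeta> u) = dpi \<zeta> (parity_part p u)"
proof -
  have "hmat_part p (dpi \<zeta> u) = hmat_part p (dpi \<zeta> (parity_part False u)) + hmat_part p (dpi \<zeta> (parity_part True u))"
    by (subst parity_part_sum[of u]) (simp add: dpi_add hmat_part_add)
  then show ?thesis
    by (cases p) (simp_all add: hmat_part_hhom[OF hhom_dpi])
qed

lemma hhom_hspace: "hhom b X \<Longrightarrow> X \<in> hspace"
  by (auto simp: hhom_def hspace_def)

lemma hspace_closed:
  "X \<in> hspace \<Longrightarrow> Y \<in> hspace \<Longrightarrow> X + Y \<in> hspace" "X \<in> hspace \<Longrightarrow> hscale c X \<in> hspace"
  "0 \<in> hspace" "X \<in> hspace \<Longrightarrow> Y \<in> hspace \<Longrightarrow> hmul \<zeta> X Y \<in> hspace"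
  by (auto simp: hspace_def hmul_def)

lemma dpi_hspace: "dpi \<zeta> u \<in> hspace"
  using parity_part_sum[of u] hhom_hspace[OF hhom_dpi] by (metis dpi_add hspace_closed(1))

section \<open>The super adjoint\<close>

lemma hact_spin_module: "X \<in> hspace \<Longrightarrow> w \<in> spin_module \<Longrightarrow> hact \<zeta> X w \<in> spin_module"
  by (auto simp: hspace_def spin_module_def hact_def)

lemma Gamma_vector: "(Gamma_mat *v v) $ I = (- 1) ^ card (odd_positions I) * v $ I" for I :: "'n::finite spin"
  by (simp add: matrix_vector_mult_def Gamma_entry if_distrib[of "\<lambda>x. x * _"] cong: if_cong)

lemma svec_part_even:
  assumes "even CARD('n)" "w \<in> (spin_module :: 'n::finite svec set)"
  shows "svec_part p w = w \<longleftrightarrow> Gamma_mat *v fst w = (if p then - 1 else 1) *s fst w"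
proof -
  have "svec_part p w = w \<longleftrightarrow> (\<forall>I. odd (card (odd_positions I)) \<noteq> p \<longrightarrow> fst w $ I = 0)"
    using assms by (auto simp: svec_part_def prod_eq_iff vec_eq_iff spin_module_def)
  also have "\<dots> \<longleftrightarrow> (\<forall>I. (- 1) ^ card (odd_positions I) * fst w $ I = (if p then - 1 else 1) * fst w $ I)"
    by (intro arg_cong[where f = All] ext) (auto simp: minus_one_power_iff)
  finally show ?thesis by (simp add: vec_eq_iff Gamma_vector)
qed

lemma svec_part_hact:
  fixes w :: "'n::finite svec"
  assumes "hhom b X" "w \<in> spin_module" "svec_part p w = w"
  shows "svec_part (p \<noteq> b) (hact \<zeta> X w) = hact \<zeta> X w"
proof (cases "even CARD('n)")
  case True
  then have X: "snd X = 0" "Gamma_mat ** fst X = cscale (if b then - 1 else 1) (fst X ** Gamma_mat)"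
    using assms by (simp_all add: hhom_def)
  have w: "Gamma_mat *v fst w = (if p then - 1 else 1) *s fst w"
    using svec_part_even[OF True assms(2)] assms(3) by simp
  have "Gamma_mat *v (fst X *v fst w) = (if b then - 1 else 1) *s (fst X *v (Gamma_mat *v fst w))"
    by (simp only: matrix_vector_mul_assoc X cscale_matrix_vector)
  also have "\<dots> = (if p \<noteq> b then - 1 else 1) *s (fst X *v fst w)"
    by (simp only: w vector_scalar_commute vector_smult_assoc) simp
  finally have "Gamma_mat *v (fst X *v fst w) = (if p \<noteq> b then - 1 else 1) *s (fst X *v fst w)" .
  moreover have "fst (hact \<zeta> X w) = fst X *v fst w" using X by (simp add: hact_def)
  ultimately show ?thesis
    using svec_part_even[OF True hact_spin_module[OF hhom_hspace[OF assms(1)] assms(2)]] by simp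
next
  case False
  with assms show ?thesis
    by (cases w; cases p; cases b) (auto simp: svec_part_def hact_def hhom_def)
qed

lemma svec_part_sum: "w \<in> spin_module \<Longrightarrow> svec_part False w + svec_part True w = w"
  by (auto simp: svec_part_def prod_eq_iff vec_eq_iff spin_module_def)

lemma svec_part_svec_part: "svec_part p (svec_part q w) = (if p = q then svec_part q w else 0)"
  by (auto simp: svec_part_def prod_eq_iff vec_eq_iff)

lemma sform_add_right: "sform \<eta> x (y + z) = sform \<eta> x y + sform \<eta> x z"
  by (simp add: sform_def algebra_simps sum.distrib)

lemma sform_zero [simp]: "sform \<eta> 0 y = 0" "sform \<eta> x 0 = 0"
  by (simp_all add: sform_def)

lemma sform_orthogonal:
  "p \<noteq> q \<Longrightarrow> sform \<eta> (svec_part p x) (svec_part q y) = 0"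
  by (auto simp: sform_def svec_part_def intro!: sum.neutral)

text \<open>The parity parts are orthogonal for \<open>sform\<close>, so only the part of y with the
  parity of x contributes, and there i^(|u||v|) is i or 1.\<close>

lemma super_form_homogeneous:
  assumes "svec_part p x = x" "y \<in> spin_module"
  shows "super_form \<eta> x y = (if p then \<i> else 1) * sform \<eta> x y"
proof -
  have part: "svec_part q x = (if q = p then x else 0)" for q
    using svec_part_svec_part[of q p x] assms(1) by auto
  have "sform \<eta> x y = sform \<eta> x (svec_part False y) + sform \<eta> x (svec_part True y)"
    by (subst svec_part_sum[OF assms(2), symmetric]) (rule sform_add_right)
  moreover have "sform \<eta> x (svec_part (\<not> p) y) = 0"
    using sform_orthogonal[of p "\<not> p" \<eta> x y] assms(1) by simp
  ultimately show ?thesis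
    by (cases p) (simp_all add: super_form_def UNIV_bool part)
qed

definition dag :: "complex ^ 'n ^ 'm \<Rightarrow> complex ^ 'm ^ 'n" where
  "dag A = (\<chi> i j. cnj (A $ j $ i))"

lemma dag_mult: "dag (A ** B) = dag B ** dag A"
  by (simp add: dag_def matrix_matrix_mult_def vec_eq_iff mult.commute)

lemma dag_cscale: "dag (cscale c A) = cscale (cnj c) (dag A)"
  by (simp add: dag_def vec_eq_iff)

lemma dag_inner: "(\<Sum>I\<in>UNIV. (M *v x) $ I * cnj (y $ I)) = (\<Sum>I\<in>UNIV. x $ I * cnj ((dag M *v y) $ I))"
proof -
  have "(\<Sum>I\<in>UNIV. (M *v x) $ I * cnj (y $ I)) = (\<Sum>I\<in>UNIV. \<Sum>J\<in>UNIV. M $ I $ J * x $ J * cnj (y $ I))"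
    by (simp add: matrix_vector_mult_def sum_distrib_right)
  also have "\<dots> = (\<Sum>J\<in>UNIV. \<Sum>I\<in>UNIV. M $ I $ J * x $ J * cnj (y $ I))"
    by (rule sum.swap)
  finally show ?thesis
    by (simp add: matrix_vector_mult_def dag_def sum_distrib_left mult_ac)
qed

text \<open>With W the diagonal matrix of the form, this is W M = M^* W read entrywise. Both sides
  factor over the positions, so it is enough that diag(1, \<eta>) satisfies the relation with sigma,
  X, Y and the identity.\<close>

lemma spin_gen_hermitian:
  "complex_of_real \<eta> ^ card (odd_positions I) * spin_gen \<eta> j $ I $ J
    = complex_of_real \<eta> ^ card (odd_positions J) * cnj (spin_gen \<eta> j $ J $ I)"
  for I J :: "'n::finite spin"
proof -
  have f: "(if a then complex_of_real \<eta> else 1) * spin_factor \<eta> j p a b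
      = (if b then complex_of_real \<eta> else 1) * cnj (spin_factor \<eta> j p b a)" for p a b
    by (auto simp: spin_factor_def mat2_defs)
  show ?thesis
    unfolding prod_odd_positions[symmetric] spin_gen_factor tensor_mat_def
    by (simp add: prod.distrib[symmetric] f)
qed

lemma dag_Gamma: "dag Gamma_mat = (Gamma_mat :: 'n::finite cmat)"
  by (simp add: dag_def vec_eq_iff Gamma_entry)

lemma dag_spin_gen: "dag (spin_gen 1 j) = (spin_gen 1 j :: 'n::finite cmat)"
proof -
  have "cnj (spin_gen 1 j $ J $ I) = spin_gen 1 j $ I $ J" for I J :: "'n spin"
    using spin_gen_hermitian[of 1 I j J] by simp
  then show ?thesis by (simp add: dag_def vec_eq_iff)
qed

lemma sform_cgen_pos:
  fixes x y :: "'n::finite svec"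
  assumes "1 \<le> j" "j \<le> CARD('n)" "x \<in> spin_module" "y \<in> spin_module"
  shows "sform \<eta> (hact \<eta> (cgen_pos \<eta> j) x) y = sform \<eta> x (hact \<eta> (cgen_pos \<eta> j) y)"
proof (cases "even CARD('n)")
  case True
  have "(\<Sum>I\<in>UNIV. complex_of_real \<eta> ^ card (odd_positions I) * ((spin_gen \<eta> j *v u) $ I * cnj (v $ I)))
      = (\<Sum>I\<in>UNIV. complex_of_real \<eta> ^ card (odd_positions I) * (u $ I * cnj ((spin_gen \<eta> j *v v) $ I)))"
    for u v :: "complex ^ 'n spin"
  proof -
    have "(\<Sum>I\<in>UNIV. complex_of_real \<eta> ^ card (odd_positions I) * ((spin_gen \<eta> j *v u) $ I * cnj (v $ I)))
      = (\<Sum>I\<in>UNIV. \<Sum>J\<in>UNIV. (complex_of_real \<eta> ^ card (odd_positions I) * spin_gen \<eta> j $ I $ J) * (u $ J * cnj (v $ I)))"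
      by (simp add: matrix_vector_mult_def sum_distrib_right sum_distrib_left mult_ac)
    also have "\<dots> = (\<Sum>J\<in>UNIV. \<Sum>I\<in>UNIV. (complex_of_real \<eta> ^ card (odd_positions I) * spin_gen \<eta> j $ I $ J) * (u $ J * cnj (v $ I)))"
      by (rule sum.swap)
    also have "\<dots> = (\<Sum>J\<in>UNIV. \<Sum>I\<in>UNIV. (complex_of_real \<eta> ^ card (odd_positions J) * cnj (spin_gen \<eta> j $ J $ I)) * (u $ J * cnj (v $ I)))"
      by (simp only: spin_gen_hermitian)
    finally show ?thesis
      by (simp add: matrix_vector_mult_def sum_distrib_right sum_distrib_left mult_ac)
  qed
  with True show ?thesis by (simp add: sform_def cgen_pos_def hact_def)
next
  case False
  \<comment> \<open>For odd n every generator is \<epsilon> B with B Hermitian; the factor -i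
    compensates the anticommutation of Gamma and C_j.\<close>
  define B :: "'n cmat" where "B = (if j = 1 then Gamma_mat else cscale (- \<i>) (Gamma_mat ** spin_gen 1 (j - 1)))"
  have "dag B = B"
  proof (cases "j = 1")
    case False
    then have "1 \<le> j - 1" "j - 1 \<le> 2 * (CARD('n) div 2)" using assms \<open>odd CARD('n)\<close> by simp_all
    note Gamma_spin_gen = Gamma_spin_gen[OF this, of 1]
    have "dag (cscale (- \<i>) (Gamma_mat ** spin_gen 1 (j - 1))) = cscale \<i> (spin_gen 1 (j - 1) ** (Gamma_mat :: 'n cmat))"
      by (simp add: dag_cscale dag_mult dag_Gamma dag_spin_gen)
    also have "\<dots> = cscale (- \<i>) (Gamma_mat ** spin_gen 1 (j - 1))"
      unfolding Gamma_spin_gen by (simp add: vec_eq_iff)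
    finally show ?thesis using False by (simp add: B_def)
  qed (simp add: B_def dag_Gamma)
  then have B: "(\<Sum>I\<in>UNIV. (B *v u) $ I * cnj (v $ I)) = (\<Sum>I\<in>UNIV. u $ I * cnj ((B *v v) $ I))" for u v
    using dag_inner[of B u v] by simp
  have c: "cgen_pos \<eta> j = (0, B)" using False by (simp add: cgen_pos_def B_def)
  have "sform \<eta> (hact \<eta> (0, B) x) y = \<eta> * (\<Sum>I\<in>UNIV. (B *v snd x) $ I * cnj (fst y $ I)) 
      + \<eta> * (\<Sum>I\<in>UNIV. (B *v fst x) $ I * cnj (snd y $ I))"
    using False by (simp add: sform_def hact_def sum_distrib_left mult_ac)
  also have "\<dots> = sform \<eta> x (hact \<eta> (0, B) y)"
    unfolding B using False by (simp add: sform_def hact_def sum_distrib_left mult_ac)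
  finally show ?thesis unfolding c .
qed

lemma hact_scale: "hact \<zeta> (hscale c X) w = (c *s fst (hact \<zeta> X w), c *s snd (hact \<zeta> X w))"
  by (simp add: hact_def vector_add_ldistrib vector_smult_assoc mult.commute)

lemma sform_scale:
  "sform \<eta> (c *s fst x, c *s snd x) y = c * sform \<eta> x y"
  "sform \<eta> x (c *s fst y, c *s snd y) = cnj c * sform \<eta> x y"
  by (simp_all add: sform_def sum_distrib_left algebra_simps)

lemma svec_part_linear:
  "svec_part p (x + y) = svec_part p x + svec_part p y"
  "svec_part p (c *s fst x, c *s snd x) = (c *s fst (svec_part p x), c *s snd (svec_part p x))"
  by (auto simp: svec_part_def prod_eq_iff vec_eq_iff)

lemma super_form_linear:
  "super_form \<eta> (x + x') y = super_form \<eta> x y + super_form \<eta> x' y"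
  "super_form \<eta> x (y + y') = super_form \<eta> x y + super_form \<eta> x y'"
  "super_form \<eta> (c *s fst x, c *s snd x) y = c * super_form \<eta> x y"
  "super_form \<eta> x (c *s fst y, c *s snd y) = cnj c * super_form \<eta> x y"
proof -
  have add_left: "sform \<eta> (u + u') v = sform \<eta> u v + sform \<eta> u' v" for u u' v :: "'a svec"
    by (simp add: sform_def algebra_simps sum.distrib)
  show "super_form \<eta> (x + x') y = super_form \<eta> x y + super_form \<eta> x' y"
    "super_form \<eta> x (y + y') = super_form \<eta> x y + super_form \<eta> x y'"
    by (simp_all add: super_form_def svec_part_linear add_left sform_add_right sum.distrib distrib_left)
  show "super_form \<eta> (c *s fst x, c *s snd x) y = c * super_form \<eta> x y"
    "super_form \<eta> x (c *s fst y, c *s snd y) = cnj c * super_form \<eta> x y"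
    by (simp_all add: super_form_def svec_part_linear sform_scale sum_distrib_left UNIV_bool algebra_simps)
qed

text \<open>The defining property of the super adjoint, with \<open>dpi \<eta> (antipode u)\<close>
  in its place. As a predicate on u it can be checked on generators and extended to products and
  sums, apart from the question of uniqueness.\<close>

definition adj_dpi :: "real \<Rightarrow> bool \<Rightarrow> 'n::{finite,linorder} uhc \<Rightarrow> bool" where
  "adj_dpi \<eta> b u \<longleftrightarrow> (\<forall>p. \<forall>x\<in>spin_module. \<forall>y\<in>spin_module. svec_part p x = x \<longrightarrow>
      super_form \<eta> (hact \<eta> (dpi \<eta> u) x) y
      = complex_of_real (koszul p b) * super_form \<eta> x (hact \<eta> (dpi \<eta> (antipode u)) y))"

lemma hact_add: "hact \<zeta> (X + Y) w = hact \<zeta> X w + hact \<zeta> Y w"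
  by (simp add: hact_def matrix_vector_mult_add_rdistrib vector_add_ldistrib)

lemma hact_zero [simp]: "hact \<zeta> 0 w = 0"
  by (simp add: hact_def zero_prod_def)

lemma hact_one [simp]: "hact \<zeta> hone w = w"
  by (simp add: hact_def hone_def)

lemma super_form_zero [simp]:
  fixes x y :: "'n::finite svec"
  shows "super_form \<eta> 0 y = 0" "super_form \<eta> x 0 = 0"
  using super_form_linear(3)[of \<eta> 0 x y] super_form_linear(4)[of \<eta> x 0 y]
  by (simp_all add: zero_prod_def[symmetric])

lemma adj_dpi_add: "adj_dpi \<eta> b u \<Longrightarrow> adj_dpi \<eta> b v \<Longrightarrow> adj_dpi \<eta> b (u + v)"
  unfolding adj_dpi_def by (simp only: dpi_add antipode_add hact_add super_form_linear distrib_left) simp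

lemma adj_dpi_scale: "adj_dpi \<eta> b u \<Longrightarrow> adj_dpi \<eta> b (r *\<^sub>R u)"
  unfolding adj_dpi_def
  by (simp only: dpi_scale antipode_scale scaleR_hmat hact_scale super_form_linear complex_cnj_complex_of_real) simp

text \<open>\<open>dpi\<close> is multiplicative and the antipode reverses products with the Koszul
  sign, so what remains is an identity between signs, checked by cases on the parities p, b and
  c.\<close>

lemma adj_dpi_mult:
  fixes u v :: "'n::{finite,linorder} uhc"
  assumes "homogeneous b u" "homogeneous c v" "adj_dpi \<eta> b u" "adj_dpi \<eta> c v"
  shows "adj_dpi \<eta> (b \<noteq> c) (u * v)"
  unfolding adj_dpi_def
proof (intro allI ballI impI)
  fix p and x y :: "'n svec"
  assume x: "x \<in> spin_module" "svec_part p x = x" and y: "y \<in> spin_module"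
  have hv: "hhom c (dpi \<eta> v)" using hhom_dpi[of c \<eta> v] assms(2) by (simp add: homogeneous_def)
  have m: "hact \<eta> (dpi \<eta> w) z \<in> spin_module" if "z \<in> spin_module" for w :: "'n uhc" and z
    by (rule hact_spin_module[OF dpi_hspace that])
  have "super_form \<eta> (hact \<eta> (dpi \<eta> (u * v)) x) y = super_form \<eta> (hact \<eta> (dpi \<eta> u) (hact \<eta> (dpi \<eta> v) x)) y"
    by (simp add: dpi_mult hact_mul)
  also have "\<dots> = complex_of_real (koszul (p \<noteq> c) b) *
      super_form \<eta> (hact \<eta> (dpi \<eta> v) x) (hact \<eta> (dpi \<eta> (antipode u)) y)"
    using assms(3) m[OF x(1)] y svec_part_hact[OF hv x] unfolding adj_dpi_def by blast
  also have "super_form \<eta> (hact \<eta> (dpi \<eta> v) x) (hact \<eta> (dpi \<eta> (antipode u)) y)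
    = complex_of_real (koszul p c) * super_form \<eta> x (hact \<eta> (dpi \<eta> (antipode v)) (hact \<eta> (dpi \<eta> (antipode u)) y))"
    using assms(4) m[OF y] x unfolding adj_dpi_def by blast
  also have "hact \<eta> (dpi \<eta> (antipode v)) (hact \<eta> (dpi \<eta> (antipode u)) y) = hact \<eta> (dpi \<eta> (antipode v * antipode u)) y"
    by (simp add: dpi_mult hact_mul)
  finally have 1: "super_form \<eta> (hact \<eta> (dpi \<eta> (u * v)) x) y = complex_of_real (koszul (p \<noteq> c) b) *
     (complex_of_real (koszul p c) * super_form \<eta> x (hact \<eta> (dpi \<eta> (antipode v * antipode u)) y))" .
  have "super_form \<eta> x (hact \<eta> (dpi \<eta> (antipode (u * v))) y)
    = complex_of_real (koszul b c) * super_form \<eta> x (hact \<eta> (dpi \<eta> (antipode v * antipode u)) y)"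
    unfolding antipode_props(6)[OF assms(1,2)]
    by (simp only: dpi_scale scaleR_hmat hact_scale super_form_linear complex_cnj_complex_of_real)
  with 1 show "super_form \<eta> (hact \<eta> (dpi \<eta> (u * v)) x) y
      = complex_of_real (koszul p (b \<noteq> c)) * super_form \<eta> x (hact \<eta> (dpi \<eta> (antipode (u * v))) y)"
    by (cases p; cases b; cases c) simp_all
qed

text \<open>The reason for the eighth root of unity in the representation: it absorbs the factor i
  by which the super form differs from the ordinary form on odd vectors.\<close>

lemma cis_pi4_cnj: "cis (pi / 4) = \<i> * cnj (cis (pi / 4))"
proof -
  have "\<i> * cnj (cis (pi / 4)) = cis (pi / 2) * cis (- pi / 4)"
    by (simp add: cis_cnj)
  also have "\<dots> = cis (pi / 4)" unfolding cis_mult by simp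
  finally show ?thesis by simp
qed

lemma adj_dpi_agen: "adj_dpi \<eta> True (agen i :: 'n::{finite,linorder} uhc)"
  unfolding adj_dpi_def
proof (intro allI ballI impI)
  fix p and x y :: "'n svec"
  assume x: "x \<in> spin_module" "svec_part p x = x" and y: "y \<in> spin_module"
  let ?e = "cis (pi / 4)" and ?c = "cgen (complex_of_real \<eta>) i"
  have c: "hhom True ?c" unfolding cgen_eq by (intro hhom_cgen_pos pos_bounds)
  have my: "hact \<eta> ?c y \<in> spin_module" and mx: "hact \<eta> ?c x \<in> spin_module"
    using c x(1) y by (auto intro: hact_spin_module hhom_hspace)
  have 1: "super_form \<eta> (hact \<eta> (dpi \<eta> (agen i)) x) y = ?e * ((if \<not> p then \<i> else 1) * sform \<eta> (hact \<eta> ?c x) y)"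
    unfolding dpi_agen hact_scale super_form_linear
    using super_form_homogeneous[OF svec_part_hact[OF c x] y, of \<eta> \<eta>] by simp
  have "dpi \<eta> (antipode (agen i)) = hscale (- ?e) ?c"
    by (simp add: antipode_props(3) linear_neg[OF linear_dpi] dpi_agen hscale_minus_one[symmetric])
  then have 2: "super_form \<eta> x (hact \<eta> (dpi \<eta> (antipode (agen i))) y)
      = cnj (- ?e) * ((if p then \<i> else 1) * sform \<eta> x (hact \<eta> ?c y))"
    by (simp only: hact_scale super_form_linear super_form_homogeneous[OF x(2) my])
  have 3: "sform \<eta> (hact \<eta> ?c x) y = sform \<eta> x (hact \<eta> ?c y)"
    unfolding cgen_eq by (intro sform_cgen_pos pos_bounds x y)
  \<comment> \<open>The operator changes the parity, so exactly one side of the adjunction carries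
    the factor i.\<close>
  have "?e * (if \<not> p then \<i> else 1) = complex_of_real (koszul p True) * (cnj (- ?e) * (if p then \<i> else 1))"
  proof (cases p)
    case True
    then show ?thesis using cis_pi4_cnj by (simp add: mult.commute)
  next
    case False
    have "\<i> * (\<i> * c) = - c" for c by (simp add: mult.assoc[symmetric])
    then have "\<i> * ?e = - cnj ?e" using arg_cong[OF cis_pi4_cnj, of "(*) \<i>"] by simp
    with False show ?thesis by (simp add: mult.commute)
  qed
  then show "super_form \<eta> (hact \<eta> (dpi \<eta> (agen i)) x) y
      = complex_of_real (koszul p True) * super_form \<eta> x (hact \<eta> (dpi \<eta> (antipode (agen i))) y)"
    unfolding 1 2 3 by (simp only: mult.assoc[symmetric])
qed

lemma homogeneous_basis: "homogeneous (bodd m) (basis_elt m)"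
  by (simp add: homogeneous_def parity_part_basis)

lemma homogeneous_agen: "homogeneous True (agen i)"
  using homogeneous_basis[of "Mon 0 {i}"] by (simp add: agen_def bodd_mon_def)

lemma homogeneous_zgen: "homogeneous False zgen"
  using homogeneous_basis[of "Mon 1 {}"] by (simp add: zgen_def bodd_mon_def)

lemma homogeneous_one: "homogeneous False (1 :: 'n::{finite,linorder} uhc)"
  using homogeneous_basis[of "bone :: 'n mon"] by (simp add: one_salg_def)

lemma homogeneous_mult:
  fixes u v :: "'n::{finite,linorder} uhc"
  assumes "homogeneous b u" "homogeneous c v"
  shows "homogeneous (b \<noteq> c) (u * v)"
proof -
  have 1: "homogeneous (b \<noteq> c) (parity_part b (basis_elt m) * parity_part c v)" for m :: "'n mon"
    by (induction v rule: salg_induct)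
      (auto simp: homogeneous_def parity_part_basis basis_times bodd_mul parity_part_zero parity_part_add
        parity_part_scale distrib_left)
  have "homogeneous (b \<noteq> c) (parity_part b u * parity_part c v)"
    by (induction u rule: salg_induct)
      (use 1 in \<open>auto simp: homogeneous_def parity_part_zero parity_part_add parity_part_scale distrib_right\<close>)
  with assms show ?thesis by (simp add: homogeneous_def)
qed

lemma adj_dpi_basis: "adj_dpi \<eta> (bodd m) (basis_elt m :: 'n::{finite,linorder} uhc)"
proof -
  have one: "adj_dpi \<eta> False (1 :: 'n uhc)"
    by (simp add: adj_dpi_def antipode_props(2) dpi_one)
  have A: "homogeneous (odd (length xs)) (prod_list (map agen xs)) \<and> adj_dpi \<eta> (odd (length xs)) (prod_list (map agen xs))"
    for xs :: "'n list"
  proof (induction xs)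
    case (Cons i xs)
    from homogeneous_mult[OF homogeneous_agen conjunct1[OF Cons]]
      adj_dpi_mult[OF homogeneous_agen conjunct1[OF Cons] adj_dpi_agen conjunct2[OF Cons]]
    show ?case by simp
  qed (simp add: one homogeneous_one)
  \<comment> \<open>Since z is the square of every generator, any index will do;
    \<open>undefined\<close> is one.\<close>
  have z: "adj_dpi \<eta> False (zgen :: 'n uhc)"
    using adj_dpi_mult[OF homogeneous_agen homogeneous_agen adj_dpi_agen adj_dpi_agen, of \<eta> undefined undefined]
    by (simp add: agen_sq)
  have Z: "homogeneous False (zgen ^ j :: 'n uhc) \<and> adj_dpi \<eta> False (zgen ^ j :: 'n uhc)" for j
  proof (induction j)
    case (Suc j)
    from homogeneous_mult[OF homogeneous_zgen conjunct1[OF Suc]]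
      adj_dpi_mult[OF homogeneous_zgen conjunct1[OF Suc] z conjunct2[OF Suc]]
    show ?case by simp
  qed (simp add: one homogeneous_one)
  obtain j I where m: "m = Mon j I" by (cases m)
  let ?xs = "sorted_list_of_set I"
  have "adj_dpi \<eta> (False \<noteq> odd (length ?xs)) (zgen ^ j * prod_list (map agen ?xs))"
    using Z[of j] A[of ?xs] by (intro adj_dpi_mult) auto
  then show ?thesis
    by (simp add: m bodd_mon_def basis_eq_monomial aprod_def)
qed

lemma adj_dpi_parity_part: "adj_dpi \<eta> b (parity_part b u)"
proof (induction u rule: salg_induct)
  case (1 m)
  have "adj_dpi \<eta> b 0" by (simp add: adj_dpi_def antipode_zero dpi_zero)
  then show ?case using adj_dpi_basis[of \<eta> m] by (auto simp: parity_part_basis)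
next
  case 2
  then show ?case by (simp add: adj_dpi_def antipode_zero dpi_zero parity_part_zero)
qed (simp_all add: parity_part_add parity_part_scale adj_dpi_add adj_dpi_scale)

text \<open>Standard basis vectors are homogeneous, and \<open>sform\<close> against them gives the
  conjugate coordinates up to a power of \<eta>, which is invertible.\<close>

lemma super_form_nondegenerate:
  fixes w w' :: "'n::finite svec"
  assumes "\<eta> \<noteq> 0" "w \<in> spin_module" "w' \<in> spin_module"
    and eq: "\<And>p x. x \<in> spin_module \<Longrightarrow> svec_part p x = x \<Longrightarrow> super_form \<eta> x w = super_form \<eta> x w'"
  shows "w = w'"
proof -
  have s: "sform \<eta> x w = sform \<eta> x w'" if "x \<in> spin_module" "svec_part p x = x" for p x
    using eq[OF that] by (simp add: super_form_homogeneous[OF that(2)] assms split: if_splits)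
  have d: "(\<Sum>I\<in>UNIV. f I * (axis J (1 :: complex) $ I * g I)) = f J * g J" for f g and J :: "'n spin"
    by (simp add: axis_def if_distrib[of "\<lambda>x. x * _"] if_distrib[of "(*) _"] cong: if_cong)
  have 1: "fst w $ J = fst w' $ J" for J
  proof (cases "even CARD('n)")
    case True
    have "svec_part (odd (card (odd_positions J))) (axis J 1, 0) = (axis J 1, 0 :: complex ^ 'n spin)"
      using True by (auto simp: svec_part_def vec_eq_iff axis_def)
    from s[OF _ this] show ?thesis
      using True \<open>\<eta> \<noteq> 0\<close> by (simp add: spin_module_def sform_def d)
  next
    case False
    have "svec_part False (axis J 1, 0) = (axis J 1, 0 :: complex ^ 'n spin)"
      using False by (auto simp: svec_part_def)
    from s[OF _ this] show ?thesis
      using False d[of "\<lambda>_. 1"] by (simp add: spin_module_def sform_def)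
  qed
  have 2: "snd w $ J = snd w' $ J" for J
  proof (cases "even CARD('n)")
    case True
    then show ?thesis using assms by (simp add: spin_module_def)
  next
    case False
    have "svec_part True (0, axis J 1) = (0 :: complex ^ 'n spin, axis J 1)"
      using False by (auto simp: svec_part_def)
    from s[OF _ this] show ?thesis
      using False d[of "\<lambda>_. 1"] \<open>\<eta> \<noteq> 0\<close> by (simp add: spin_module_def sform_def)
  qed
  show ?thesis using 1 2 by (simp add: prod_eq_iff vec_eq_iff)
qed

text \<open>The description in \<open>hom_adjoint\<close> needs existence, which is
  \<open>adj_dpi_parity_part\<close>, and uniqueness, which is nondegeneracy of the form.\<close>

lemma hom_adjoint_dpi:
  fixes u :: "'n::{finite,linorder} uhc"
  assumes "\<eta> \<noteq> 0"
  shows "hom_adjoint \<eta> b (dpi \<eta> (parity_part b u)) = dpi \<eta> (antipode (parity_part b u))"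
  unfolding hom_adjoint_def
proof (rule the_equality)
  let ?B = "dpi \<eta> (parity_part b u)" and ?C = "dpi \<eta> (antipode (parity_part b u))"
  have C: "\<forall>p. \<forall>x\<in>spin_module. \<forall>y\<in>spin_module. svec_part p x = x \<longrightarrow>
      super_form \<eta> (hact \<eta> ?B x) y = complex_of_real (koszul p b) * super_form \<eta> x (hact \<eta> ?C y)"
    using adj_dpi_parity_part[of \<eta> b u] unfolding adj_dpi_def .
  then show "?C \<in> hspace \<and> (\<forall>p. \<forall>x\<in>spin_module. \<forall>y\<in>spin_module. svec_part p x = x \<longrightarrow>
      super_form \<eta> (hact \<eta> ?B x) y = complex_of_real (koszul p b) * super_form \<eta> x (hact \<eta> ?C y))"
    using dpi_hspace by blast
  fix D :: "'n hmat"
  assume D: "D \<in> hspace \<and> (\<forall>p. \<forall>x\<in>spin_module. \<forall>y\<in>spin_module. svec_part p x = x \<longrightarrow>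
      super_form \<eta> (hact \<eta> ?B x) y = complex_of_real (koszul p b) * super_form \<eta> x (hact \<eta> D y))"
  have "hact \<eta> D y = hact \<eta> ?C y" if y: "y \<in> spin_module" for y :: "'n svec"
  proof (rule super_form_nondegenerate[OF assms])
    show "hact \<eta> D y \<in> spin_module" "hact \<eta> ?C y \<in> spin_module"
      using D dpi_hspace y by (auto intro: hact_spin_module)
    fix p and x :: "'n svec" assume x: "x \<in> spin_module" "svec_part p x = x"
    have "complex_of_real (koszul p b) * super_form \<eta> x (hact \<eta> D y)
        = complex_of_real (koszul p b) * super_form \<eta> x (hact \<eta> ?C y)"
      using C D x y by metis
    then show "super_form \<eta> x (hact \<eta> D y) = super_form \<eta> x (hact \<eta> ?C y)"
      by (simp split: if_splits)
  qed
  \<comment> \<open>\<open>hact_inject\<close> tests on vectors (x, 0) only, and these lie in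
    \<open>spin_module\<close> for either parity of n.\<close>
  then show "D = ?C"
    by (intro hact_inject[of "complex_of_real \<eta>"]) (simp add: spin_module_def)
qed

theorem super_adjoint_dpi:
  fixes u :: "'n::{finite,linorder} uhc"
  assumes "\<eta> \<noteq> 0"
  shows "super_adjoint \<eta> (dpi \<eta> u) = dpi \<eta> (antipode u)"
proof -
  have "super_adjoint \<eta> (dpi \<eta> u)
      = dpi \<eta> (antipode (parity_part False u)) + dpi \<eta> (antipode (parity_part True u))"
    by (simp add: super_adjoint_def UNIV_bool hmat_part_dpi hom_adjoint_dpi[OF assms] add.commute)
  also have "\<dots> = dpi \<eta> (antipode (parity_part False u + parity_part True u))"
    by (simp only: dpi_add antipode_add)
  finally show ?thesis by (simp only: parity_part_sum[symmetric])
qed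

section \<open>Traces\<close>

text \<open>For odd n the spin module is two copies of the matrix module, belonging to 1 and
  \<epsilon>, and the component without \<epsilon> acts in the same way on both.\<close>

definition spin_mult :: "'n::finite itself \<Rightarrow> complex" where
  "spin_mult _ = (if even CARD('n) then 1 else 2)"

lemma spin_trace_eq: "spin_trace \<zeta> (X :: 'n::finite hmat) = spin_mult TYPE('n) * trace (fst X)"
proof -
  have "(M *v axis I 1) $ I = M $ I $ I" for M :: "'n cmat" and I
    by (simp add: matrix_vector_mult_def axis_def if_distrib[of "(*) _"] cong: if_cong)
  then show ?thesis
    by (simp add: spin_trace_def spin_mult_def hact_def trace_def)
qed

lemma trace_cscale: "trace (cscale c A) = c * trace A"
  by (simp add: trace_def sum_distrib_left)

lemma spin_trace_commute: "spin_trace \<zeta> (hmul \<zeta> X Y) = spin_trace \<zeta> (hmul \<zeta> Y X)"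
  unfolding spin_trace_eq hmul_def fst_conv trace_add trace_cscale
  by (simp only: trace_mul_sym[of "fst X"] trace_mul_sym[of "snd X"])

lemma spin_trace_scale: "spin_trace \<zeta> (hscale c X) = c * spin_trace \<zeta> X"
  by (simp add: spin_trace_eq trace_cscale)

lemma spin_trace_add: "spin_trace \<zeta> (X + Y) = spin_trace \<zeta> X + spin_trace \<zeta> Y"
  by (simp add: spin_trace_eq trace_add distrib_left)

lemma spin_trace_zero [simp]: "spin_trace \<zeta> 0 = 0"
  by (simp add: spin_trace_eq trace_def)

text \<open>For even n conjugation by the involution Gamma negates X and preserves the trace; for
  odd n the component that enters the trace is zero.\<close>

lemma spin_trace_odd:
  assumes "hhom True X"
  shows "spin_trace \<zeta> (X :: 'n::finite hmat) = 0"
proof (cases "even CARD('n)")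
  case True
  then have X: "Gamma_mat ** fst X = - (fst X ** Gamma_mat)"
    using assms by (simp add: hhom_def cscale_minus_one)
  have "trace (fst X) = trace (Gamma_mat ** (Gamma_mat ** fst X))"
    by (simp add: matrix_mul_assoc Gamma_sq)
  also have "\<dots> = - trace (Gamma_mat ** (fst X ** Gamma_mat))"
    unfolding X matrix_uminus_mult by (simp add: trace_def sum_negf)
  also have "trace (Gamma_mat ** (fst X ** Gamma_mat)) = trace (fst X ** Gamma_mat ** Gamma_mat)"
    by (rule trace_mul_sym)
  also have "\<dots> = trace (fst X)" by (simp add: matrix_mul_assoc[symmetric] Gamma_sq)
  finally have "trace (fst X) = 0" by simp
  then show ?thesis by (simp add: spin_trace_eq)
next
  case False
  with assms show ?thesis by (simp add: hhom_def spin_trace_eq trace_def)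
qed

lemma basis_Mon: "basis_elt (Mon j I) = zgen ^ j * basis_elt (Mon 0 I)"
  using basis_eq_monomial[of j I] by (simp add: aprod_basis)

lemma dpi_zgen_power: "dpi \<zeta> (zgen ^ j * u) = hscale ((\<i> * \<zeta>) ^ j) (dpi \<zeta> u)"
  by (induction j) (simp_all add: mult.assoc dpi_mult dpi_zgen mult.commute[of "(\<i> * \<zeta>) ^ _"])

text \<open>For i in I and |I| even, a_i anticommutes with a_I. By cyclicity the trace of a_i a_i
  a_I = z a_I is then its own negative, and z acts by the nonzero scalar i\<zeta>.\<close>

lemma spin_trace_even:
  fixes I :: "'n::{finite,linorder} set"
  assumes "\<zeta> \<noteq> 0" "even (card I)" "I \<noteq> {}"
  shows "spin_trace \<zeta> (dpi \<zeta> (basis_elt (Mon j I))) = 0"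
proof -
  obtain i where i: "i \<in> I" using assms by blast
  let ?u = "basis_elt (Mon j I)" and ?c = "(-1) ^ (j + card I) :: real"
  \<comment> \<open>The anticommutation comes from computing the antipode of a_i u twice: from its
    values on monomials, and from its rule for products. Removing i from I raises the degree in z by
    one, so the exponent of the sign is the same as for u.\<close>
  have "antipode (agen i * ?u) = ?c *\<^sub>R (agen i * ?u)"
  proof -
    have S: "sym_diff {i} I = I - {i}" using i by auto
    have "card I > 0" using i by (simp add: card_gt_0_iff) blast
    then have "Suc j + card (I - {i}) = j + card I"
      using i by (simp add: card_Diff_singleton)
    then show ?thesis
      using i unfolding agen_basis S antipode_scale
      by (simp add: antipode_def mult.commute del: add_Suc add_Suc_shift)
  qed
  moreover have "antipode (agen i * ?u) = - (?c *\<^sub>R (?u * agen i))"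
  proof -
    have "homogeneous False ?u"
      using homogeneous_basis[of "Mon j I"] assms by (simp add: bodd_mon_def)
    note S = antipode_props(6)[OF homogeneous_agen this, of i]
    have "antipode ?u = ?c *\<^sub>R ?u" by (simp add: antipode_def)
    then show ?thesis unfolding S antipode_props(3) by simp
  qed
  ultimately have "?c *\<^sub>R (agen i * ?u) = ?c *\<^sub>R (- (?u * agen i))" by simp
  then have anti: "agen i * ?u = - (?u * agen i)"
    unfolding scaleR_cancel_left by simp
  have "spin_trace \<zeta> (dpi \<zeta> (agen i * (agen i * ?u))) = spin_trace \<zeta> (dpi \<zeta> ((agen i * ?u) * agen i))"
    unfolding dpi_mult by (rule spin_trace_commute)
  also have "(agen i * ?u) * agen i = - (agen i * (agen i * ?u))"
    by (subst (2) anti) (simp add: mult.assoc)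
  also have "spin_trace \<zeta> (dpi \<zeta> (- (agen i * (agen i * ?u)))) = - spin_trace \<zeta> (dpi \<zeta> (agen i * (agen i * ?u)))"
    by (simp only: linear_neg[OF linear_dpi] hscale_minus_one[symmetric] spin_trace_scale) simp
  finally have "spin_trace \<zeta> (dpi \<zeta> (agen i * (agen i * ?u))) = 0" by simp
  moreover have "agen i * (agen i * ?u) = zgen ^ 1 * ?u" by (simp add: mult.assoc[symmetric] agen_sq)
  ultimately show ?thesis
    using assms(1) by (simp only: dpi_zgen_power spin_trace_scale) simp
qed

lemma spin_trace_dpi_basis:
  fixes m :: "'n::{finite,linorder} mon"
  assumes "\<zeta> \<noteq> 0" "gens m \<noteq> {}"
  shows "spin_trace \<zeta> (dpi \<zeta> (basis_elt m)) = 0"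
proof (cases "bodd m")
  case True
  then show ?thesis using hhom_dpi_basis[of m \<zeta>] spin_trace_odd by metis
next
  case False
  then show ?thesis using spin_trace_even[OF assms(1) _ assms(2), of "zdeg m"] by (simp add: bodd_mon_def)
qed

section \<open>The top element\<close>

text \<open>The factor that turns the trace into T. Up to a power of \<zeta> it is the image of
  \<open>gam\<close>, by \<open>dpi_gam\<close>.\<close>

definition Tgen :: "'n::finite hmat" where
  "Tgen = (if even CARD('n) then (Gamma_mat, 0) else hscale (cis (pi / 4)) (0, mat 1))"

lemma Tfun_eq: "Tfun \<zeta> A = spin_trace \<zeta> (hmul \<zeta> Tgen A)"
  by (simp add: Tfun_def Tgen_def)

lemma foldr_hmul: "foldr (hmul \<zeta>) xs X = hmul \<zeta> (foldr (hmul \<zeta>) xs hone) X"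
  by (induction xs) (simp_all add: hmul_assoc)

definition gen_prod :: "complex \<Rightarrow> nat \<Rightarrow> 'n::finite hmat" where
  "gen_prod \<zeta> m = foldr (hmul \<zeta>) (map (\<lambda>j. hscale (cis (pi / 4)) (cgen_pos \<zeta> j)) [1..<m + 1]) hone"

lemma gen_prod_0 [simp]: "gen_prod \<zeta> 0 = hone"
  by (simp add: gen_prod_def)

lemma gen_prod_Suc: "gen_prod \<zeta> (Suc m) = hscale (cis (pi / 4)) (hmul \<zeta> (gen_prod \<zeta> m) (cgen_pos \<zeta> (Suc m)))"
proof -
  have "[1..<Suc m + 1] = [1..<m + 1] @ [Suc m]" by simp
  then show ?thesis unfolding gen_prod_def by (simp only: map_append foldr_append) (subst foldr_hmul, simp)
qed

lemma dpi_gam_prod: "dpi \<zeta> (gam :: 'n::{finite,linorder} uhc) = gen_prod \<zeta> CARD('n)"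
proof -
  let ?xs = "sorted_list_of_set (UNIV :: 'n set)"
  have mono: "pos i \<le> pos j" if "i \<le> j" for i j :: 'n
    unfolding pos_def using that by (intro card_mono) auto
  have "map pos ?xs = [1..<CARD('n) + 1]"
  proof (rule sorted_distinct_set_unique)
    show "sorted (map pos ?xs)"
      unfolding sorted_map by (rule sorted_wrt_mono_rel[of _ "(\<le>)"]) (auto intro: mono)
    show "distinct (map pos ?xs)" by (simp add: distinct_map inj_on_def)
    show "set (map pos ?xs) = set [1..<CARD('n) + 1]"
      using bij_pos[where 'n = 'n] by (auto simp: bij_betw_def atLeastLessThanSuc_atLeastAtMost)
  qed (simp_all del: upt_Suc)
  then have "map (dpi_gen \<zeta>) ?xs = map (\<lambda>j. hscale (cis (pi / 4)) (cgen_pos \<zeta> j)) [1..<CARD('n) + 1]"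
    unfolding cgen_eq[abs_def] by (metis (no_types, lifting) map_map comp_def map_eq_conv)
  then show ?thesis
    by (simp add: gam_def aprod_basis dpi_basis gen_prod_def)
qed

text \<open>For even n, the product of the first 2m generators is a multiple of this matrix.\<close>

definition Gamma_upto :: "nat \<Rightarrow> 'n::finite cmat" where
  "Gamma_upto m = tensor_mat (\<lambda>p. if p \<le> m then sigma2 else one2)"

lemma Gamma_upto_0: "Gamma_upto 0 = (mat 1 :: 'n::finite cmat)"
proof -
  have "Gamma_upto 0 = (tensor_mat (\<lambda>_. one2) :: 'n cmat)"
    unfolding Gamma_upto_def by (rule tensor_mat_cong) simp
  then show ?thesis by (simp add: tensor_mat_one)
qed

lemma Gamma_upto_top: "Gamma_upto (CARD('n) div 2) = (Gamma_mat :: 'n::finite cmat)"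
  unfolding Gamma_upto_def Gamma_mat_def by (rule tensor_mat_cong) simp

text \<open>At position m + 1 the factors are X and Y, with X Y = -i\<zeta> sigma. At earlier
  positions two of the three copies of sigma cancel; at later ones all factors are the
  identity.\<close>

lemma Gamma_upto_Suc:
  assumes "m < CARD('n) div 2"
  shows "Gamma_upto m ** spin_gen \<zeta> (2 * m + 1) ** spin_gen \<zeta> (2 * m + 2)
    = cscale (- \<i> * \<zeta>) (Gamma_upto (Suc m) :: 'n::finite cmat)"
proof -
  have f: "mul2 (mul2 (if p \<le> m then sigma2 else one2) (spin_factor \<zeta> (2 * m + 1) p)) (spin_factor \<zeta> (2 * m + 2) p)
      = (\<lambda>a b. (if p = Suc m then - \<i> * \<zeta> else 1) * (if p \<le> Suc m then sigma2 else one2) a b)" for p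
  proof -
    have "(2 * m + 1 + 1) div 2 = Suc m" "(2 * m + 2 + 1) div 2 = Suc m" by simp_all
    then show ?thesis
      unfolding spin_factor_def by (auto simp: fun_eq_iff mat2_defs le_Suc_eq)
  qed
  have "Suc m \<in> {1..CARD('n) div 2}" using assms by simp
  then show ?thesis
    unfolding Gamma_upto_def spin_gen_factor tensor_mat_mult f tensor_mat_scale
    by (simp only: prod_single_position)
qed

text \<open>Each pair of generators contributes i from the two eighth roots of unity and -i\<zeta>
  from \<open>Gamma_upto_Suc\<close>, hence \<zeta>.\<close>

lemma gen_prod_even:
  assumes "even CARD('n)" "m \<le> CARD('n) div 2"
  shows "gen_prod \<zeta> (2 * m) = hscale (\<zeta> ^ m) (Gamma_upto m, 0 :: 'n::finite cmat)"
  using assms(2)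
proof (induction m)
  case 0
  show ?case by (simp add: Gamma_upto_0 hone_def)
next
  case (Suc m)
  have "gen_prod \<zeta> (2 * Suc m) = hscale \<i> (hmul \<zeta> (hmul \<zeta> (gen_prod \<zeta> (2 * m)) (spin_gen \<zeta> (2 * m + 1), 0)) (spin_gen \<zeta> (2 * m + 2), 0 :: 'n cmat))"
    using assms(1) by (simp add: gen_prod_Suc cgen_pos_def cis_pi4_sq)
  also have "\<dots> = hscale (\<i> * \<zeta> ^ m) (hmul \<zeta> (hmul \<zeta> (Gamma_upto m, 0) (spin_gen \<zeta> (2 * m + 1), 0)) (spin_gen \<zeta> (2 * m + 2), 0))"
    using Suc by simp
  also have "\<dots> = hscale (\<i> * \<zeta> ^ m) (Gamma_upto m ** spin_gen \<zeta> (2 * m + 1) ** spin_gen \<zeta> (2 * m + 2), 0)"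
    by (simp add: hmul_def)
  also have "\<dots> = hscale (\<zeta> ^ Suc m) (Gamma_upto (Suc m), 0)"
    using Gamma_upto_Suc[of m \<zeta>, where 'n = 'n] Suc.prems by (simp add: hscale_def mult_ac)
  finally show ?case .
qed

text \<open>The first generator contributes e^(i pi/4) \<epsilon> Gamma. In each later pair the two
  \<epsilon> give \<zeta>, the two Gamma cancel, and i from the eighth roots meets -i from
  \<open>Gamma_upto_Suc\<close> at parameter 1.\<close>

lemma gen_prod_odd:
  assumes "odd CARD('n)" "m \<le> CARD('n) div 2"
  shows "gen_prod \<zeta> (2 * m + 1) = hscale (cis (pi / 4) * \<zeta> ^ m) (0, Gamma_mat ** (Gamma_upto m :: 'n::finite cmat))"
  using assms(2)
proof (induction m)
  case 0
  show ?case using assms(1) by (simp add: Gamma_upto_0 gen_prod_Suc cgen_pos_def)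
next
  case (Suc m)
  let ?D = "\<lambda>j. (0, cscale (- \<i>) (Gamma_mat ** spin_gen 1 j)) :: 'n hmat"
  let ?A = "Gamma_mat ** (Gamma_upto m :: 'n cmat)"
  have "gen_prod \<zeta> (2 * Suc m + 1) = hscale \<i> (hmul \<zeta> (hmul \<zeta> (gen_prod \<zeta> (2 * m + 1)) (?D (2 * m + 1))) (?D (2 * m + 2)))"
  proof -
    have "2 * Suc m + 1 = Suc (Suc (2 * m + 1))" by simp
    moreover have "cgen_pos \<zeta> (Suc (2 * m + 1)) = ?D (2 * m + 1)" "cgen_pos \<zeta> (Suc (Suc (2 * m + 1))) = ?D (2 * m + 2)"
      using assms(1) by (simp_all add: cgen_pos_def)
    ultimately show ?thesis
      by (simp only: gen_prod_Suc[of \<zeta> "2 * m + 1"] gen_prod_Suc[of \<zeta> "Suc (2 * m + 1)"] hmul_scale hscale_simps cis_pi4_sq)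
  qed
  also have "\<dots> = hscale (\<i> * (cis (pi / 4) * \<zeta> ^ m)) (hmul \<zeta> (0, ?A) (hmul \<zeta> (?D (2 * m + 1)) (?D (2 * m + 2))))"
    using Suc by (simp add: hmul_assoc)
  also have "hmul \<zeta> (?D (2 * m + 1)) (?D (2 * m + 2))
      = (cscale \<zeta> (spin_gen 1 (2 * m + 1) ** spin_gen 1 (2 * m + 2)), 0)"
    using odd_generator_product[of "2 * m + 1" 1 "spin_gen 1 (2 * m + 2) :: 'n cmat"] Suc.prems
    by (simp add: hmul_def) (simp add: vec_eq_iff)
  also have "hmul \<zeta> (0, ?A) \<dots> = (0, cscale \<zeta> (Gamma_mat ** (Gamma_upto m ** spin_gen 1 (2 * m + 1) ** spin_gen 1 (2 * m + 2))))"
    by (simp add: hmul_def matrix_mul_assoc)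
  also have "\<dots> = hscale (- \<i> * \<zeta>) (0, Gamma_mat ** Gamma_upto (Suc m))"
    using Gamma_upto_Suc[of m 1, where 'n = 'n] Suc.prems by (simp add: hscale_def mult_ac)
  finally show ?case by (simp add: mult_ac)
qed

lemma dpi_gam: "dpi \<zeta> (gam :: 'n::{finite,linorder} uhc) = hscale (\<zeta> ^ (CARD('n) div 2)) Tgen"
proof (cases "even CARD('n)")
  case True
  then have "CARD('n) = 2 * (CARD('n) div 2)" by simp
  then have "gen_prod \<zeta> CARD('n) = hscale (\<zeta> ^ (CARD('n) div 2)) (Gamma_mat, 0 :: 'n cmat)"
    using gen_prod_even[OF True order_refl, of \<zeta>] by (simp only: Gamma_upto_top)
  then show ?thesis using True by (simp add: dpi_gam_prod Tgen_def)
next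
  case False
  then have "CARD('n) = 2 * (CARD('n) div 2) + 1" by simp
  then have "gen_prod \<zeta> CARD('n) = hscale (cis (pi / 4) * \<zeta> ^ (CARD('n) div 2)) (0, mat 1 :: 'n cmat)"
    using gen_prod_odd[OF False order_refl, of \<zeta>] by (simp only: Gamma_upto_top Gamma_sq)
  then show ?thesis using False by (simp add: dpi_gam_prod Tgen_def mult.commute)
qed

lemma spin_trace_Tgen:
  "spin_trace \<zeta> (hmul \<zeta> Tgen (Tgen :: 'n::finite hmat))
    = (if even CARD('n) then 2 ^ (CARD('n) div 2) else \<i> * \<zeta> * 2 ^ (CARD('n) div 2 + 1))"
proof -
  have "trace (mat 1 :: 'n cmat) = of_nat CARD('n spin)"
    by (simp add: trace_def mat_def)
  then have t: "trace (mat 1 :: 'n cmat) = 2 ^ (CARD('n) div 2)"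
    by (simp add: card_spin)
  show ?thesis
    by (simp add: Tgen_def hmul_def spin_trace_eq spin_mult_def Gamma_sq t trace_cscale cis_pi4_sq mult.assoc[symmetric])
qed

text \<open>The i is e^(i pi/4) squared: one factor belongs to T, the other is left over from the
  odd number of generators in \<open>gam\<close>.\<close>

definition Tsign :: "'n::finite itself \<Rightarrow> complex" where
  "Tsign _ = (if even CARD('n) then 1 else \<i>)"

text \<open>Multiplication by \<open>\<gamma>\<close> turns \<open>T\<close> into the trace, which vanishes on all \<open>a_I\<close> with \<open>I \<noteq> {}\<close>.\<close>

lemma Tfun_dpi_basis:
  fixes m :: "'n::{finite,linorder} mon"
  assumes "\<zeta> \<noteq> 0"
  shows "Tfun \<zeta> (dpi \<zeta> (basis_elt m))
    = (if gens m = UNIV then (\<i> * \<zeta>) ^ zdeg m * ((2 * \<zeta>) ^ half_dim TYPE('n) * Tsign TYPE('n)) else 0)"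
proof (cases "gens m = UNIV")
  case True
  then have "basis_elt m = zgen ^ zdeg m * gam"
    using basis_eq_monomial[of "zdeg m" UNIV] by (cases m) (simp add: gam_def)
  then have "Tfun \<zeta> (dpi \<zeta> (basis_elt m)) = (\<i> * \<zeta>) ^ zdeg m * (\<zeta> ^ (CARD('n) div 2) * spin_trace \<zeta> (hmul \<zeta> Tgen (Tgen :: 'n hmat)))"
    by (simp add: dpi_zgen_power dpi_gam Tfun_eq spin_trace_scale)
  \<comment> \<open>The power of \<zeta> comes from \<open>dpi_gam\<close> and that of 2 from the
    size of the matrices; for odd n the doubled module and \<epsilon>^2 give one more factor
    2\<zeta>.\<close>
  also have "\<zeta> ^ (CARD('n) div 2) * spin_trace \<zeta> (hmul \<zeta> Tgen (Tgen :: 'n hmat)) = (2 * \<zeta>) ^ half_dim TYPE('n) * Tsign TYPE('n)"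
    by (auto simp: spin_trace_Tgen half_dim_def Tsign_def power_mult_distrib elim!: oddE)
  finally show ?thesis using True by simp
next
  case False
  let ?k = "CARD('n) div 2"
  have "\<zeta> ^ ?k * Tfun \<zeta> (dpi \<zeta> (basis_elt m)) = spin_trace \<zeta> (dpi \<zeta> (gam * basis_elt m))"
    by (simp add: Tfun_eq dpi_mult dpi_gam spin_trace_scale)
  also have "gam * basis_elt m = bsgn (Mon 0 UNIV) m *\<^sub>R basis_elt (bmul (Mon 0 UNIV) m)"
    by (simp add: gam_def aprod_basis basis_times)
  also have "spin_trace \<zeta> (dpi \<zeta> \<dots>) = 0"
    using False spin_trace_dpi_basis[OF assms, of "bmul (Mon 0 UNIV) m"]
    by (simp add: dpi_scale scaleR_hmat spin_trace_scale bmul_mon_def) blast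
  finally show ?thesis using False assms by simp
qed

section \<open>The coproduct of the top element\<close>

text \<open>Expanding the product of the a_i \<otimes> 1 + 1 \<otimes> a_i chooses the subset I that
  goes to the left; the sign is that of sorting I followed by its complement.\<close>

lemma coproduct_aprod:
  fixes K :: "'n::{finite,linorder} set"
  shows "coproduct (aprod K) = (\<Sum>I\<in>Pow K. bsgn (Mon 0 I) (Mon 0 (K - I)) *\<^sub>R basis_elt (Mon 0 I, Mon 0 (K - I)))"
proof -
  have "finite K" by simp
  then show ?thesis
  \<comment> \<open>An element below all others enters as a left factor that is already in its
    sorted place. Only 1 \<otimes> a_b picks up a sign, (-1)^|I|, by passing a_I in the left tensor
    factor.\<close>
  proof (induction K rule: finite_linorder_min_induct)
    case empty
    show ?case
      using coproduct_hom(2)[where 'n = 'n]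
      by (simp add: aprod_basis bsgn_mon_def one_salg_def bone_mon_def bone_prod_def)
  next
    case (insert b A)
    let ?e = "\<lambda>I J. basis_elt (Mon 0 I, Mon 0 J) :: ('n mon \<times> 'n mon) salg"
    let ?s = "\<lambda>I J. bsgn (Mon 0 I) (Mon 0 J)"
    have bA: "b \<notin> A" and lt: "\<And>a. a \<in> A \<Longrightarrow> b < a \<and> \<not> a < b" using insert.hyps by auto
    have one: "(\<Prod>l\<in>J. if l < b then - 1 else 1 :: real) = 1" if "J \<subseteq> A" for J
      using that lt by (intro prod.neutral) auto
    have "sym_diff {b} A = insert b A" using bA by auto
    then have "aprod (insert b A) = agen b * aprod A"
      using bA one[of A] by (simp add: aprod_basis agen_basis)
    then have "coproduct (aprod (insert b A)) = (?e {b} {} + ?e {} {b}) * (\<Sum>I\<in>Pow A. ?s I (A - I) *\<^sub>R ?e I (A - I))"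
    proof -
      have "coproduct (agen b) = ?e {b} {} + ?e {} {b}"
        unfolding coproduct_hom(4) by (simp add: agen_def one_salg_def bone_mon_def tensor_basis)
      with \<open>aprod (insert b A) = agen b * aprod A\<close> show ?thesis by (simp only: coproduct_hom(3) insert.IH)
    qed
    also have "\<dots> = (\<Sum>I\<in>Pow A. ?s I (A - I) *\<^sub>R (?e {b} {} * ?e I (A - I)) + ?s I (A - I) *\<^sub>R (?e {} {b} * ?e I (A - I)))"
      by (simp add: sum_distrib_left distrib_right scaleR_add_right)
    also have "\<dots> = (\<Sum>I\<in>Pow A. ?s (insert b I) (A - I) *\<^sub>R ?e (insert b I) (A - I)
        + ?s I (insert b (A - I)) *\<^sub>R ?e I (insert b (A - I)))"
    proof (rule sum.cong[OF refl])
      fix I assume "I \<in> Pow A"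
      then have I: "I \<subseteq> A" "b \<notin> I" using bA by auto
      have u: "sym_diff {b} I = insert b I" "sym_diff {b} (A - I) = insert b (A - I)"
        "sym_diff {} J = J" "{b} \<inter> I = {}" "{b} \<inter> (A - I) = {}" for J :: "'n set"
        using I bA by auto
      have 1: "?e {b} {} * ?e I (A - I) = ?e (insert b I) (A - I)"
        using one[OF I(1)] I u by (simp add: basis_times bsgn_prod_def bmul_prod_def bmul_mon_def bsgn_mon_def bodd_mon_def)
      have 2: "?e {} {b} * ?e I (A - I) = (- 1) ^ card I *\<^sub>R ?e I (insert b (A - I))"
        using one[of "A - I"] I u by (simp add: basis_times bsgn_prod_def bmul_prod_def bmul_mon_def bsgn_mon_def bodd_mon_def)
      have 3: "?s (insert b I) (A - I) = ?s I (A - I)"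
        using one[of "A - I"] I by (simp add: bsgn_mon_def)
      have "(\<Prod>j\<in>insert b (A - I). if j < i then - 1 else 1 :: real) = - 1 * (\<Prod>j\<in>A - I. if j < i then - 1 else 1)" if "i \<in> I" for i
        using that lt I bA by (subst prod.insert) auto
      then have "?s I (insert b (A - I)) = (\<Prod>i\<in>I. - 1 * (\<Prod>j\<in>A - I. if j < i then - 1 else 1))"
        unfolding bsgn_mon_def mon.sel by (rule prod.cong[OF refl])
      then have 4: "?s I (insert b (A - I)) = (- 1) ^ card I * ?s I (A - I)"
        unfolding bsgn_mon_def mon.sel by (simp only: prod.distrib prod_constant)
      show "?s I (A - I) *\<^sub>R (?e {b} {} * ?e I (A - I)) + ?s I (A - I) *\<^sub>R (?e {} {b} * ?e I (A - I))
        = ?s (insert b I) (A - I) *\<^sub>R ?e (insert b I) (A - I) + ?s I (insert b (A - I)) *\<^sub>R ?e I (insert b (A - I))"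
        unfolding 1 2 3 4 by (simp add: mult.commute)
    qed
    also have "\<dots> = (\<Sum>I\<in>Pow A. ?s (insert b I) (A - I) *\<^sub>R ?e (insert b I) (A - I))
        + (\<Sum>I\<in>Pow A. ?s I (insert b (A - I)) *\<^sub>R ?e I (insert b (A - I)))"
      by (rule sum.distrib)
    also have "(\<Sum>I\<in>Pow A. ?s (insert b I) (A - I) *\<^sub>R ?e (insert b I) (A - I))
        = (\<Sum>I\<in>insert b ` Pow A. ?s I (insert b A - I) *\<^sub>R ?e I (insert b A - I))"
    proof -
      have "inj_on (insert b) (Pow A)" using bA by (auto simp: inj_on_def)
      moreover have "insert b A - insert b I = A - I" if "I \<in> Pow A" for I using that bA by auto
      ultimately show ?thesis by (simp add: sum.reindex)
    qed
    also have "(\<Sum>I\<in>Pow A. ?s I (insert b (A - I)) *\<^sub>R ?e I (insert b (A - I)))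
        = (\<Sum>I\<in>Pow A. ?s I (insert b A - I) *\<^sub>R ?e I (insert b A - I))"
    proof (rule sum.cong[OF refl])
      fix I assume "I \<in> Pow A"
      then have "insert b (A - I) = insert b A - I" using bA by auto
      then show "?s I (insert b (A - I)) *\<^sub>R ?e I (insert b (A - I)) = ?s I (insert b A - I) *\<^sub>R ?e I (insert b A - I)"
        by (simp only:)
    qed
    also have "(\<Sum>I\<in>insert b ` Pow A. ?s I (insert b A - I) *\<^sub>R ?e I (insert b A - I))
        + (\<Sum>I\<in>Pow A. ?s I (insert b A - I) *\<^sub>R ?e I (insert b A - I))
        = (\<Sum>I\<in>Pow (insert b A). ?s I (insert b A - I) *\<^sub>R ?e I (insert b A - I))"
      unfolding Pow_insert using bA by (subst sum.union_disjoint) (auto simp: add.commute)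
    finally show ?case .
  qed
qed

lemma fourier_eq:
  fixes F :: "'n::{finite,linorder} uhc \<Rightarrow> real \<Rightarrow> complex"
  shows "fourier F \<zeta> = (\<Sum>I\<in>UNIV. hscale (complex_of_real (bsgn (Mon 0 I) (Mon 0 (- I))) * ft (F (basis_elt (Mon 0 I))) \<zeta>)
    (dpi (- complex_of_real \<zeta>) (basis_elt (Mon 0 (- I)))))"
  unfolding fourier_def gam_def coproduct_aprod
  by (simp add: linear_sum[OF linear_lin_ext] lin_ext_scale scaleR_hmat ft_def Compl_eq_Diff_UNIV)

section \<open>The pairing on the representation\<close>

lemma Tfun_linear:
  "Tfun \<zeta> (X + Y) = Tfun \<zeta> X + Tfun \<zeta> Y" "Tfun \<zeta> (hscale c X) = c * Tfun \<zeta> X" "Tfun \<zeta> 0 = 0"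
  by (simp_all add: Tfun_eq hmul_add spin_trace_add spin_trace_scale)

lemma Tfun_sum: "Tfun \<zeta> (sum f A) = (\<Sum>x\<in>A. Tfun \<zeta> (f x))"
  by (induction A rule: infinite_finite_induct) (simp_all add: Tfun_linear)

lemma hmul_sum_left: "hmul \<zeta> (sum f A) X = (\<Sum>x\<in>A. hmul \<zeta> (f x) X)"
  by (induction A rule: infinite_finite_induct) (simp_all add: hmul_add)

text \<open>For i in K and l outside K exactly one of the two orders is an inversion, so each such
  pair contributes -1.\<close>

lemma bsgn_flip:
  "bsgn (Mon 0 K) (Mon 0 (- K)) * bsgn (Mon 0 (- K)) (Mon j K) = (- 1) ^ (card K * card (- K))"
  for K :: "'n::{finite,linorder} set"
proof -
  have "bsgn (Mon 0 (- K)) (Mon j K) = (\<Prod>i\<in>K. \<Prod>l\<in>- K. if i < l then - 1 else 1)"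
    unfolding bsgn_mon_def mon.sel by (rule prod.swap)
  then have "bsgn (Mon 0 K) (Mon 0 (- K)) * bsgn (Mon 0 (- K)) (Mon j K)
    = (\<Prod>i\<in>K. \<Prod>l\<in>- K. (if l < i then - 1 else 1) * (if i < l then - 1 else 1))"
    by (simp add: bsgn_mon_def prod.distrib)
  also have "\<dots> = (\<Prod>i\<in>K. \<Prod>l\<in>- K. - 1)"
  proof (intro prod.cong refl)
    fix i l assume "i \<in> K" "l \<in> - K"
    then have "i \<noteq> l" by auto
    then show "(if l < i then - 1 else 1) * (if i < l then - 1 else 1 :: real) = - 1"
      by (cases "i < l") auto
  qed
  also have "\<dots> = (- 1) ^ (card K * card (- K))" by (simp add: power_mult[symmetric] mult.commute)
  finally show ?thesis .
qed

text \<open>The product is a signed monomial whose index set is everything only for I =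
  \<open>gens m\<close>. The antipode turns z into -z, whence -i\<eta>; at \<eta> = -\<zeta> this
  becomes i\<zeta>, the symbol of d/dx.\<close>

lemma Tfun_dpi_pair:
  fixes m :: "'n::{finite,linorder} mon"
  assumes "\<eta> \<noteq> 0"
  shows "Tfun \<eta> (hmul \<eta> (dpi \<eta> (basis_elt (Mon 0 (- I)))) (dpi \<eta> (antipode (basis_elt m))))
    = (if I = gens m then complex_of_real ((- 1) ^ card (gens m) * bsgn (Mon 0 (- gens m)) m)
        * (- \<i> * \<eta>) ^ zdeg m * ((2 * \<eta>) ^ half_dim TYPE('n) * Tsign TYPE('n)) else 0)"
proof -
  let ?m = "bmul (Mon 0 (- I)) m"
  let ?c = "(- 1) ^ (zdeg m + card (gens m)) * bsgn (Mon 0 (- I)) m"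
  have "hmul \<eta> (dpi \<eta> (basis_elt (Mon 0 (- I)))) (dpi \<eta> (antipode (basis_elt m))) = dpi \<eta> (?c *\<^sub>R basis_elt ?m)"
    by (simp add: dpi_mult[symmetric] antipode_def basis_times)
  then have 1: "Tfun \<eta> (hmul \<eta> (dpi \<eta> (basis_elt (Mon 0 (- I)))) (dpi \<eta> (antipode (basis_elt m))))
      = complex_of_real ?c * Tfun \<eta> (dpi \<eta> (basis_elt ?m))"
    by (simp only: dpi_scale scaleR_hmat Tfun_linear)
  have gens: "gens ?m = UNIV \<longleftrightarrow> I = gens m"
    by (auto simp: bmul_mon_def)
  show ?thesis
  proof (cases "I = gens m")
    case True
    have "zdeg ?m = zdeg m" by (simp add: bmul_mon_def True)
    moreover have "(- \<i> * \<eta>) ^ zdeg m = (- 1) ^ zdeg m * (\<i> * \<eta>) ^ zdeg m"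
      by (simp add: power_mult_distrib[symmetric])
    ultimately show ?thesis
      unfolding 1 Tfun_dpi_basis[OF assms] gens using True by (simp add: power_add mult_ac)
  next
    case False
    then show ?thesis unfolding 1 Tfun_dpi_basis[OF assms] gens by simp
  qed
qed

lemma pairing_nz_eq:
  fixes A :: "real \<Rightarrow> 'n::{finite,linorder} hmat"
  assumes "\<zeta> \<noteq> 0"
  shows "pairing_nz A u \<zeta> = Tfun (- complex_of_real \<zeta>) (hmul (- complex_of_real \<zeta>) (A \<zeta>) (dpi (- complex_of_real \<zeta>) (antipode u)))
    / (2 * (- complex_of_real \<zeta>)) ^ half_dim TYPE('n)"
  using super_adjoint_dpi[of "- \<zeta>" u] assms by (simp add: pairing_nz_def)

lemma pairing_nz_linear:
  fixes A :: "real \<Rightarrow> 'n::{finite,linorder} hmat"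
  assumes "\<zeta> \<noteq> 0"
  shows "pairing_nz A (u + v) \<zeta> = pairing_nz A u \<zeta> + pairing_nz A v \<zeta>"
    and "pairing_nz A (r *\<^sub>R u) \<zeta> = r * pairing_nz A u \<zeta>"
    and "pairing_nz A 0 \<zeta> = 0"
    and "pairing_nz A (zgen * u) \<zeta> = \<i> * \<zeta> * pairing_nz A u \<zeta>"
proof -
  have "antipode (zgen * u) = - (zgen * antipode u)"
  proof (induction u rule: salg_induct)
    case (1 b)
    then show ?case by (cases b) (simp add: zgen_basis antipode_def)
  qed (simp_all add: distrib_left antipode_add antipode_scale antipode_zero)
  then have z: "dpi \<eta> (antipode (zgen * u)) = hscale (- \<i> * \<eta>) (dpi \<eta> (antipode u))" for \<eta>
    using dpi_zgen_power[of \<eta> 1 "antipode u"]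
    by (simp add: linear_neg[OF linear_dpi] hscale_minus_one[symmetric])
  show "pairing_nz A (u + v) \<zeta> = pairing_nz A u \<zeta> + pairing_nz A v \<zeta>"
    "pairing_nz A (r *\<^sub>R u) \<zeta> = r * pairing_nz A u \<zeta>"
    "pairing_nz A 0 \<zeta> = 0"
    "pairing_nz A (zgen * u) \<zeta> = \<i> * \<zeta> * pairing_nz A u \<zeta>"
    unfolding pairing_nz_eq[OF assms] z
    by (simp_all only: antipode_add antipode_scale antipode_zero dpi_add dpi_scale dpi_zero hmul_add hmul_zero scaleR_hmat hmul_scale
        Tfun_linear add_divide_distrib) simp_all
qed

text \<open>The constant by which \<open>A(u; \<zeta>)\<close>, for \<open>u\<close> of parity \<open>p\<close> and \<open>A\<close> the transform of \<open>F\<close>, differs from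
  the classical transform of \<open>F(u; x)\<close>.\<close>

definition kappa :: "'n::finite itself \<Rightarrow> bool \<Rightarrow> complex" where
  "kappa _ p = (if even CARD('n) then 1 else if p then - \<i> else \<i>)"

text \<open>The exponent is |K| (n + 1 - |K|): even if n is even, and of the parity of |K| if n is
  odd.\<close>

lemma kappa_eq:
  fixes K :: "'n::{finite,linorder} set"
  shows "complex_of_real ((- 1) ^ card K * ((- 1) ^ (card K * card (- K)))) * Tsign TYPE('n) = kappa TYPE('n) (odd (card K))"
proof -
  have n: "CARD('n) = card K + card (- K)"
    using card_Un_disjoint[of K "- K"] by simp
  show ?thesis
    unfolding kappa_def Tsign_def n by (auto simp: minus_one_power_iff)
qed

text \<open>Of the sum over I only the term I = \<open>gens m\<close> survives. T of the top element
  cancels the normalizing power of -2\<zeta>, and the remaining signs combine to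
  \<open>kappa\<close>.\<close>

lemma pairing_nz_fourier_basis:
  fixes F :: "'n::{finite,linorder} uhc \<Rightarrow> real \<Rightarrow> complex"
  assumes "\<zeta> \<noteq> 0"
  shows "pairing_nz (fourier F) (basis_elt m) \<zeta>
    = kappa TYPE('n) (bodd m) * ((\<i> * \<zeta>) ^ zdeg m * ft (F (basis_elt (Mon 0 (gens m)))) \<zeta>)"
proof -
  let ?\<eta> = "- complex_of_real \<zeta>" and ?K = "gens m"
  let ?s = "\<lambda>I :: 'n set. complex_of_real (bsgn (Mon 0 I) (Mon 0 (- I)))"
  let ?f = "\<lambda>I. ft (F (basis_elt (Mon 0 I))) \<zeta>"
  let ?P = "(2 * ?\<eta>) ^ half_dim TYPE('n)"
  have \<eta>: "?\<eta> \<noteq> 0" using assms by simp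
  have "Tfun ?\<eta> (hmul ?\<eta> (fourier F \<zeta>) (dpi ?\<eta> (antipode (basis_elt m))))
    = (\<Sum>I\<in>UNIV. if I = ?K then ?s I * ?f I * (complex_of_real ((- 1) ^ card ?K * bsgn (Mon 0 (- ?K)) m)
        * (- \<i> * ?\<eta>) ^ zdeg m * (?P * Tsign TYPE('n))) else 0)"
    unfolding fourier_eq hmul_sum_left Tfun_sum hmul_scale Tfun_linear Tfun_dpi_pair[OF \<eta>]
    by (intro sum.cong refl) simp
  also have "\<dots> = ?s ?K * ?f ?K * (complex_of_real ((- 1) ^ card ?K * bsgn (Mon 0 (- ?K)) m)
        * (- \<i> * ?\<eta>) ^ zdeg m * (?P * Tsign TYPE('n)))"
    by simp
  also have "\<dots> = (complex_of_real ((- 1) ^ card ?K * (bsgn (Mon 0 ?K) (Mon 0 (- ?K)) * bsgn (Mon 0 (- ?K)) m)) * Tsign TYPE('n))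
      * ((\<i> * \<zeta>) ^ zdeg m * ?f ?K) * ?P"
    by simp
  also have "bsgn (Mon 0 ?K) (Mon 0 (- ?K)) * bsgn (Mon 0 (- ?K)) m = (- 1) ^ (card ?K * card (- ?K))"
    using bsgn_flip[of ?K "zdeg m"] by simp
  finally show ?thesis
    unfolding pairing_nz_eq[OF assms] kappa_eq using \<eta> by (simp add: bodd_mon_def)
qed

text \<open>\<open>dim\<close> counts over the reals, so a complex 2^k by 2^k matrix contributes 2
  times 4^k. There is one such component for n = 2k and two for n = 2k + 1; either way the total is
  that of one complex coefficient per subset of the indices.\<close>

lemma dim_hspace: "dim (hspace :: 'n::{finite,linorder} hmat set) = DIM(complex ^ 'n set)"
proof (cases "even CARD('n)")
  case True
  have "(hspace :: 'n hmat set) = range (\<lambda>A. (A, 0))"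
    using True by (auto simp: hspace_def prod_eq_iff)
  moreover have "dim (range (\<lambda>A :: 'n cmat. (A, 0 :: 'n cmat))) = dim (UNIV :: 'n cmat set)"
    by (rule dim_image_eq) (auto intro!: linearI inj_onI)
  ultimately have "dim (hspace :: 'n hmat set) = 2 ^ (CARD('n) div 2) * (2 ^ (CARD('n) div 2) * 2)"
    by (simp add: card_spin)
  also have "\<dots> = 2 ^ (2 * (CARD('n) div 2) + 1)" by (simp add: power_add mult_2)
  also have "2 * (CARD('n) div 2) = CARD('n)" using True by simp
  finally show ?thesis by (simp add: card_UNIV_set)
next
  case False
  have "dim (hspace :: 'n hmat set) = DIM('n hmat)"
    using False by (simp add: hspace_def)
  also have "\<dots> = 2 ^ ((2 * (CARD('n) div 2) + 1) + 1)" by (simp add: card_spin power_add mult_2)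
  also have "2 * (CARD('n) div 2) + 1 = CARD('n)" using False by simp
  finally show ?thesis by (simp add: card_UNIV_set)
qed

lemma hspace_sum: "(\<And>x. x \<in> A \<Longrightarrow> f x \<in> hspace) \<Longrightarrow> sum f A \<in> hspace"
  by (induction A rule: infinite_finite_induct) (auto intro: hspace_closed)

text \<open>The elements \<open>d\<pi>(a_I)\<close> are dual to each other under \<open>T\<close>, hence linearly independent, and by
  dimension they span \<open>\<H>\<close>.\<close>

lemma Tfun_nondegenerate:
  fixes X :: "'n::{finite,linorder} hmat"
  assumes "\<eta> \<noteq> 0" "X \<in> hspace"
    and T: "\<And>K. Tfun \<eta> (hmul \<eta> X (dpi \<eta> (antipode (basis_elt (Mon 0 K))))) = 0"
  shows "X = 0"
proof -
  \<comment> \<open>The coefficient with index I belongs to the complementary product, so that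
    pairing with a_K reads off \<open>c $ K\<close>.\<close>
  define L :: "complex ^ 'n set \<Rightarrow> 'n hmat" where
    "L c = (\<Sum>I\<in>UNIV. hscale (c $ I) (dpi \<eta> (basis_elt (Mon 0 (- I)))))" for c
  have lin: "linear L"
    by (rule linearI) (simp_all add: L_def hscale_add_left sum.distrib scaleR_hmat hscale_sum scaleR_conv_of_real[where 'a = complex])
  have dual: "\<exists>d. d \<noteq> 0 \<and> (\<forall>c. Tfun \<eta> (hmul \<eta> (L c) (dpi \<eta> (antipode (basis_elt (Mon 0 K))))) = c $ K * d)" for K
  proof -
    let ?d = "complex_of_real ((- 1) ^ card K * bsgn (Mon 0 (- K)) (Mon 0 K)) * ((2 * \<eta>) ^ half_dim TYPE('n) * Tsign TYPE('n))"
    have "bsgn (Mon 0 (- K)) (Mon 0 K) \<noteq> 0" using bsgn_flip[of K 0] by auto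
    then have "?d \<noteq> 0" using assms(1) by (simp add: Tsign_def)
    moreover have "Tfun \<eta> (hmul \<eta> (L c) (dpi \<eta> (antipode (basis_elt (Mon 0 K))))) = c $ K * ?d" for c
    proof -
      have "Tfun \<eta> (hmul \<eta> (L c) (dpi \<eta> (antipode (basis_elt (Mon 0 K))))) = (\<Sum>I\<in>UNIV. if I = K then c $ I * ?d else 0)"
        unfolding L_def hmul_sum_left Tfun_sum hmul_scale Tfun_linear Tfun_dpi_pair[OF assms(1)]
        by (intro sum.cong refl) simp
      then show ?thesis by simp
    qed
    ultimately show ?thesis by blast
  qed
  have inj: "c = 0" if "\<And>K. Tfun \<eta> (hmul \<eta> (L c) (dpi \<eta> (antipode (basis_elt (Mon 0 K))))) = 0" for c
    unfolding vec_eq_iff zero_index using that dual by (metis mult_eq_0_iff)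
  have "inj L"
    using inj by (intro linear_injective_0[OF lin, THEN iffD2]) (simp add: Tfun_linear)
  then have "dim (range L) = dim (UNIV :: (complex ^ 'n set) set)"
    by (intro dim_image_eq lin) simp
  then have "dim (range L) = dim (hspace :: 'n hmat set)"
    by (simp only: dim_hspace dim_UNIV)
  moreover have "range L \<subseteq> hspace"
  proof -
    have "L c \<in> hspace" for c
      unfolding L_def using hspace_closed dpi_hspace by (intro hspace_sum) blast
    then show ?thesis by blast
  qed
  moreover have "subspace (hspace :: 'n hmat set)"
    by (auto simp: subspace_def hspace_def)
  ultimately have "range L = hspace"
    using subspace_dim_equal[of "range L" hspace] linear_subspace_image[OF lin subspace_UNIV] by simp
  then obtain c where "X = L c" using assms(2) by blast
  with inj T show ?thesis by (metis linear_0[OF lin])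
qed

section \<open>Schwartz functions on the supergroup\<close>

lemma Cinf_linear:
  assumes "F \<in> Cinf_HC"
  shows "F (u + v) x = F u x + F v x" "F (r *\<^sub>R u) x = complex_of_real r * F u x" "F 0 x = 0"
proof -
  have l: "linear (\<lambda>u. F u x)" using assms by (simp add: Cinf_HC_def)
  show "F (u + v) x = F u x + F v x" "F (r *\<^sub>R u) x = complex_of_real r * F u x" "F 0 x = 0"
    using linear_add[OF l] linear_scale[OF l] linear_0[OF l] by (simp_all add: scaleR_conv_of_real)
qed

lemma Cinf_nth_deriv:
  assumes "F \<in> Cinf_HC"
  shows "nth_deriv k (F u) = F (zgen ^ k * u)"
proof -
  let ?G = "\<lambda>k. F (zgen ^ k * u)"
  have "(?G k has_vector_derivative ?G (Suc k) x) (at x)" for k x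
  proof -
    have "smooth (?G k)" using assms by (simp add: Cinf_HC_def)
    from smooth_nth_deriv[OF this, of 0] have "(?G k has_vector_derivative vector_derivative (?G k) (at x)) (at x)"
      by (simp add: nth_deriv_Suc)
    then show ?thesis using assms by (simp add: Cinf_HC_def mult.assoc)
  qed
  from nth_derivI(1)[of ?G, OF this] show ?thesis by simp
qed

text \<open>The antipode preserves parity, so at v = 1 only the terms with q = p remain in the
  double sum.\<close>

lemma Lact_one:
  fixes F :: "'n::{finite,linorder} uhc \<Rightarrow> real \<Rightarrow> complex"
  assumes "F \<in> Cinf_HC"
  shows "Lact u F 1 x = F (antipode (parity_part False u)) x - F (antipode (parity_part True u)) x"
proof -
  have "parity_part q (antipode (parity_part p u)) = (if p = q then antipode (parity_part p u) else 0)" for p q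
  proof -
    have "homogeneous p (parity_part p u)" by (simp add: homogeneous_def parity_part_parity_part)
    then have "homogeneous p (antipode (parity_part p u))" by (rule antipode_props(5))
    then show ?thesis using parity_part_parity_part[of q p "antipode (parity_part p u)"]
      by (auto simp: homogeneous_def)
  qed
  then show ?thesis by (simp add: Lact_def UNIV_bool Cinf_linear[OF assms])
qed

lemma norm_Lact_basis:
  assumes "F \<in> Cinf_HC"
  shows "norm (Lact (basis_elt m) F 1 x) = norm (F (basis_elt m) x)"
proof -
  have "antipode (basis_elt m) = ((- 1) ^ (zdeg m + card (gens m))) *\<^sub>R basis_elt m"
    by (simp add: antipode_def)
  then show ?thesis
    unfolding Lact_one[OF assms]
    by (auto simp: parity_part_basis antipode_zero Cinf_linear[OF assms] norm_mult norm_power)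
qed

lemma schwartz_HC_Cinf: "F \<in> schwartz_HC \<Longrightarrow> F \<in> Cinf_HC"
  by (simp add: schwartz_HC_def)

text \<open>Differentiation is multiplication by z, so decay of the derivatives of
  \<open>F u\<close> is decay of the values at z^k u. Hence it suffices to bound x^j F(u; x) for all
  u, and by linearity for basis elements, where \<open>Lact\<close> agrees with \<open>F\<close> up
  to sign.\<close>

lemma schwartz_HC_schwartz:
  assumes "F \<in> schwartz_HC"
  shows "schwartz (F u)"
proof -
  note F = schwartz_HC_Cinf[OF assms]
  have bound: "\<exists>C. \<forall>x. norm (complex_of_real x ^ j * F u x) \<le> C" for j u
  proof (induction u rule: salg_induct)
    case (1 m)
    have "bdd_above (range (\<lambda>x. norm (complex_of_real x ^ j * Lact (basis_elt m) F 1 x)))"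
      using assms by (simp add: schwartz_HC_def)
    then show ?case by (auto simp: bdd_above_def norm_mult norm_Lact_basis[OF F])
  next
    case (3 u v)
    then obtain C D where "\<forall>x. norm (complex_of_real x ^ j * F u x) \<le> C" "\<forall>x. norm (complex_of_real x ^ j * F v x) \<le> D"
      by blast
    then have "\<forall>x. norm (complex_of_real x ^ j * F (u + v) x) \<le> C + D"
      by (auto simp: Cinf_linear[OF F] distrib_left intro!: norm_triangle_mono)
    then show ?case by blast
  next
    case (4 r u)
    then obtain C where C: "\<forall>x. norm (complex_of_real x ^ j * F u x) \<le> C" by blast
    have "norm (complex_of_real x ^ j * F (r *\<^sub>R u) x) \<le> \<bar>r\<bar> * C" for x
    proof -
      have "complex_of_real x ^ j * F (r *\<^sub>R u) x = r * (complex_of_real x ^ j * F u x)"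
        by (simp add: Cinf_linear[OF F])
      then show ?thesis using C by (simp only: norm_mult[of "complex_of_real r"]) (simp add: mult_left_mono)
    qed
    then show ?case by blast
  qed (auto simp: Cinf_linear[OF F])
  show ?thesis
    unfolding schwartz_def Cinf_nth_deriv[OF F] using F bound by (simp add: Cinf_HC_def)
qed

lemma schwartz_HCI:
  assumes F: "F \<in> Cinf_HC" and "\<And>u. schwartz (F u)"
  shows "F \<in> schwartz_HC"
proof -
  have "bdd_above (range (\<lambda>x. norm (complex_of_real x ^ j * Lact u F 1 x)))" for j u
  proof -
    have "schwartz (\<lambda>x. 1 * F (antipode (parity_part False u)) x + (- 1) * F (antipode (parity_part True u)) x)"
      by (intro schwartz_linear assms)
    then have "schwartz (\<lambda>x. Lact u F 1 x)" by (simp add: Lact_one[OF F])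
    from schwartz_bound[OF this, of j 0] show ?thesis by (auto simp: bdd_above_def)
  qed
  with F show ?thesis by (simp add: schwartz_HC_def)
qed

lemma schwartz_HC_linear:
  fixes c d :: complex
  assumes "F \<in> schwartz_HC" "G \<in> schwartz_HC"
  shows "(\<lambda>u x. c * F u x + d * G u x) \<in> schwartz_HC"
proof (rule schwartz_HCI)
  note F = schwartz_HC_Cinf[OF assms(1)] and G = schwartz_HC_Cinf[OF assms(2)]
  note S = schwartz_HC_schwartz[OF assms(1)] schwartz_HC_schwartz[OF assms(2)]
  show "schwartz (\<lambda>x. c * F u x + d * G u x)" for u
    by (intro schwartz_linear S)
  show "(\<lambda>u x. c * F u x + d * G u x) \<in> Cinf_HC"
    unfolding Cinf_HC_def
  proof (intro CollectI conjI allI)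
    show "linear (\<lambda>u. c * F u x + d * G u x)" for x
      by (rule linearI) (simp_all add: Cinf_linear[OF F] Cinf_linear[OF G] algebra_simps scaleR_conv_of_real[where 'a = complex])
    fix u x
    show "smooth (\<lambda>x. c * F u x + d * G u x)"
      by (intro schwartz_smooth schwartz_linear S)
    have "nth_deriv 1 (\<lambda>x. c * F u x + d * G u x) x = c * F (zgen * u) x + d * G (zgen * u) x"
      by (subst nth_deriv_linear) (simp_all add: S schwartz_smooth Cinf_nth_deriv[OF F] Cinf_nth_deriv[OF G])
    then show "c * F (zgen * u) x + d * G (zgen * u) x = vector_derivative (\<lambda>x. c * F u x + d * G u x) (at x)"
      by (simp add: nth_deriv_Suc)
  qed
qed

lemma schwartz_HC_diff:
  assumes "F \<in> schwartz_HC" "G \<in> schwartz_HC"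
  shows "F - G \<in> schwartz_HC"
proof -
  have "F - G = (\<lambda>u x. 1 * F u x + (- 1) * G u x)" by (simp add: fun_eq_iff)
  then show ?thesis using schwartz_HC_linear[OF assms, of 1 "- 1"] by simp
qed

section \<open>The Fourier transform\<close>

lemma fourier_linear:
  assumes "F \<in> schwartz_HC" "G \<in> schwartz_HC"
  shows "fourier (\<lambda>u x. c * F u x + d * G u x) = (\<lambda>\<zeta>. hscale c (fourier F \<zeta>) + hscale d (fourier G \<zeta>))"
proof
  fix \<zeta>
  note S = schwartz_HC_schwartz[OF assms(1)] schwartz_HC_schwartz[OF assms(2)]
  show "fourier (\<lambda>u x. c * F u x + d * G u x) \<zeta> = hscale c (fourier F \<zeta>) + hscale d (fourier G \<zeta>)"
    unfolding fourier_eq ft_linear[OF S] hscale_sum sum.distrib[symmetric]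
    by (intro sum.cong refl) (simp add: hscale_add_left[symmetric] algebra_simps)
qed

lemma fourier_diff:
  assumes "F \<in> schwartz_HC" "G \<in> schwartz_HC"
  shows "fourier (F - G) = fourier F - fourier G"
proof -
  have "F - G = (\<lambda>u x. 1 * F u x + (- 1) * G u x)" by (simp add: fun_eq_iff)
  then have "fourier (F - G) = (\<lambda>\<zeta>. hscale 1 (fourier F \<zeta>) + hscale (- 1) (fourier G \<zeta>))"
    by (simp only: fourier_linear[OF assms])
  then show ?thesis by (simp add: fun_eq_iff hscale_minus_one)
qed

text \<open>The function whose classical transform is A(u; \<zeta>) for A the transform of F. The
  parity parts are separated because for odd n \<open>kappa\<close> differs between them.\<close>

definition twist :: "('n::{finite,linorder} uhc \<Rightarrow> real \<Rightarrow> complex) \<Rightarrow> 'n uhc \<Rightarrow> real \<Rightarrow> complex" where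
  "twist F u x = kappa TYPE('n) False * F (parity_part False u) x + kappa TYPE('n) True * F (parity_part True u) x"

lemma kappa_nonzero: "kappa T p \<noteq> 0" and norm_kappa: "norm (kappa T p) = 1"
  by (auto simp: kappa_def)

lemma schwartz_twist: "F \<in> schwartz_HC \<Longrightarrow> schwartz (twist F u)"
  unfolding twist_def[abs_def] by (intro schwartz_linear schwartz_HC_schwartz)

lemma twist_homogeneous:
  fixes F :: "'n::{finite,linorder} uhc \<Rightarrow> real \<Rightarrow> complex"
  assumes "F \<in> Cinf_HC" "homogeneous p u"
  shows "twist F u x = kappa TYPE('n) p * F u x"
proof -
  have "parity_part q u = (if q = p then u else 0)" for q
    using parity_part_parity_part[of q p u] assms(2) by (auto simp: homogeneous_def)
  then show ?thesis by (cases p) (simp_all add: twist_def Cinf_linear[OF assms(1)])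
qed

text \<open>The coefficients 1 and 0 bring the right-hand sides into the form to which
  \<open>ft_linear\<close> applies.\<close>

lemma twist_add:
  assumes "F \<in> Cinf_HC"
  shows "twist F (u + v) = (\<lambda>x. 1 * twist F u x + 1 * twist F v x)"
    "twist F (r *\<^sub>R u) = (\<lambda>x. complex_of_real r * twist F u x + 0 * twist F u x)"
    "twist F 0 = (\<lambda>x. 0)"
  by (simp_all add: fun_eq_iff twist_def parity_part_add parity_part_scale parity_part_zero Cinf_linear[OF assms] algebra_simps)

lemma pairing_nz_fourier:
  fixes F :: "'n::{finite,linorder} uhc \<Rightarrow> real \<Rightarrow> complex"
  assumes F: "F \<in> schwartz_HC" and \<zeta>: "\<zeta> \<noteq> 0"
  shows "pairing_nz (fourier F) u \<zeta> = ft (twist F u) \<zeta>"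
proof (induction u rule: salg_induct)
  case (1 m)
  note C = schwartz_HC_Cinf[OF F]
  have "twist F (basis_elt m) = (\<lambda>x. kappa TYPE('n) (bodd m) * F (basis_elt m) x + 0 * F (basis_elt m) x)"
    using twist_homogeneous[OF C homogeneous_basis] by (simp add: fun_eq_iff)
  then have "ft (twist F (basis_elt m)) \<zeta> = kappa TYPE('n) (bodd m) * ft (F (basis_elt m)) \<zeta>"
    by (simp only: ft_linear[OF schwartz_HC_schwartz[OF F] schwartz_HC_schwartz[OF F]]) simp
  also have "F (basis_elt m) = nth_deriv (zdeg m) (F (basis_elt (Mon 0 (gens m))))"
    using basis_Mon[of "zdeg m" "gens m"] by (simp add: Cinf_nth_deriv[OF C])
  also have "ft \<dots> \<zeta> = (\<i> * \<zeta>) ^ zdeg m * ft (F (basis_elt (Mon 0 (gens m)))) \<zeta>"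
    by (rule ft_nth_deriv[OF schwartz_HC_schwartz[OF F]])
  finally show ?case by (simp add: pairing_nz_fourier_basis[OF \<zeta>])
next
  case 2
  show ?case
    unfolding pairing_nz_linear[OF \<zeta>] twist_add[OF schwartz_HC_Cinf[OF F]] by (simp add: ft_def)
next
  case (3 u v)
  then show ?case
    unfolding pairing_nz_linear[OF \<zeta>] twist_add[OF schwartz_HC_Cinf[OF F]]
      ft_linear[OF schwartz_twist[OF F] schwartz_twist[OF F]] by simp
next
  case (4 r u)
  then show ?case
    unfolding pairing_nz_linear[OF \<zeta>] twist_add[OF schwartz_HC_Cinf[OF F]]
      ft_linear[OF schwartz_twist[OF F] schwartz_twist[OF F]] by simp
qed

lemma tendsto_eq_punctured:
  fixes f g :: "real \<Rightarrow> 'a::topological_space"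
  assumes "(g \<longlongrightarrow> l) (at 0)" "\<And>x. x \<noteq> 0 \<Longrightarrow> f x = g x"
  shows "(f \<longlongrightarrow> l) (at 0)"
  using assms(1) by (rule Lim_transform_within[where d = 1]) (use assms(2) in \<open>auto simp: dist_norm\<close>)

text \<open>This carries identities proved for \<zeta> \<noteq> 0 to \<zeta> = 0, where the algebra
  degenerates.\<close>

lemma isCont_eq_punctured:
  fixes f g :: "real \<Rightarrow> 'a::t2_space"
  assumes "isCont f 0" "isCont g 0" "\<And>x. x \<noteq> 0 \<Longrightarrow> f x = g x"
  shows "f = g"
proof
  fix x
  have "(f \<longlongrightarrow> g 0) (at 0)"
    using tendsto_eq_punctured[of g "g 0" f] assms(2,3) by (simp add: isCont_def)
  moreover have "(f \<longlongrightarrow> f 0) (at 0)" using assms(1) by (simp add: isCont_def)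
  ultimately have "f 0 = g 0" by (intro tendsto_unique[OF trivial_limit_at])
  with assms(3) show "f x = g x" by (cases "x = 0") auto
qed

lemma smooth_isCont: "smooth f \<Longrightarrow> isCont f x"
  using smooth_continuous[of f 0] by (simp add: continuous_on_eq_continuous_at)

text \<open>At \<zeta> = 0 \<open>pairing\<close> is a limit; it exists because the transform on the
  right is continuous.\<close>

lemma pairing_fourier:
  assumes F: "F \<in> schwartz_HC"
  shows "pairing (fourier F) u = ft (twist F u)"
proof
  fix \<zeta>
  have "isCont (ft (twist F u)) 0"
    by (intro smooth_isCont smooth_ft schwartz_twist F)
  then have "(pairing_nz (fourier F) u \<longlongrightarrow> ft (twist F u) 0) (at 0)"
    using tendsto_eq_punctured[of "ft (twist F u)" "ft (twist F u) 0" "pairing_nz (fourier F) u"]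
      pairing_nz_fourier[OF F, of _ u] by (simp add: isCont_def)
  then have "Lim (at 0) (pairing_nz (fourier F) u) = ft (twist F u) 0"
    by (rule tendsto_Lim[OF trivial_limit_at])
  then show "pairing (fourier F) u \<zeta> = ft (twist F u) \<zeta>"
    by (simp add: pairing_def pairing_nz_fourier[OF F])
qed

lemma continuous_on_nth:
  fixes f :: "'a::topological_space \<Rightarrow> 'b::real_normed_vector ^ 'c::finite"
  shows "continuous_on S f \<Longrightarrow> continuous_on S (\<lambda>x. f x $ i)"
  by (rule bounded_linear.continuous_on[OF bounded_linear_vec_nth])

lemma continuous_on_hscale:
  "continuous_on S g \<Longrightarrow> continuous_on S X \<Longrightarrow> continuous_on S (\<lambda>x. hscale (g x) (X x))"
  unfolding hscale_def cscale_def
  by (intro continuous_on_Pair continuous_on_vec_lambda continuous_on_mult continuous_on_nth continuous_on_fst continuous_on_snd)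

lemma continuous_on_hmul:
  "continuous_on S z \<Longrightarrow> continuous_on S X \<Longrightarrow> continuous_on S Y \<Longrightarrow> continuous_on S (\<lambda>x. hmul (z x) (X x) (Y x))"
  unfolding hmul_def cscale_def matrix_matrix_mult_def
  by (intro continuous_on_Pair continuous_on_vec_lambda continuous_on_mult continuous_on_nth continuous_on_fst continuous_on_snd
      continuous_on_add continuous_on_sum)

lemma continuous_on_cgen_pos: "continuous_on UNIV (\<lambda>\<zeta>. cgen_pos \<zeta> j :: 'n::finite hmat)"
proof (cases "even CARD('n)")
  case True
  have "continuous_on UNIV (\<lambda>\<zeta>. spin_factor \<zeta> j p a b)" for p a b
    by (cases a; cases b; cases "p < (j + 1) div 2"; cases "p = (j + 1) div 2"; cases "odd j")
      (simp_all add: spin_factor_def mat2_defs continuous_on_mult continuous_on_id)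
  then have "continuous_on UNIV (\<lambda>\<zeta>. (spin_gen \<zeta> j, 0) :: 'n hmat)"
    unfolding spin_gen_factor tensor_mat_def
    by (intro continuous_on_Pair continuous_on_vec_lambda continuous_on_prod continuous_on_const)
  then show ?thesis using True by (simp add: cgen_pos_def)
qed (simp add: cgen_pos_def)

text \<open>Both the generators and the product itself depend on \<zeta>, so the induction over the
  factors uses continuity of \<open>hmul\<close> in all arguments, the parameter included.\<close>

lemma continuous_on_dpi_basis: "continuous_on UNIV (\<lambda>\<zeta>. dpi \<zeta> (basis_elt m))"
proof -
  have "continuous_on UNIV (\<lambda>\<zeta>. foldr (hmul \<zeta>) (map (dpi_gen \<zeta>) xs) hone)" for xs :: "'a list"
  proof (induction xs)
    case (Cons i xs)
    then show ?case
      unfolding cgen_eq by (auto intro!: continuous_on_hmul continuous_on_hscale continuous_on_cgen_pos continuous_intros)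
  qed simp
  then show ?thesis
    unfolding dpi_basis by (intro continuous_on_hscale continuous_intros)
qed

lemma isCont_fourier:
  assumes F: "F \<in> schwartz_HC"
  shows "isCont (fourier F) \<zeta>"
proof -
  have "continuous_on UNIV (\<lambda>\<zeta>. dpi (- complex_of_real \<zeta>) (basis_elt m))" for m :: "'a mon"
    by (rule continuous_on_compose2[OF continuous_on_dpi_basis]) (auto intro!: continuous_intros)
  moreover have "continuous_on UNIV (ft (F u))" for u
    using smooth_continuous[OF smooth_ft[OF schwartz_HC_schwartz[OF F]], of 0] by simp
  ultimately have "continuous_on UNIV (\<lambda>\<zeta>. fourier F \<zeta>)"
    unfolding fourier_eq by (intro continuous_on_sum continuous_on_hscale continuous_intros)
  then show ?thesis by (simp add: continuous_on_eq_continuous_at)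
qed

lemma fourier_hspace: "fourier F \<zeta> \<in> hspace"
  unfolding fourier_eq by (intro hspace_sum hspace_closed dpi_hspace)

lemma fourier_schwartz_RH:
  assumes F: "F \<in> schwartz_HC"
  shows "fourier F \<in> schwartz_RH"
proof -
  have S: "schwartz (pairing (fourier F) u)" for u
    unfolding pairing_fourier[OF F] by (intro schwartz_ft schwartz_twist F)
  have "bdd_above (range (\<lambda>\<zeta>. norm (nth_deriv k (pairing (fourier F) u) \<zeta>)))" for k u
    using schwartz_bound[OF S[of u], of 0 k] by (auto simp: bdd_above_def)
  with S show ?thesis
    unfolding schwartz_RH_def by (simp add: fourier_hspace isCont_fourier[OF F] schwartz_smooth)
qed

lemma ft_inject:
  assumes "schwartz f" "schwartz g" "ft f = ft g"
  shows "f = g"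
proof -
  have "f = ift (ft f)" by (rule ift_ft[OF assms(1), symmetric])
  also have "\<dots> = ift (ft g)" by (simp only: assms(3))
  also have "\<dots> = g" by (rule ift_ft[OF assms(2)])
  finally show ?thesis .
qed

text \<open>Equal transforms have equal pairings, so the twisted functions agree by classical
  injectivity. Basis elements are homogeneous, and there the nonzero \<open>kappa\<close>
  cancels.\<close>

lemma fourier_inject:
  assumes F: "F \<in> schwartz_HC" and G: "G \<in> schwartz_HC" and eq: "fourier F = fourier G"
  shows "F = G"
proof (intro ext)
  fix u x
  have t: "twist F u = twist G u" for u
    by (rule ft_inject[OF schwartz_twist[OF F] schwartz_twist[OF G]])
      (simp only: pairing_fourier[OF F, symmetric] pairing_fourier[OF G, symmetric] eq)
  show "F u x = G u x"
  proof (induction u rule: salg_induct)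
    case (1 m)
    show ?case
      using fun_cong[OF t[of "basis_elt m"], of x]
      by (simp add: kappa_nonzero twist_homogeneous[OF _ homogeneous_basis] schwartz_HC_Cinf F G)
  qed (simp_all add: Cinf_linear schwartz_HC_Cinf F G)
qed

section \<open>Surjectivity\<close>

lemma schwartz_RH_continuous:
  assumes "A \<in> schwartz_RH"
  shows "smooth (pairing A u)" "isCont (pairing A u) \<zeta>"
  using assms smooth_isCont by (auto simp: schwartz_RH_def)

text \<open>For \<zeta> \<noteq> 0 these are \<open>pairing_nz_linear\<close>; membership in
  \<open>schwartz_RH\<close> makes every \<open>pairing A u\<close> continuous, which settles
  \<zeta> = 0.\<close>

lemma pairing_linear:
  assumes A: "A \<in> schwartz_RH"
  shows "pairing A (u + v) = (\<lambda>\<zeta>. pairing A u \<zeta> + pairing A v \<zeta>)"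
    and "pairing A (r *\<^sub>R u) = (\<lambda>\<zeta>. complex_of_real r * pairing A u \<zeta>)"
    and "pairing A 0 = (\<lambda>\<zeta>. 0)"
    and "pairing A (zgen * u) = (\<lambda>\<zeta>. \<i> * complex_of_real \<zeta> * pairing A u \<zeta>)"
  by (rule isCont_eq_punctured; (intro continuous_intros schwartz_RH_continuous A)?; simp add: pairing_def pairing_nz_linear)+

lemma pairing_zgen_power:
  assumes A: "A \<in> schwartz_RH"
  shows "pairing A (zgen ^ j * u) \<zeta> = (\<i> * complex_of_real \<zeta>) ^ j * pairing A u \<zeta>"
  by (induction j) (simp_all add: pairing_linear[OF A] mult.assoc)

lemma nth_deriv_cmult:
  assumes "smooth f"
  shows "nth_deriv k (\<lambda>x. c * f x) = (\<lambda>x. c * nth_deriv k f x)" "smooth (\<lambda>x. c * f x)"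
  using nth_deriv_linear[OF assms assms, where a = c and b = 0] by simp_all

text \<open>Membership in \<open>schwartz_RH\<close> bounds derivatives without weights, but for all
  u: replacing u by z^j u inserts \<zeta>^j up to a power of i.\<close>

lemma schwartz_pairing:
  assumes A: "A \<in> schwartz_RH"
  shows "schwartz (pairing A u)"
proof (rule schwartzI_bounded_derivs)
  fix j
  have eq: "(\<lambda>\<zeta>. complex_of_real \<zeta> ^ j * pairing A u \<zeta>) = (\<lambda>\<zeta>. (- \<i>) ^ j * pairing A (zgen ^ j * u) \<zeta>)"
  proof
    fix \<zeta>
    have "(- \<i>) ^ j * (\<i> * complex_of_real \<zeta>) ^ j = complex_of_real \<zeta> ^ j"
      by (simp add: power_mult_distrib[symmetric])
    then show "complex_of_real \<zeta> ^ j * pairing A u \<zeta> = (- \<i>) ^ j * pairing A (zgen ^ j * u) \<zeta>"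
      by (simp only: pairing_zgen_power[OF A] mult.assoc[symmetric])
  qed
  note s = schwartz_RH_continuous(1)[OF A]
  show "smooth (\<lambda>\<zeta>. complex_of_real \<zeta> ^ j * pairing A u \<zeta>)"
    unfolding eq by (rule nth_deriv_cmult(2)[OF s])
  fix k
  have "bdd_above (range (\<lambda>\<zeta>. norm (nth_deriv k (pairing A (zgen ^ j * u)) \<zeta>)))"
    using A by (simp add: schwartz_RH_def)
  then show "\<exists>C. \<forall>\<zeta>. norm (nth_deriv k (\<lambda>\<zeta>. complex_of_real \<zeta> ^ j * pairing A u \<zeta>) \<zeta>) \<le> C"
    unfolding eq nth_deriv_cmult(1)[OF s] by (auto simp: bdd_above_def norm_mult norm_power)
qed

lemma parity_part_zgen: "parity_part p (zgen * u) = zgen * parity_part p u"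
proof (induction u rule: salg_induct)
  case (1 b)
  then show ?case by (cases b) (simp add: zgen_basis parity_part_basis bodd_mon_def)
qed (simp_all add: parity_part_zero parity_part_add parity_part_scale distrib_left)

definition untwist :: "('n::{finite,linorder} uhc \<Rightarrow> real \<Rightarrow> complex) \<Rightarrow> 'n uhc \<Rightarrow> real \<Rightarrow> complex" where
  "untwist F u x = inverse (kappa TYPE('n) False) * F (parity_part False u) x
    + inverse (kappa TYPE('n) True) * F (parity_part True u) x"

text \<open>The candidate preimage of A. The inverse transforms of the A(u; \<zeta>) satisfy F(z u)
  = F(u)' since z acts by i\<zeta>, and dividing by \<open>kappa\<close> on each parity makes the
  twist reproduce them.\<close>

lemma
  fixes A :: "real \<Rightarrow> 'n::{finite,linorder} hmat"
  assumes A: "A \<in> schwartz_RH"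
  defines "F \<equiv> untwist (\<lambda>u. ift (pairing A u))"
  shows untwist_schwartz_HC: "F \<in> schwartz_HC"
    and twist_untwist: "twist F u = ift (pairing A u)"
proof -
  note S = schwartz_pairing[OF A]
  have lin: "ift (pairing A (u + v)) x = ift (pairing A u) x + ift (pairing A v) x"
    "ift (pairing A (r *\<^sub>R u)) x = complex_of_real r * ift (pairing A u) x"
    "ift (pairing A 0) x = 0" for u v r x
    using ift_linear[OF S[of u] S[of v], of 1 1 x] ift_linear[OF S[of u] S[of u], of r 0 x]
    by (simp_all add: pairing_linear[OF A] ift_def ft_def)
  have SF: "schwartz (F u)" for u
    unfolding F_def untwist_def[abs_def] by (intro schwartz_linear schwartz_ift S)
  have "F \<in> Cinf_HC"
    unfolding Cinf_HC_def
  proof (intro CollectI conjI allI)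
    show "linear (\<lambda>u. F u x)" for x
      by (rule linearI) (simp_all add: F_def untwist_def parity_part_add parity_part_scale lin algebra_simps
          scaleR_conv_of_real[where 'a = complex])
    show "smooth (F u)" for u by (rule schwartz_smooth[OF SF])
    fix u x
    have d: "nth_deriv 1 (ift (pairing A v)) x = ift (pairing A (zgen * v)) x" for v
      by (simp only: pairing_linear[OF A] ift_times_ident[OF S])
    have "nth_deriv 1 (F u) x = F (zgen * u) x"
      unfolding F_def untwist_def[abs_def]
      by (simp only: nth_deriv_linear(1)[OF schwartz_smooth[OF schwartz_ift[OF S]] schwartz_smooth[OF schwartz_ift[OF S]]]
          d parity_part_zgen)
    then show "F (zgen * u) x = vector_derivative (F u) (at x)"
      by (simp add: nth_deriv_Suc)
  qed
  then show "F \<in> schwartz_HC" using SF by (rule schwartz_HCI)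
  show "twist F u = ift (pairing A u)"
  proof
    fix x
    have "twist F u x = ift (pairing A (parity_part False u)) x + ift (pairing A (parity_part True u)) x"
      by (simp add: twist_def F_def untwist_def parity_part_parity_part lin kappa_nonzero mult.assoc[symmetric])
    also have "\<dots> = ift (pairing A u) x"
      unfolding lin(1)[symmetric] parity_part_sum[symmetric] ..
    finally show "twist F u x = ift (pairing A u) x" .
  qed
qed

lemma fourier_surj:
  fixes A :: "real \<Rightarrow> 'n::{finite,linorder} hmat"
  assumes A: "A \<in> schwartz_RH"
  shows "\<exists>F\<in>schwartz_HC. fourier F = A"
proof
  let ?F = "untwist (\<lambda>u. ift (pairing A u))"
  show F: "?F \<in> schwartz_HC" by (rule untwist_schwartz_HC[OF A])
  have p: "pairing (fourier ?F) u = pairing A u" for u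
    unfolding pairing_fourier[OF F] twist_untwist[OF A] by (rule ft_ift[OF schwartz_pairing[OF A]])
  show "fourier ?F = A"
  proof (rule isCont_eq_punctured)
    show "isCont (fourier ?F) 0" by (rule isCont_fourier[OF F])
    show "isCont A 0" using A by (simp add: schwartz_RH_def)
    fix \<zeta> :: real assume \<zeta>: "\<zeta> \<noteq> 0"
    let ?\<eta> = "- complex_of_real \<zeta>"
    let ?X = "fourier ?F \<zeta> + hscale (- 1) (A \<zeta>)"
    have "?X = 0"
    proof (rule Tfun_nondegenerate)
      show \<eta>: "?\<eta> \<noteq> 0" using \<zeta> by simp
      show "?X \<in> hspace"
        using A by (intro hspace_closed fourier_hspace) (simp add: schwartz_RH_def)
      fix K :: "'n set"
      let ?u = "basis_elt (Mon 0 K) :: 'n uhc"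
      have "pairing_nz (fourier ?F) ?u \<zeta> = pairing_nz A ?u \<zeta>"
        using fun_cong[OF p[of ?u], of \<zeta>] \<zeta> by (simp add: pairing_def)
      then show "Tfun ?\<eta> (hmul ?\<eta> ?X (dpi ?\<eta> (antipode ?u))) = 0"
        using \<eta> unfolding pairing_nz_eq[OF \<zeta>] by (simp add: hmul_add Tfun_linear)
    qed
    then show "fourier ?F \<zeta> = A \<zeta>" by (simp add: hscale_minus_one)
  qed
qed

section \<open>Continuity\<close>

text \<open>Basic neighbourhoods involve finitely many seminorms, so treating one target seminorm at
  a time is enough: unite the sets and take the smaller radius. In both applications
  \<open>T g - T f\<close> is the image of a difference.\<close>

lemma continuous_map_seminormI:
  fixes T :: "'a::minus \<Rightarrow> 'b::minus"
  assumes T: "\<And>f. f \<in> X \<Longrightarrow> T f \<in> Y"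
    and bound: "\<And>q e. q \<in> P' \<Longrightarrow> 0 < e \<Longrightarrow> \<exists>Q d. finite Q \<and> Q \<subseteq> P \<and> 0 < d \<and>
      (\<forall>f\<in>X. \<forall>g\<in>X. (\<forall>p\<in>Q. p (g - f) < d) \<longrightarrow> q (T g - T f) < e)"
  shows "continuous_map (seminorm_topology X P) (seminorm_topology Y P') T"
  unfolding continuous_map_def topspace_seminorm_topology
proof (intro conjI allI impI)
  show "T \<in> X \<rightarrow> Y" using T by auto
  fix U assume "openin (seminorm_topology Y P') U"
  then have U: "\<And>f. f \<in> U \<Longrightarrow> \<exists>Q e. finite Q \<and> Q \<subseteq> P' \<and> 0 < e \<and> {g \<in> Y. \<forall>p\<in>Q. p (g - f) < e} \<subseteq> U"
    unfolding openin_seminorm_topology by blast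
  have multi: "\<exists>Q d. finite Q \<and> Q \<subseteq> P \<and> 0 < d \<and>
      (\<forall>f\<in>X. \<forall>g\<in>X. (\<forall>p\<in>Q. p (g - f) < d) \<longrightarrow> (\<forall>q\<in>Q'. q (T g - T f) < e))"
    if "finite Q'" "Q' \<subseteq> P'" "0 < e" for Q' and e :: real
    using that(1,2)
  proof (induction Q' rule: finite_induct)
    case empty
    show ?case by (rule exI[of _ "{}"], rule exI[of _ 1]) simp
  next
    case (insert q Q')
    then obtain Q d where 1: "finite Q" "Q \<subseteq> P" "0 < d"
      "\<And>f g. f \<in> X \<Longrightarrow> g \<in> X \<Longrightarrow> \<forall>p\<in>Q. p (g - f) < d \<Longrightarrow> \<forall>q\<in>Q'. q (T g - T f) < e"
      by auto
    obtain R c where 2: "finite R" "R \<subseteq> P" "0 < c"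
      "\<And>f g. f \<in> X \<Longrightarrow> g \<in> X \<Longrightarrow> \<forall>p\<in>R. p (g - f) < c \<Longrightarrow> q (T g - T f) < e"
      using bound[of q e] insert.prems \<open>0 < e\<close> by auto
    show ?case
    proof (intro exI[of _ "Q \<union> R"] exI[of _ "min c d"] conjI ballI impI)
      fix f g r
      assume fg: "f \<in> X" "g \<in> X" and small: "\<forall>p\<in>Q \<union> R. p (g - f) < min c d" and r: "r \<in> insert q Q'"
      have "\<forall>p\<in>Q. p (g - f) < d" "\<forall>p\<in>R. p (g - f) < c" using small by auto
      with 1(4)[OF fg] 2(4)[OF fg] r show "r (T g - T f) < e" by auto
    qed (use 1 2 in auto)
  qed
  show "openin (seminorm_topology X P) {f \<in> X. T f \<in> U}"
    unfolding openin_seminorm_topology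
  proof (intro conjI ballI)
    fix f assume "f \<in> {f \<in> X. T f \<in> U}"
    then have f: "f \<in> X" "T f \<in> U" by auto
    obtain Q' e where Q': "finite Q'" "Q' \<subseteq> P'" "0 < e" "{g \<in> Y. \<forall>p\<in>Q'. p (g - T f) < e} \<subseteq> U"
      using U[OF f(2)] by blast
    obtain Q d where Q: "finite Q" "Q \<subseteq> P" "0 < d"
      "\<And>f g. f \<in> X \<Longrightarrow> g \<in> X \<Longrightarrow> \<forall>p\<in>Q. p (g - f) < d \<Longrightarrow> \<forall>q\<in>Q'. q (T g - T f) < e"
      using multi[OF Q'(1-3)] by blast
    have "{g \<in> X. \<forall>p\<in>Q. p (g - f) < d} \<subseteq> {f \<in> X. T f \<in> U}"
    proof
      fix g assume "g \<in> {g \<in> X. \<forall>p\<in>Q. p (g - f) < d}"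
      then have g: "g \<in> X" "\<forall>p\<in>Q. p (g - f) < d" by auto
      then have "T g \<in> {g \<in> Y. \<forall>p\<in>Q'. p (g - T f) < e}"
        using Q(4)[OF f(1) g] T by auto
      with Q'(4) g(1) show "g \<in> {f \<in> X. T f \<in> U}" by blast
    qed
    with Q show "\<exists>Q e. finite Q \<and> Q \<subseteq> P \<and> 0 < e \<and> {g \<in> X. \<forall>p\<in>Q. p (g - f) < e} \<subseteq> {f \<in> X. T f \<in> U}"
      by blast
  qed auto
qed

lemma HC_seminorm_upper:
  assumes F: "F \<in> schwartz_HC"
  shows "norm (complex_of_real x ^ j * F (basis_elt m) x) \<le> HC_seminorm j (basis_elt m) F"
proof -
  have "bdd_above (range (\<lambda>x. norm (complex_of_real x ^ j * Lact (basis_elt m) F 1 x)))"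
    using F by (simp add: schwartz_HC_def)
  from cSUP_upper[OF UNIV_I this, of x] show ?thesis
    by (simp add: HC_seminorm_def norm_mult norm_Lact_basis[OF schwartz_HC_Cinf[OF F]])
qed

lemma RH_seminorm_upper:
  assumes "A \<in> schwartz_RH"
  shows "norm (nth_deriv k (pairing A u) \<zeta>) \<le> RH_seminorm k u A"
  unfolding RH_seminorm_def using assms by (intro cSUP_upper) (auto simp: schwartz_RH_def)

lemma twist_basis:
  fixes F :: "'n::{finite,linorder} uhc \<Rightarrow> real \<Rightarrow> complex"
  assumes "F \<in> schwartz_HC"
  shows "twist F (basis_elt m) x = kappa TYPE('n) (bodd m) * F (basis_elt m) x"
  by (rule twist_homogeneous[OF schwartz_HC_Cinf[OF assms] homogeneous_basis])

text \<open>The k-th derivative of the transform is the transform of (-ix)^k w, whose quadratic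
  decay is measured by the seminorms with weights k and k + 2; \<open>norm_ft_le\<close> adds the
  factor pi.\<close>

lemma RH_seminorm_fourier_le:
  assumes F: "F \<in> schwartz_HC"
  shows "RH_seminorm k (basis_elt m) (fourier F)
    \<le> (HC_seminorm k (basis_elt m) F + HC_seminorm (k + 2) (basis_elt m) F) * pi"
  unfolding RH_seminorm_def
proof (rule cSUP_least)
  fix \<zeta>
  let ?w = "twist F (basis_elt m)"
  have S: "schwartz ?w" by (rule schwartz_twist[OF F])
  have n: "norm (?w x) = norm (F (basis_elt m) x)" for x
    by (simp add: twist_basis[OF F] norm_mult norm_kappa)
  have "quad_decay (HC_seminorm k (basis_elt m) F + HC_seminorm (k + 2) (basis_elt m) F)
      (\<lambda>x. (- \<i> * complex_of_real x) ^ k * ?w x)"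
  proof (rule quad_decayI)
    show "continuous_on UNIV (\<lambda>x. (- \<i> * complex_of_real x) ^ k * ?w x)"
      using smooth_continuous[OF schwartz_smooth[OF schwartz_power[OF S]], of 0] by simp
    show "norm ((- \<i> * complex_of_real x) ^ k * ?w x) \<le> HC_seminorm k (basis_elt m) F" for x
      using HC_seminorm_upper[OF F, of x k m] by (simp add: norm_mult norm_power n)
    show "norm (complex_of_real (x\<^sup>2) * ((- \<i> * complex_of_real x) ^ k * ?w x)) \<le> HC_seminorm (k + 2) (basis_elt m) F" for x
      using HC_seminorm_upper[OF F, of x "k + 2" m] by (simp add: norm_mult norm_power n power_add power2_eq_square mult_ac)
  qed
  from norm_ft_le[OF this, of \<zeta>]
  show "norm (nth_deriv k (pairing (fourier F) (basis_elt m)) \<zeta>)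
    \<le> (HC_seminorm k (basis_elt m) F + HC_seminorm (k + 2) (basis_elt m) F) * pi"
    by (simp only: pairing_fourier[OF F] nth_deriv_ft[OF S])
qed simp

lemma continuous_fourier:
  "continuous_map (top_schwartz_HC :: ('n::{finite,linorder} uhc \<Rightarrow> real \<Rightarrow> complex) topology) top_schwartz_RH fourier"
  unfolding top_schwartz_HC_def top_schwartz_RH_def
proof (rule continuous_map_seminormI)
  show "fourier F \<in> schwartz_RH" if "F \<in> schwartz_HC" for F :: "'n uhc \<Rightarrow> real \<Rightarrow> complex"
    using that by (rule fourier_schwartz_RH)
  let ?P = "range (\<lambda>(j, u). HC_seminorm j u) :: (('n uhc \<Rightarrow> real \<Rightarrow> complex) \<Rightarrow> real) set"
  fix q :: "(real \<Rightarrow> 'n hmat) \<Rightarrow> real" and e :: real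
  assume "q \<in> range (\<lambda>(k, j, J). RH_seminorm k (zgen ^ j * aprod J))" and e: "0 < e"
  then obtain k j J where q: "q = RH_seminorm k (basis_elt (Mon j J))"
    by (auto simp: basis_eq_monomial)
  let ?u = "basis_elt (Mon j J) :: 'n uhc"
  let ?Q = "{HC_seminorm k ?u, HC_seminorm (k + 2) ?u}"
  have "?Q \<subseteq> ?P" by (auto intro: range_eqI[of _ _ "(_, _)"])
  \<comment> \<open>The radius e / (2 pi) splits e over two seminorms and compensates the factor
    pi.\<close>
  moreover have "q (fourier G - fourier F) < e"
    if F: "F \<in> schwartz_HC" and G: "G \<in> schwartz_HC" and small: "\<forall>p\<in>?Q. p (G - F) < e / (2 * pi)" for F G
  proof -
    have "q (fourier G - fourier F) = q (fourier (G - F))"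
      by (simp only: fourier_diff[OF G F])
    also have "\<dots> \<le> (HC_seminorm k ?u (G - F) + HC_seminorm (k + 2) ?u (G - F)) * pi"
      unfolding q by (rule RH_seminorm_fourier_le[OF schwartz_HC_diff[OF G F]])
    also have "\<dots> < (e / (2 * pi) + e / (2 * pi)) * pi"
      using small by (intro mult_strict_right_mono add_strict_mono) auto
    also have "\<dots> = e" by simp
    finally show ?thesis .
  qed
  moreover have "0 < e / (2 * pi)" using e by simp
  ultimately show "\<exists>Q d. finite Q \<and> Q \<subseteq> ?P \<and> 0 < d \<and>
      (\<forall>F\<in>schwartz_HC. \<forall>G\<in>schwartz_HC. (\<forall>p\<in>Q. p (G - F) < d) \<longrightarrow> q (fourier G - fourier F) < e)"
    by (intro exI[of _ ?Q] exI[of _ "e / (2 * pi)"]) simp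
qed

section \<open>Continuity of the inverse transform\<close>

definition RH_seminorms :: "((real \<Rightarrow> 'n::{finite,linorder} hmat) \<Rightarrow> real) set" where
  "RH_seminorms = range (\<lambda>(k, j, J). RH_seminorm k (zgen ^ j * aprod J))"

text \<open>Smallness of x^j F(u; x), uniformly in x, in terms of the topology of the transform. The
  defining seminorms of \<open>top_schwartz_RH\<close> concern only monomials z^j a_J; in this form
  the property passes to linear combinations and so reaches every u.\<close>

definition controlled :: "nat \<Rightarrow> 'n::{finite,linorder} uhc \<Rightarrow> bool" where
  "controlled j u \<longleftrightarrow> (\<forall>e>0. \<exists>Q d. finite Q \<and> Q \<subseteq> RH_seminorms \<and> 0 < d \<and>
    (\<forall>F\<in>schwartz_HC. (\<forall>p\<in>Q. p (fourier F) < d) \<longrightarrow> (\<forall>x. norm (complex_of_real x ^ j * F u x) \<le> e)))"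

lemma RH_seminorm_basis: "RH_seminorm k (basis_elt m) \<in> RH_seminorms"
proof -
  have "RH_seminorm k (basis_elt m) = RH_seminorm k (zgen ^ zdeg m * aprod (gens m))"
    using basis_eq_monomial[of "zdeg m" "gens m"] by simp
  then show ?thesis unfolding RH_seminorms_def by (intro range_eqI[of _ _ "(k, zdeg m, gens m)"]) simp
qed

lemma controlled_basis: "controlled j (basis_elt m :: 'n::{finite,linorder} uhc)"
  unfolding controlled_def
proof (intro allI impI)
  fix e :: real assume e: "0 < e"
  let ?u = "\<lambda>l. basis_elt (Mon (l + zdeg m) (gens m)) :: 'n uhc"
  \<comment> \<open>The four quantities bounded in \<open>norm_ift_le\<close>, with multiplication
    by \<zeta>^l replaced by z^l; \<open>?c\<close> is the sum of the coefficients there.\<close>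
  let ?Q = "{RH_seminorm j (?u 0), RH_seminorm (j - 1) (?u 1), RH_seminorm j (?u 2), RH_seminorm (j - 2) (?u 0)}"
  let ?c = "1 + real (2 * j) + 1 + real (j * (j - 1))"
  have c: "?c > 0" by (simp add: add_pos_nonneg)
  have u: "?u l = zgen ^ l * basis_elt m" for l
    using basis_eq_monomial[of "l + zdeg m" "gens m"] basis_eq_monomial[of "zdeg m" "gens m"]
    by (simp add: power_add mult.assoc)
  have "norm (complex_of_real x ^ j * F (basis_elt m) x) \<le> e"
    if F: "F \<in> schwartz_HC" and small: "\<forall>p\<in>?Q. p (fourier F) < e / ?c" for F and x :: real
  proof -
    let ?h = "pairing (fourier F) (basis_elt m)"
    note A = fourier_schwartz_RH[OF F]
    have S: "schwartz ?h" by (rule schwartz_pairing[OF A])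
    have sm: "smooth (pairing (fourier F) v)" for v by (rule schwartz_smooth[OF schwartz_pairing[OF A]])
    have mult: "norm (nth_deriv k (\<lambda>\<zeta>. complex_of_real \<zeta> ^ l * ?h \<zeta>) \<zeta>)
        = norm (nth_deriv k (pairing (fourier F) (?u l)) \<zeta>)" for k l \<zeta>
    proof -
      have "(- \<i>) ^ l * (\<i> * complex_of_real \<zeta>) ^ l = complex_of_real \<zeta> ^ l" for \<zeta>
        by (simp add: power_mult_distrib[symmetric])
      then have "(\<lambda>\<zeta>. complex_of_real \<zeta> ^ l * ?h \<zeta>) = (\<lambda>\<zeta>. (- \<i>) ^ l * pairing (fourier F) (?u l) \<zeta>)"
        unfolding u pairing_zgen_power[OF A] mult.assoc[symmetric] by simp
      then show ?thesis by (simp add: nth_deriv_cmult[OF sm] norm_mult norm_power)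
    qed
    have b: "norm (nth_deriv k (pairing (fourier F) (?u l)) \<zeta>) \<le> e / ?c"
      if "RH_seminorm k (?u l) \<in> ?Q" for k l \<zeta>
      using RH_seminorm_upper[OF A, of k "?u l" \<zeta>] small that by fastforce
    have "norm (complex_of_real x ^ j * ift ?h x) \<le> e / ?c + real (2 * j) * (e / ?c) + e / ?c + real (j * (j - 1)) * (e / ?c)"
    proof (rule norm_ift_le[OF S])
      show "norm (nth_deriv j ?h \<zeta>) \<le> e / ?c" for \<zeta>
        using b[of j 0 \<zeta>] by (simp add: u)
      show "norm (nth_deriv (j - 1) (\<lambda>\<zeta>. complex_of_real \<zeta> * ?h \<zeta>) \<zeta>) \<le> e / ?c" for \<zeta>
        using b[of "j - 1" 1 \<zeta>] mult[of "j - 1" 1 \<zeta>] by simp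
      show "norm (nth_deriv j (\<lambda>\<zeta>. complex_of_real \<zeta> ^ 2 * ?h \<zeta>) \<zeta>) \<le> e / ?c" for \<zeta>
        using b[of j 2 \<zeta>] mult[of j 2 \<zeta>] by simp
      show "norm (nth_deriv (j - 2) ?h \<zeta>) \<le> e / ?c" for \<zeta>
        using b[of "j - 2" 0 \<zeta>] by (simp add: u)
    qed
    also have "\<dots> = ?c * (e / ?c)" by (simp only: distrib_right mult_1_left)
    also have "\<dots> = e" using c by simp
    also have "ift ?h = twist F (basis_elt m)"
      unfolding pairing_fourier[OF F] by (rule ift_ft[OF schwartz_twist[OF F]])
    finally show ?thesis by (simp add: twist_basis[OF F] norm_mult norm_kappa)
  qed
  moreover have "?Q \<subseteq> RH_seminorms" by (simp add: RH_seminorm_basis)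
  moreover have "0 < e / ?c" using e c by simp
  ultimately show "\<exists>Q d. finite Q \<and> Q \<subseteq> RH_seminorms \<and> 0 < d \<and>
    (\<forall>F\<in>schwartz_HC. (\<forall>p\<in>Q. p (fourier F) < d) \<longrightarrow> (\<forall>x. norm (complex_of_real x ^ j * F (basis_elt m) x) \<le> e))"
    by (intro exI[of _ ?Q] exI[of _ "e / ?c"]) simp
qed

lemma controlled: "controlled j (u :: 'n::{finite,linorder} uhc)"
proof (induction u rule: salg_induct)
  case (1 m)
  show ?case by (rule controlled_basis)
next
  case 2
  show ?case
    unfolding controlled_def
    by (auto intro!: exI[of _ "{}"] exI[of _ "1 :: real"] simp: Cinf_linear schwartz_HC_Cinf)
next
  case (3 u v)
  show ?case
    unfolding controlled_def
  proof (intro allI impI)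
    fix e :: real assume "0 < e"
    then have e: "0 < e / 2" by simp
    obtain Q d where 1: "finite Q" "Q \<subseteq> RH_seminorms" "0 < d"
      "\<And>F x. F \<in> schwartz_HC \<Longrightarrow> \<forall>p\<in>Q. p (fourier F) < d \<Longrightarrow> norm (complex_of_real x ^ j * F u x) \<le> e / 2"
      using 3(1) e unfolding controlled_def by meson
    obtain R c where 2: "finite R" "R \<subseteq> RH_seminorms" "0 < c"
      "\<And>F x. F \<in> schwartz_HC \<Longrightarrow> \<forall>p\<in>R. p (fourier F) < c \<Longrightarrow> norm (complex_of_real x ^ j * F v x) \<le> e / 2"
      using 3(2) e unfolding controlled_def by meson
    have "norm (complex_of_real x ^ j * F (u + v) x) \<le> e"
      if F: "F \<in> schwartz_HC" and small: "\<forall>p\<in>Q \<union> R. p (fourier F) < min c d" for F and x :: real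
    proof -
      have "\<forall>p\<in>Q. p (fourier F) < d" "\<forall>p\<in>R. p (fourier F) < c" using small by auto
      from 1(4)[OF F this(1), of x] 2(4)[OF F this(2), of x]
      have "norm (complex_of_real x ^ j * F u x) + norm (complex_of_real x ^ j * F v x) \<le> e" by simp
      then show ?thesis
        using norm_triangle_ineq[of "complex_of_real x ^ j * F u x" "complex_of_real x ^ j * F v x"]
        by (simp add: Cinf_linear[OF schwartz_HC_Cinf[OF F]] distrib_left)
    qed
    then show "\<exists>Q d. finite Q \<and> Q \<subseteq> RH_seminorms \<and> 0 < d \<and>
      (\<forall>F\<in>schwartz_HC. (\<forall>p\<in>Q. p (fourier F) < d) \<longrightarrow> (\<forall>x. norm (complex_of_real x ^ j * F (u + v) x) \<le> e))"
      using 1(1-3) 2(1-3) by (intro exI[of _ "Q \<union> R"] exI[of _ "min c d"]) simp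
  qed
next
  case (4 r u)
  show ?case
    unfolding controlled_def
  proof (intro allI impI)
    fix e :: real assume "0 < e"
    then have e: "0 < e / (\<bar>r\<bar> + 1)" by (simp add: add_nonneg_pos)
    obtain Q d where 1: "finite Q" "Q \<subseteq> RH_seminorms" "0 < d"
      "\<And>F x. F \<in> schwartz_HC \<Longrightarrow> \<forall>p\<in>Q. p (fourier F) < d \<Longrightarrow> norm (complex_of_real x ^ j * F u x) \<le> e / (\<bar>r\<bar> + 1)"
      using 4 e unfolding controlled_def by meson
    have "norm (complex_of_real x ^ j * F (r *\<^sub>R u) x) \<le> e"
      if F: "F \<in> schwartz_HC" and small: "\<forall>p\<in>Q. p (fourier F) < d" for F and x :: real
    proof -
      have "complex_of_real x ^ j * F (r *\<^sub>R u) x = complex_of_real r * (complex_of_real x ^ j * F u x)"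
        by (simp add: Cinf_linear[OF schwartz_HC_Cinf[OF F]])
      then have "norm (complex_of_real x ^ j * F (r *\<^sub>R u) x) = \<bar>r\<bar> * norm (complex_of_real x ^ j * F u x)"
        by (simp only: norm_mult[of "complex_of_real r"] norm_of_real)
      also have "\<dots> \<le> (\<bar>r\<bar> + 1) * (e / (\<bar>r\<bar> + 1))"
        by (intro mult_mono 1(4)[OF F small]) auto
      also have "\<dots> = e" by simp
      finally show ?thesis .
    qed
    then show "\<exists>Q d. finite Q \<and> Q \<subseteq> RH_seminorms \<and> 0 < d \<and>
      (\<forall>F\<in>schwartz_HC. (\<forall>p\<in>Q. p (fourier F) < d) \<longrightarrow> (\<forall>x. norm (complex_of_real x ^ j * F (r *\<^sub>R u) x) \<le> e))"
      using 1(1-3) by blast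
  qed
qed

definition inv_fourier :: "(real \<Rightarrow> 'n::{finite,linorder} hmat) \<Rightarrow> 'n uhc \<Rightarrow> real \<Rightarrow> complex" where
  "inv_fourier = the_inv_into schwartz_HC fourier"

lemma inj_on_fourier: "inj_on fourier schwartz_HC"
  by (rule inj_onI) (rule fourier_inject)

lemma inv_fourier:
  fixes A :: "real \<Rightarrow> 'n::{finite,linorder} hmat"
  assumes "A \<in> schwartz_RH"
  shows "inv_fourier A \<in> schwartz_HC" "fourier (inv_fourier A) = A"
proof -
  have A: "A \<in> fourier ` schwartz_HC" using fourier_surj[OF assms] by blast
  show "inv_fourier A \<in> schwartz_HC"
    unfolding inv_fourier_def by (rule the_inv_into_into[OF inj_on_fourier A order_refl])
  show "fourier (inv_fourier A) = A"
    unfolding inv_fourier_def by (rule f_the_inv_into_f[OF inj_on_fourier A])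
qed

lemma continuous_inv_fourier:
  "continuous_map top_schwartz_RH (top_schwartz_HC :: ('n::{finite,linorder} uhc \<Rightarrow> real \<Rightarrow> complex) topology) inv_fourier"
  unfolding top_schwartz_HC_def top_schwartz_RH_def RH_seminorms_def[symmetric]
proof (rule continuous_map_seminormI)
  show "inv_fourier A \<in> schwartz_HC" if "A \<in> schwartz_RH" for A :: "real \<Rightarrow> 'n hmat"
    using that by (rule inv_fourier)
  fix q :: "('n uhc \<Rightarrow> real \<Rightarrow> complex) \<Rightarrow> real" and e :: real
  assume "q \<in> range (\<lambda>(j, u). HC_seminorm j u)" and e: "0 < e"
  then obtain j u where q: "q = HC_seminorm j u" by auto
  let ?u = "\<lambda>p. antipode (parity_part p u)"
  \<comment> \<open>Each parity gets e / 4: a supremum yields only \<le>, and e / 2 < e restores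
    strictness.\<close>
  have e4: "0 < e / 4" using e by simp
  obtain Q d where 1: "finite Q" "Q \<subseteq> RH_seminorms" "0 < d"
    "\<And>F x. F \<in> schwartz_HC \<Longrightarrow> \<forall>p\<in>Q. p (fourier F) < d \<Longrightarrow> norm (complex_of_real x ^ j * F (?u False) x) \<le> e / 4"
    using controlled[of j "?u False"] e4 unfolding controlled_def by meson
  obtain R c where 2: "finite R" "R \<subseteq> RH_seminorms" "0 < c"
    "\<And>F x. F \<in> schwartz_HC \<Longrightarrow> \<forall>p\<in>R. p (fourier F) < c \<Longrightarrow> norm (complex_of_real x ^ j * F (?u True) x) \<le> e / 4"
    using controlled[of j "?u True"] e4 unfolding controlled_def by meson
  have "q (inv_fourier B - inv_fourier A) < e"
    if A: "A \<in> schwartz_RH" and B: "B \<in> schwartz_RH" and small: "\<forall>p\<in>Q \<union> R. p (B - A) < min c d" for A B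
  proof -
    let ?F = "inv_fourier B - inv_fourier A"
    have F: "?F \<in> schwartz_HC" by (intro schwartz_HC_diff inv_fourier A B)
    have "fourier ?F = B - A"
      by (simp only: fourier_diff[OF inv_fourier(1)[OF B] inv_fourier(1)[OF A]] inv_fourier(2)[OF A] inv_fourier(2)[OF B])
    then have s: "\<forall>p\<in>Q. p (fourier ?F) < d" "\<forall>p\<in>R. p (fourier ?F) < c" using small by auto
    have "q ?F \<le> e / 4 + e / 4"
      unfolding q HC_seminorm_def
    proof (rule cSUP_least)
      fix x :: real
      have "norm (complex_of_real x ^ j * Lact u ?F 1 x)
          = norm (complex_of_real x ^ j * ?F (?u False) x - complex_of_real x ^ j * ?F (?u True) x)"
        by (simp only: Lact_one[OF schwartz_HC_Cinf[OF F]] right_diff_distrib)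
      also have "\<dots> \<le> e / 4 + e / 4"
        by (intro order_trans[OF norm_triangle_ineq4] add_mono 1(4)[OF F s(1)] 2(4)[OF F s(2)])
      finally show "norm (complex_of_real x ^ j * Lact u ?F 1 x) \<le> e / 4 + e / 4" .
    qed simp
    then show ?thesis using e by simp
  qed
  then show "\<exists>Q d. finite Q \<and> Q \<subseteq> RH_seminorms \<and> 0 < d \<and>
      (\<forall>A\<in>schwartz_RH. \<forall>B\<in>schwartz_RH. (\<forall>p\<in>Q. p (B - A) < d) \<longrightarrow> q (inv_fourier B - inv_fourier A) < e)"
    using 1(1-3) 2(1-3) by (intro exI[of _ "Q \<union> R"] exI[of _ "min c d"]) simp
qed

lemma homeomorphic_map_fourier:
  "homeomorphic_map (top_schwartz_HC :: ('n::{finite,linorder} uhc \<Rightarrow> real \<Rightarrow> complex) topology) top_schwartz_RH fourier"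
proof -
  have "inv_fourier (fourier F) = F" if "F \<in> schwartz_HC" for F :: "'n uhc \<Rightarrow> real \<Rightarrow> complex"
    unfolding inv_fourier_def by (rule the_inv_into_f_f[OF inj_on_fourier that])
  then have "homeomorphic_maps (top_schwartz_HC :: ('n uhc \<Rightarrow> real \<Rightarrow> complex) topology) top_schwartz_RH fourier inv_fourier"
    unfolding homeomorphic_maps_def
    by (simp add: continuous_fourier continuous_inv_fourier) (simp add: top_schwartz_HC_def top_schwartz_RH_def inv_fourier)
  then show ?thesis unfolding homeomorphic_map_maps by blast
qed

lemma twist_inv_fourier:
  assumes A: "A \<in> schwartz_RH"
  shows "twist (inv_fourier A) u x = 1 / (2 * pi) * (LINT \<zeta>|lborel. pairing A u \<zeta> * exp (\<i> * x * \<zeta>))"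
proof -
  note F = inv_fourier[OF A]
  have "twist (inv_fourier A) u = ift (ft (twist (inv_fourier A) u))"
    by (rule ift_ft[OF schwartz_twist[OF F(1)], symmetric])
  also have "\<dots> = ift (pairing A u)"
    by (simp only: pairing_fourier[OF F(1), symmetric] F(2))
  finally show ?thesis by (simp only: ift_eq)
qed

theorem theorem2:
  shows "homeomorphic_map
      (top_schwartz_HC :: ('n::{finite,linorder} uhc \<Rightarrow> real \<Rightarrow> complex) topology)
      top_schwartz_RH fourier \<and>
    (\<forall>F \<in> schwartz_HC. \<forall>G \<in> schwartz_HC. \<forall>c d :: complex.
      fourier (\<lambda>(u :: 'n uhc) x. c * F u x + d * G u x)
        = (\<lambda>\<zeta>. hscale c (fourier F \<zeta>) + hscale d (fourier G \<zeta>))) \<and>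
    (even CARD('n) \<longrightarrow> (\<forall>A \<in> schwartz_RH. \<forall>(u :: 'n uhc) x.
      the_inv_into schwartz_HC fourier A u x
        = 1 / (2 * pi) * (LINT \<zeta>|lborel. pairing A u \<zeta> * exp (\<i> * x * \<zeta>)))) \<and>
    (odd CARD('n) \<longrightarrow> (\<forall>A \<in> schwartz_RH. \<forall>p. \<forall>(u :: 'n uhc) x. homogeneous p u \<longrightarrow>
      the_inv_into schwartz_HC fourier A u x
        = (if p then \<i> else - \<i>) / (2 * pi)
          * (LINT \<zeta>|lborel. pairing A u \<zeta> * exp (\<i> * x * \<zeta>))))"
  unfolding inv_fourier_def[symmetric]
proof (intro conjI impI ballI allI)
  show "homeomorphic_map (top_schwartz_HC :: ('n uhc \<Rightarrow> real \<Rightarrow> complex) topology) top_schwartz_RH fourier"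
    by (rule homeomorphic_map_fourier)
next
  fix F G :: "'n uhc \<Rightarrow> real \<Rightarrow> complex" and c d :: complex
  assume "F \<in> schwartz_HC" "G \<in> schwartz_HC"
  then show "fourier (\<lambda>u x. c * F u x + d * G u x) = (\<lambda>\<zeta>. hscale c (fourier F \<zeta>) + hscale d (fourier G \<zeta>))"
    by (rule fourier_linear)
next
  fix A :: "real \<Rightarrow> 'n hmat" and u :: "'n uhc" and x
  assume n: "even CARD('n)" and A: "A \<in> schwartz_RH"
  \<comment> \<open>For even n \<open>kappa\<close> is 1 on both parities, so that
    \<open>twist\<close> changes nothing.\<close>
  have "inv_fourier A u x = inv_fourier A (parity_part False u) x + inv_fourier A (parity_part True u) x"
    by (simp only: Cinf_linear(1)[OF schwartz_HC_Cinf[OF inv_fourier(1)[OF A]], symmetric] parity_part_sum[symmetric])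
  also have "\<dots> = twist (inv_fourier A) u x"
    using n by (simp add: twist_def kappa_def)
  finally show "inv_fourier A u x = 1 / (2 * pi) * (LINT \<zeta>|lborel. pairing A u \<zeta> * exp (\<i> * x * \<zeta>))"
    by (simp only: twist_inv_fourier[OF A])
next
  fix A :: "real \<Rightarrow> 'n hmat" and p and u :: "'n uhc" and x
  assume n: "odd CARD('n)" and A: "A \<in> schwartz_RH" and u: "homogeneous p u"
  have "inv_fourier A u x = inverse (kappa TYPE('n) p) * twist (inv_fourier A) u x"
    by (simp add: twist_homogeneous[OF schwartz_HC_Cinf[OF inv_fourier(1)[OF A]] u] kappa_nonzero)
  \<comment> \<open>For odd n the constant in the formula is 1 / \<open>kappa\<close>: the inverse
    of i on even u and of -i on odd u.\<close>
  also have "inverse (kappa TYPE('n) p) = (if p then \<i> else - \<i>)"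
    using n by (simp add: kappa_def)
  finally show "inv_fourier A u x = (if p then \<i> else - \<i>) / (2 * pi)
      * (LINT \<zeta>|lborel. pairing A u \<zeta> * exp (\<i> * x * \<zeta>))"
    by (simp add: twist_inv_fourier[OF A])
qed

end
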